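(* Let $M$ be a Noetherian $R_d$-module, $\alpha_M$ the corresponding algebraic $\mathbb{Z}^d$-action, and $H\in\mathsf{H}_d$ a half-space with outward unit normal $\mathbf{v}_H$. Then the following are equivalent. (1) $\alpha_M$ is expansive along $H$. (2) $\alpha_{R_d/\mathfrak{p}}$ is expansive along $H$ for every $\mathfrak{p}\in\operatorname{asc}(M)$. (3) For every $\mathfrak{p}\in\operatorname{asc}(M)$, $R_d/\mathfrak{p}$ is $R_H$-Noetherian and $[0,\infty)\mathbf{v}_H\cap\log|\mathsf{V}(\mathfrak{p})|=\emptyset$.
   Context: $R_d=\mathbb{Z}[u_1^{\pm1},\dots,u_d^{\pm1}]$ is the ring of Laurent polynomials in $d\ge1$ commuting variables, and $u^{\mathbf{n}}=u_1^{n_1}\cdots u_d^{n_d}$ for $\mathbf{n}\in\mathbb{Z}^d$. For an $R_d$-module $M$ (regarded as a discrete abelian group), $X_M=\widehat{M}$ is its compact Pontryagin dual, and $\alpha_M$ is the $\mathbb{Z}^d$-action by continuous automorphisms of $X_M$ for which $\alpha_M^{\mathbf{n}}$ is dual to multiplication by $u^{\mathbf{n}}$ on $M$. If $M$ is Noetherian then $M$ is countable, so $X_M$ is metrizable. A prime ideal $\mathfrak{p}\subset R_d$ is associated to $M$ if $\mathfrak{p}=\{f\in R_d: f\cdot m=0\}$ for some $m\in M$; $\operatorname{asc}(M)$ is the set of such primes. Expansiveness: for a $\mathbb{Z}^d$-action $\beta$ by homeomorphisms of a compact metric space $(X,\rho)$ and $F\subset\mathbb{R}^d$, put $\rho_\beta^F(x,y)=\sup\{\rho(\beta^{\mathbf{n}}x,\beta^{\mathbf{n}}y):\mathbf{n}\in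 F\cap\mathbb{Z}^d\}$ (and $0$ if $F\cap\mathbb{Z}^d=\emptyset$), and $F^t=\{\mathbf{x}\in\mathbb{R}^d:\operatorname{dist}(\mathbf{x},F)\le t\}$ (Euclidean distance). $\beta$ is expansive along $F$ if there are $\varepsilon>0$, $t>0$ such that $\rho_\beta^{F^t}(x,y)\le\varepsilon$ implies $x=y$. (This does not depend on the choice of compatible metric.) Half-spaces: $\mathsf{H}_d$ is the set of half-spaces $H_{\mathbf{v}}=\{\mathbf{x}\in\mathbb{R}^d:\mathbf{x}\cdot\mathbf{v}\le0\}$ with $\mathbf{v}\in\mathbb{R}^d$, $\|\mathbf{v}\|=1$; $\mathbf{v}$ is the outward unit normal of $H_{\mathbf{v}}$. For $H\in\mathsf{H}_d$, $R_H=\mathbb{Z}[u^{\mathbf{n}}:\mathbf{n}\in H\cap\mathbb{Z}^d]$, a subring of $R_d$. An $R_d$-module is $R_H$-Noetherian if it is Noetherian as an $R_H$-module (ascending chain condition on $R_H$-submodules). For an ideal $\mathfrak{a}\subset R_d$, $\mathsf{V}(\mathfrak{a})=\{\mathbf{z}\in(\mathbb{C}\setminus\{0\})^d: f(\mathbf{z})=0\text{ for all }f\in\mathfrak{a}\}$ and $\log|\mathsf{V}(\mathfrak{a})|=\{(\log|z_1|,\dots,\log|z_d|):\mathbf{z}\in\mathsf{V}(\mathfrak{a})\}\subset\mathbb{R}^d$. Also $[0,\infty)\mathbf{v}=\{t\mathbf{v}:t\ge0\}$. *)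

theory Defs
  imports
    "HOL-Analysis.Analysis"
    "HOL-Library.Poly_Mapping"
    "HOL-Algebra.QuotRing"
    "HOL-Algebra.Module"
    "HOL-Algebra.Generated_Rings"
begin

section \<open>Laurent polynomials\<close>

text \<open>
  The Laurent polynomial ring in \<open>d = CARD('d)\<close> variables is the group ring of
  \<open>\<int>\<^sup>d\<close>: finitely supported coefficient functions on exponent vectors,
  multiplied by convolution.
\<close>

type_synonym 'd laurent = "(int ^ 'd) \<Rightarrow>\<^sub>0 int"

definition laurent_ring :: "('d::finite) laurent ring" where
  "laurent_ring = \<lparr>carrier = UNIV, monoid.mult = (*), one = 1, ring.zero = 0, add = (+)\<rparr>"

lemma cring_laurent_ring: "cring (laurent_ring :: ('d::finite) laurent ring)"
proof -
  have "\<exists>g. g + f = 0" for f :: "'d laurent"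
    by (rule exI[of _ "- f"]) simp
  then show ?thesis
    by (intro cringI abelian_groupI comm_monoidI)
      (auto simp: laurent_ring_def algebra_simps)
qed

definition laurent_monom :: "int ^ 'd::finite \<Rightarrow> 'd laurent" where
  "laurent_monom n = Poly_Mapping.single n 1"

definition laurent_eval :: "('d::finite) laurent \<Rightarrow> complex ^ 'd \<Rightarrow> complex" where
  "laurent_eval f z =
     (\<Sum>n \<in> Poly_Mapping.keys f.
        of_int (Poly_Mapping.lookup f n) * (\<Prod>i\<in>UNIV. (z $ i) powi (n $ i)))"

definition laurent_variety :: "('d::finite) laurent set \<Rightarrow> (complex ^ 'd) set" where
  "laurent_variety I = {z. (\<forall>i. z $ i \<noteq> 0) \<and> (\<forall>f\<in>I. laurent_eval f z = 0)}"

definition log_abs :: "complex ^ 'd::finite \<Rightarrow> real ^ 'd" where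
  "log_abs z = (\<chi> i. ln (cmod (z $ i)))"


section \<open>Modules\<close>

text \<open>
  The prefix in \<open>Module.module\<close> distinguishes the locale of
  \<^theory>\<open>HOL-Algebra.Module\<close> from the type-class based \<open>Modules.module\<close>.
\<close>

locale noetherian_module = Module.module R M for R and M +
  assumes ascending_chain:
    "\<And>C :: nat \<Rightarrow> _ set.
       \<lbrakk>\<And>k. submodule (C k) R M; \<And>k. C k \<subseteq> C (Suc k)\<rbrakk> \<Longrightarrow> \<exists>N. \<forall>k\<ge>N. C k = C N"

text \<open>
  The ring \<open>R Quot I\<close> as an \<open>R\<close>-module: \<open>r\<close> acts on a coset as multiplication by the coset of \<open>r\<close>.
\<close>

definition quotient_module ::
    "('a, 'b) ring_scheme \<Rightarrow> 'a set \<Rightarrow> ('a, 'a set) module" where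
  "quotient_module R I =
     ring.extend (R Quot I) (module.fields (\<lambda>r A. rcoset_mult R I (I +>\<^bsub>R\<^esub> r) A))"

definition associated_primes ::
    "('a, 'b) ring_scheme \<Rightarrow> ('a, 'm, 'c) module_scheme \<Rightarrow> 'a set set" where
  "associated_primes R M =
     {p. primeideal p R \<and>
         (\<exists>m\<in>carrier M. p = {f \<in> carrier R. f \<odot>\<^bsub>M\<^esub> m = \<zero>\<^bsub>M\<^esub>})}"


section \<open>Half-spaces\<close>

definition lattice_point :: "int ^ 'd \<Rightarrow> real ^ 'd::finite" where
  "lattice_point n = (\<chi> i. of_int (n $ i))"

definition half_space :: "real ^ 'd::finite \<Rightarrow> (real ^ 'd) set" where
  "half_space v = {x. x \<bullet> v \<le> 0}"

definition half_space_ring :: "(real ^ 'd::finite) set \<Rightarrow> 'd laurent ring" where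
  "half_space_ring H =
     laurent_ring\<lparr>carrier :=
       generate_ring laurent_ring (laurent_monom ` {n. lattice_point n \<in> H})\<rparr>"


section \<open>Expansiveness along a set\<close>

text \<open>
  \<^const>\<open>infdist\<close> to the empty set is \<open>0\<close>, whereas the distance meant here is infinite.
\<close>

definition thicken :: "(real ^ 'd::finite) set \<Rightarrow> real \<Rightarrow> (real ^ 'd) set" where
  "thicken F t = {x. F \<noteq> {} \<and> infdist x F \<le> t}"

definition orbit_dist ::
    "('x \<Rightarrow> 'x \<Rightarrow> real) \<Rightarrow> (int ^ 'd::finite \<Rightarrow> 'x \<Rightarrow> 'x) \<Rightarrow> (real ^ 'd) set \<Rightarrow> 'x \<Rightarrow> 'x \<Rightarrow> real" where
  "orbit_dist \<rho> \<beta> F x y =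
     (if {n. lattice_point n \<in> F} = {} then 0
      else (SUP n\<in>{n. lattice_point n \<in> F}. \<rho> (\<beta> n x) (\<beta> n y)))"

definition metric_expansive_along ::
    "'x set \<Rightarrow> ('x \<Rightarrow> 'x \<Rightarrow> real) \<Rightarrow> (int ^ 'd::finite \<Rightarrow> 'x \<Rightarrow> 'x) \<Rightarrow> (real ^ 'd) set \<Rightarrow> bool" where
  "metric_expansive_along T \<rho> \<beta> F \<longleftrightarrow>
     (\<exists>\<epsilon>>0. \<exists>t>0. \<forall>x\<in>T. \<forall>y\<in>T. orbit_dist \<rho> \<beta> (thicken F t) x y \<le> \<epsilon> \<longrightarrow> x = y)"

definition compatible_metric :: "'x topology \<Rightarrow> ('x \<Rightarrow> 'x \<Rightarrow> real) \<Rightarrow> bool" where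
  "compatible_metric T \<rho> \<longleftrightarrow>
     Metric_space (topspace T) \<rho> \<and> Metric_space.mtopology (topspace T) \<rho> = T"

text \<open>
  For an action on a compact metrizable space, any compatible metric may be used; see
  \<open>expansive_along_iff\<close> below.
\<close>

definition expansive_along ::
    "'x topology \<Rightarrow> (int ^ 'd::finite \<Rightarrow> 'x \<Rightarrow> 'x) \<Rightarrow> (real ^ 'd) set \<Rightarrow> bool" where
  "expansive_along T \<beta> F \<longleftrightarrow>
     (\<exists>\<rho>. compatible_metric T \<rho> \<and> metric_expansive_along (topspace T) \<rho> \<beta> F)"

lemma compatible_metric_bounded:
  assumes "compact_space T" "compatible_metric T \<rho>"
  shows "\<exists>B. \<forall>x\<in>topspace T. \<forall>y\<in>topspace T. \<rho> x y \<le> B"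
proof -
  interpret Metric_space "topspace T" \<rho> using assms(2) by (simp add: compatible_metric_def)
  have "compactin mtopology (topspace T)"
    using assms by (simp add: compatible_metric_def compact_space_def)
  then show ?thesis
    using compactin_imp_mbounded mbounded_alt by blast
qed

lemma compatible_metrics_uniform:
  assumes T: "compact_space T" and \<rho>: "compatible_metric T \<rho>" and \<sigma>: "compatible_metric T \<sigma>"
    and e: "(e::real) > 0"
  shows "\<exists>d>0. \<forall>x\<in>topspace T. \<forall>y\<in>topspace T. \<sigma> x y < d \<longrightarrow> \<rho> x y < e"
proof -
  interpret r: Metric_space "topspace T" \<rho> using \<rho> by (simp add: compatible_metric_def)
  interpret s: Metric_space "topspace T" \<sigma> using \<sigma> by (simp add: compatible_metric_def)
  define m where "m = metric (topspace T, \<sigma>)"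
  define m' where "m' = metric (topspace T, \<rho>)"
  have [simp]: "mspace m = topspace T" "mdist m = \<sigma>" "mspace m' = topspace T" "mdist m' = \<rho>"
    by (simp_all add: m_def m'_def)
  have "mtopology_of m = T" "mtopology_of m' = T"
    using \<rho> \<sigma> by (simp_all add: mtopology_of_def compatible_metric_def)
  then have "uniformly_continuous_map m m' id"
    using T by (intro continuous_imp_uniformly_continuous_map) auto
  then show ?thesis
    using e by (force simp: uniformly_continuous_map_def)
qed

lemma expansive_along_iff:
  assumes T: "compact_space T" and \<sigma>: "compatible_metric T \<sigma>"
    and \<beta>: "\<And>n x. x \<in> topspace T \<Longrightarrow> \<beta> n x \<in> topspace T"
  shows "expansive_along T \<beta> F \<longleftrightarrow> metric_expansive_along (topspace T) \<sigma> \<beta> F"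
proof
  assume "metric_expansive_along (topspace T) \<sigma> \<beta> F"
  then show "expansive_along T \<beta> F" using \<sigma> by (auto simp: expansive_along_def)
next
  assume "expansive_along T \<beta> F"
  then obtain \<rho> \<epsilon> t where \<rho>: "compatible_metric T \<rho>" and \<epsilon>: "\<epsilon> > 0" and t: "t > 0"
    and exp: "\<And>x y. \<lbrakk>x \<in> topspace T; y \<in> topspace T; orbit_dist \<rho> \<beta> (thicken F t) x y \<le> \<epsilon>\<rbrakk> \<Longrightarrow> x = y"
    by (auto simp: expansive_along_def metric_expansive_along_def)
  obtain d where d: "d > 0"
    and dd: "\<And>x y. \<lbrakk>x \<in> topspace T; y \<in> topspace T; \<sigma> x y < d\<rbrakk> \<Longrightarrow> \<rho> x y < \<epsilon>"
    using compatible_metrics_uniform[OF T \<rho> \<sigma> \<epsilon>] by blast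
  obtain B where B: "\<And>x y. \<lbrakk>x \<in> topspace T; y \<in> topspace T\<rbrakk> \<Longrightarrow> \<sigma> x y \<le> B"
    using compatible_metric_bounded[OF T \<sigma>] by blast
  have "x = y" if xy: "x \<in> topspace T" "y \<in> topspace T"
    and le: "orbit_dist \<sigma> \<beta> (thicken F t) x y \<le> d / 2" for x y
  proof (rule exp[OF xy])
    let ?N = "{n. lattice_point n \<in> thicken F t}"
    show "orbit_dist \<rho> \<beta> (thicken F t) x y \<le> \<epsilon>"
    proof (cases "?N = {}")
      case True
      then show ?thesis using \<epsilon> by (simp add: orbit_dist_def)
    next
      case False
      have "\<rho> (\<beta> n x) (\<beta> n y) \<le> \<epsilon>" if n: "n \<in> ?N" for n
      proof -
        have "\<sigma> (\<beta> n x) (\<beta> n y) \<le> (SUP n\<in>?N. \<sigma> (\<beta> n x) (\<beta> n y))"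
          by (intro cSUP_upper n bdd_aboveI2[where M = B] B \<beta> xy)
        also have "\<dots> \<le> d / 2" using le unfolding orbit_dist_def if_not_P[OF False] .
        finally have "\<sigma> (\<beta> n x) (\<beta> n y) < d" using d by simp
        then show ?thesis using dd[OF \<beta> \<beta>] xy by (meson less_imp_le)
      qed
      then have "(SUP n\<in>?N. \<rho> (\<beta> n x) (\<beta> n y)) \<le> \<epsilon>" using False by (intro cSUP_least)
      then show ?thesis unfolding orbit_dist_def if_not_P[OF False] .
    qed
  qed
  then show "metric_expansive_along (topspace T) \<sigma> \<beta> F"
    unfolding metric_expansive_along_def
    by (intro exI[of _ "d / 2"] exI[of _ t] conjI ballI impI half_gt_zero d t)
qed


section \<open>The algebraic action dual to a module\<close>

text \<open>
  The Pontryagin dual of the discrete additive group of \<open>M\<close>: characters into the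
  complex unit circle, with the topology of pointwise convergence (which is the compact-open
  topology as \<open>M\<close> is discrete). Characters are \<^const>\<open>undefined\<close> off \<open>carrier M\<close>, so
  that they are determined by their values on \<open>M\<close>.
\<close>

definition characters :: "('m, 'b) ring_scheme \<Rightarrow> ('m \<Rightarrow> complex) set" where
  "characters M =
     {\<xi> \<in> carrier M \<rightarrow>\<^sub>E sphere 0 1.
        \<forall>x\<in>carrier M. \<forall>y\<in>carrier M. \<xi> (x \<oplus>\<^bsub>M\<^esub> y) = \<xi> x * \<xi> y}"

definition dual_space :: "('m, 'b) ring_scheme \<Rightarrow> ('m \<Rightarrow> complex) topology" where
  "dual_space M =
     subtopology (product_topology (\<lambda>_. top_of_set (sphere 0 1)) (carrier M)) (characters M)"

definition dual_action ::
    "(('d::finite) laurent, 'm, 'c) module_scheme \<Rightarrow> int ^ 'd \<Rightarrow> ('m \<Rightarrow> complex) \<Rightarrow> ('m \<Rightarrow> complex)" where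
  "dual_action M n \<xi> = (\<lambda>m\<in>carrier M. \<xi> (laurent_monom n \<odot>\<^bsub>M\<^esub> m))"

lemma compact_dual_space:
  assumes "abelian_monoid M"
  shows "compact_space (dual_space M)"
proof -
  interpret abelian_monoid M by fact
  let ?P = "product_topology (\<lambda>_. top_of_set (sphere 0 1 :: complex set)) (carrier M)"
  have P: "compact_space ?P"
    by (simp add: compact_space_product_topology compact_space_subtopology)
  have ev: "continuous_map ?P euclidean (\<lambda>\<xi>. \<xi> x)" if "x \<in> carrier M" for x
    using continuous_map_product_projection[OF that, of "\<lambda>_. top_of_set (sphere 0 1 :: complex set)"]
    by (simp add: continuous_map_in_subtopology)
  have cl: "closedin ?P {\<xi> \<in> topspace ?P. \<xi> (x \<oplus>\<^bsub>M\<^esub> y) = \<xi> x * \<xi> y}"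
    if "x \<in> carrier M" "y \<in> carrier M" for x y
  proof (rule closedin_continuous_maps_eq[where Y = euclidean])
    show "continuous_map ?P euclidean (\<lambda>\<xi>. \<xi> x * \<xi> y)"
      unfolding continuous_map_atin limitin_canonical_iff
    proof
      fix \<xi> assume \<xi>: "\<xi> \<in> topspace ?P"
      have lim: "((\<lambda>\<xi>. \<xi> z) \<longlongrightarrow> \<xi> z) (atin ?P \<xi>)" if "z \<in> carrier M" for z
        using ev[OF that] \<xi> unfolding continuous_map_atin limitin_canonical_iff by (rule bspec)
      show "((\<lambda>\<xi>. \<xi> x * \<xi> y) \<longlongrightarrow> \<xi> x * \<xi> y) (atin ?P \<xi>)"
        by (rule tendsto_mult[OF lim[OF that(1)] lim[OF that(2)]])
    qed
  qed (use ev that in auto)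
  have "closedin ?P (topspace ?P \<inter>
      (\<Inter>x\<in>carrier M. \<Inter>y\<in>carrier M. {\<xi> \<in> topspace ?P. \<xi> (x \<oplus>\<^bsub>M\<^esub> y) = \<xi> x * \<xi> y}))"
    using zero_closed by (intro closedin_Int closedin_topspace closedin_INT cl) auto
  also have "topspace ?P \<inter>
      (\<Inter>x\<in>carrier M. \<Inter>y\<in>carrier M. {\<xi> \<in> topspace ?P. \<xi> (x \<oplus>\<^bsub>M\<^esub> y) = \<xi> x * \<xi> y}) = characters M"
    by (auto simp: characters_def)
  finally show ?thesis
    using closedin_compact_space[OF P] by (simp add: dual_space_def compact_space_subtopology)
qed

lemma metrizable_dual_space: "countable (carrier M) \<Longrightarrow> metrizable_space (dual_space M)"
  unfolding dual_space_def
  by (intro metrizable_space_subtopology)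
     (auto simp: metrizable_space_product_topology metrizable_space_subtopology
           metrizable_space_euclidean intro: countable_subset)

lemma dual_action_closed:
  assumes "Module.module laurent_ring M" "\<xi> \<in> topspace (dual_space M)"
  shows "dual_action M n \<xi> \<in> topspace (dual_space M)"
proof -
  interpret Module.module laurent_ring M by fact
  have "laurent_monom n \<in> carrier laurent_ring"
    by (simp add: laurent_ring_def)
  then show ?thesis using assms(2)
    by (auto simp: dual_space_def characters_def dual_action_def PiE_iff smult_r_distr)
qed

lemma quotient_module_simps:
  "carrier (quotient_module R I) = carrier (R Quot I)"
  "add (quotient_module R I) = add (R Quot I)"
  "zero (quotient_module R I) = zero (R Quot I)"
  "smult (quotient_module R I) r A = rcoset_mult R I (I +>\<^bsub>R\<^esub> r) A"
  by (simp_all add: quotient_module_def ring.defs module.defs)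

lemma (in ideal) quotient_module_is_module:
  assumes "cring R"
  shows "Module.module R (quotient_module R I)"
proof -
  interpret Q: cring "R Quot I" by (rule quotient_is_cring[OF assms])
  note hom = rcos_ring_hom
  have mem: "I +> r \<in> carrier (R Quot I)" if "r \<in> carrier R" for r
    using ring_hom_closed[OF hom that] .
  have mult: "rcoset_mult R I A B = A \<otimes>\<^bsub>R Quot I\<^esub> B" for A B
    by (simp add: FactRing_def)
  have grp: "abelian_group (quotient_module R I)"
  proof (rule abelian_groupI, unfold quotient_module_simps)
    fix x y z
    assume xyz: "x \<in> carrier (R Quot I)" "y \<in> carrier (R Quot I)" "z \<in> carrier (R Quot I)"
    then show "x \<oplus>\<^bsub>R Quot I\<^esub> y \<oplus>\<^bsub>R Quot I\<^esub> z = x \<oplus>\<^bsub>R Quot I\<^esub> (y \<oplus>\<^bsub>R Quot I\<^esub> z)"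
      by (rule Q.a_assoc)
  next
    fix x y
    assume "x \<in> carrier (R Quot I)" "y \<in> carrier (R Quot I)"
    then show "x \<oplus>\<^bsub>R Quot I\<^esub> y = y \<oplus>\<^bsub>R Quot I\<^esub> x" by (rule Q.a_comm)
  qed (auto intro: Q.add.l_inv_ex)
  show ?thesis
    by (rule Module.moduleI[OF assms grp])
      (use mem in \<open>simp_all add: quotient_module_simps mult ring_hom_add[OF hom] ring_hom_mult[OF hom]
         ring_hom_one[OF hom] Q.l_distr Q.r_distr Q.m_assoc\<close>)
qed

end

theory Submission
  imports Defs "HOL-Complex_Analysis.Great_Picard"
begin

text \<open>
  Write \<open>R\<close> for the Laurent polynomial ring, \<open>R\<^sub>H\<close> for its subring of polynomials supported in the
  half-space \<open>H\<close> with outward normal \<open>v\<close>, and \<open>\<aa>\<close> for the annihilator of a module. All three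
  statements of the theorem are compared with one condition on an ideal (\<open>half_condition\<close>):
  \<open>\<aa>\<close> contains some \<open>1 - g\<close> with \<open>g\<close> supported in the open half-space, and the ray
  \<open>[0,\<infinity>)v\<close> avoids \<open>log|V(\<aa>)|\<close>. The central fact, \<open>expansive_iff_half_condition\<close>, is that the dual
  action of a finitely generated module is expansive along \<open>H\<close> if and only if its annihilator has
  this property. It applies to \<open>M\<close> and to each \<open>R/\<pp>\<close>, whose annihilator is \<open>\<pp>\<close>.

  Expansiveness is first rewritten: for some finite set \<open>S\<close> in the module and some \<open>\<delta> > 0\<close>, the only
  character that is \<open>\<delta>\<close>-close to 1 on all \<open>u\<^sup>n m\<close> with \<open>n \<in> H\<close> and \<open>m \<in> S\<close> is the trivial one.

  Necessity. A proper subgroup is annihilated by a nontrivial character (\<open>character_separates\<close>), so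
  \<open>S\<close> generates the module over \<open>R\<^sub>H\<close>. As each monomial acts invertibly, the module is also generated
  with coefficients in the open half-space, and \<open>nakayama\<close> yields \<open>1 - g \<in> \<aa>\<close>. A point
  \<open>z \<in> V(\<aa>)\<close> admits a nonzero additive map \<open>\<phi>\<close> to the complex numbers with \<open>\<phi>(fm) = f(z) \<phi>(m)\<close>
  (\<open>evaluation_functional\<close>). If \<open>log|z|\<close> lies on the ray, then \<open>|z\<^sup>n| \<le> 1\<close> on \<open>H\<close>, and the
  characters \<open>m \<mapsto> exp(i Re(c \<phi>(m)))\<close> with small \<open>c\<close> contradict expansiveness.

  Sufficiency. If the action is not expansive, the arguments of characters that come closer and
  closer to 1 converge, after rescaling and translation, to a bounded nonzero function on the
  lattice points of \<open>H\<close> that satisfies the linear recurrences given by the elements of \<open>\<aa>\<close>. The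
  space of all such functions is invariant under shifts and closed under bounded pointwise limits,
  and in such a space every shift has an eigenfunction (\<open>eigenfunction\<close>, by Liouville's theorem).
  A joint eigenfunction for the shifts along a basis of the lattice is \<open>n \<mapsto> z\<^sup>n\<close> up to a constant; the recurrences
  put \<open>z\<close> into \<open>V(\<aa>)\<close>, and boundedness on \<open>H\<close> puts \<open>log|z|\<close> on the ray.

  Finally, \<open>annihilator_meets\<close> says that a multiplicative set meeting every associated prime of a
  Noetherian module meets its annihilator. Taking the set of all \<open>1 - g\<close>, and the set of all \<open>f\<close>
  with \<open>f(z) \<noteq> 0\<close>, shows that \<open>\<aa>\<close> has the property exactly if all associated primes have it. And
  \<open>R/\<pp>\<close> is Noetherian over \<open>R\<^sub>H\<close> exactly if some \<open>1 - g\<close> lies in \<open>\<pp>\<close>: such an element makes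
  every \<open>R\<^sub>H\<close>-submodule an \<open>R\<close>-submodule, and conversely it is produced by the chain of the
  submodules generated over \<open>R\<^sub>H\<close> by higher and higher monomials.
\<close>

section \<open>Eigenfunctions in shift-invariant spaces of bounded functions\<close>

text \<open>
  A quadratic bound for the error of the linear approximation; for resolvents it comes from the
  resolvent identity.
\<close>

lemma has_field_derivative_quadratic_error:
  fixes f :: "complex \<Rightarrow> complex"
  assumes "\<And>x. cmod (f x - f a - (x - a) * D) \<le> C * (cmod (x - a))\<^sup>2"
  shows "(f has_field_derivative D) (at a)"
proof -
  have "(\<lambda>x. (f x - f a) / (x - a) - D) \<midarrow>a\<rightarrow> 0"
  proof (rule Lim_null_comparison)
    show "\<forall>\<^sub>F x in at a. cmod ((f x - f a) / (x - a) - D) \<le> C * cmod (x - a)"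
    proof (rule eventually_at_topological[THEN iffD2], intro exI[of _ UNIV] conjI ballI impI)
      fix x assume "x \<noteq> a"
      then have "cmod ((f x - f a) / (x - a) - D) = cmod (f x - f a - (x - a) * D) / cmod (x - a)"
        by (simp add: diff_divide_distrib norm_divide [symmetric])
      also have "\<dots> \<le> C * (cmod (x - a))\<^sup>2 / cmod (x - a)"
        by (intro divide_right_mono assms) simp
      also have "\<dots> = C * cmod (x - a)" using \<open>x \<noteq> a\<close> by (simp add: power2_eq_square)
      finally show "cmod ((f x - f a) / (x - a) - D) \<le> C * cmod (x - a)" .
    qed auto
    show "(\<lambda>x. C * cmod (x - a)) \<midarrow>a\<rightarrow> 0"
      by (rule tendsto_eq_intros | simp)+
  qed
  then show ?thesis by (simp add: has_field_derivative_iff LIM_zero_iff)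
qed

lemma near_maximum:
  fixes w :: "'i \<Rightarrow> complex"
  assumes B: "\<And>i. cmod (w i) \<le> B" and j: "w j \<noteq> 0"
  shows "\<exists>i. w i \<noteq> 0 \<and> (\<forall>k. cmod (w k) \<le> 2 * cmod (w i))"
proof -
  define N where "N = (SUP i. cmod (w i))"
  have bd: "bdd_above (range (\<lambda>i. cmod (w i)))" using B by (auto intro!: bdd_aboveI)
  have le: "cmod (w i) \<le> N" for i unfolding N_def by (rule cSUP_upper[OF _ bd]) simp
  have "0 < cmod (w j)" using j by simp
  then have "0 < N" using le[of j] by linarith
  then have "N / 2 < N" by simp
  then obtain i where i: "N / 2 < cmod (w i)"
    unfolding N_def using less_cSUP_iff[OF _ bd] by blast
  show ?thesis
  proof (intro exI[of _ i] conjI allI)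
    show "w i \<noteq> 0" using i \<open>0 < N\<close> by auto
    show "cmod (w k) \<le> 2 * cmod (w i)" for k using le[of k] i by simp
  qed
qed

text \<open>
  The maps in \<open>\<Gamma>\<close> play the role of shifts. By \<open>reach\<close> they move the base point \<open>b\<close> onto the
  support of every member of \<open>W\<close>, so a nonzero member can be translated to one that is nonzero at
  \<open>b\<close> and nearly maximal there; hence norms do not get lost in pointwise limits.
\<close>

locale shift_space =
  fixes W :: "('i::countable \<Rightarrow> complex) set" and \<Gamma> :: "('i \<Rightarrow> 'i) set" and b :: 'i
  assumes lin: "\<lbrakk>w \<in> W; w' \<in> W\<rbrakk> \<Longrightarrow> (\<lambda>i. a * w i + w' i) \<in> W"
    and bdd: "w \<in> W \<Longrightarrow> \<exists>B. \<forall>i. cmod (w i) \<le> B"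
    and lim: "\<lbrakk>\<And>k::nat. s k \<in> W; \<And>k i. cmod (s k i) \<le> B; \<And>i. (\<lambda>k. s k i) \<longlonglongrightarrow> l i\<rbrakk> \<Longrightarrow> l \<in> W"
    and shift: "\<lbrakk>\<gamma> \<in> \<Gamma>; w \<in> W\<rbrakk> \<Longrightarrow> w \<circ> \<gamma> \<in> W"
    and comm: "\<lbrakk>\<gamma> \<in> \<Gamma>; \<gamma>' \<in> \<Gamma>\<rbrakk> \<Longrightarrow> \<gamma> \<circ> \<gamma>' = \<gamma>' \<circ> \<gamma>"
    and reach: "\<lbrakk>w \<in> W; w i \<noteq> 0\<rbrakk> \<Longrightarrow> \<exists>\<gamma>\<in>\<Gamma>. \<gamma> b = i"
begin

lemma zero: assumes "w \<in> W" shows "(\<lambda>i. 0) \<in> W"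
  using lin[OF assms assms, of "-1"] by simp

lemma scale: assumes "w \<in> W" shows "(\<lambda>i. a * w i) \<in> W"
  using lin[OF assms zero[OF assms], of a] by simp

lemma diff: assumes "w \<in> W" "w' \<in> W" shows "(\<lambda>i. w i - w' i) \<in> W"
  using lin[OF assms(2) assms(1), of "-1"] by simp

lemma comm': "\<lbrakk>\<gamma> \<in> \<Gamma>; \<gamma>' \<in> \<Gamma>\<rbrakk> \<Longrightarrow> \<gamma> (\<gamma>' i) = \<gamma>' (\<gamma> i)"
  using comm by (metis comp_apply)

lemma normalise:
  assumes "w \<in> W" "w j \<noteq> 0"
  obtains \<gamma> s where "\<gamma> \<in> \<Gamma>" "s * w (\<gamma> b) = 1"
    "\<And>i. cmod (s * w i) \<le> 2" "cmod s * cmod (w j) \<le> 2"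
proof -
  obtain B where "\<And>i. cmod (w i) \<le> B" using bdd[OF assms(1)] by blast
  from near_maximum[of w B j, OF this assms(2)] obtain i where wi: "w i \<noteq> 0"
    and le: "\<forall>k. cmod (w k) \<le> 2 * cmod (w i)" by (elim exE conjE)
  obtain \<gamma> where \<gamma>: "\<gamma> \<in> \<Gamma>" "\<gamma> b = i" using reach[OF assms(1) wi] by (rule bexE)
  have l2: "cmod (1 / w i * w k) \<le> 2" for k
    using spec[OF le, of k] wi by (simp add: norm_divide divide_le_eq)
  show thesis
    by (rule that[of \<gamma> "1 / w i"]) (use \<gamma> wi l2[of j] l2 in \<open>simp_all add: norm_mult norm_divide\<close>)
qed

lemma compactness:
  assumes "\<And>k. s k \<in> W" "\<And>k i. cmod (s k i) \<le> B"
  obtains r l where "strict_mono (r::nat \<Rightarrow> nat)" "l \<in> W" "\<And>i. (\<lambda>k. s (r k) i) \<longlonglongrightarrow> l i"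
proof -
  obtain r where r: "strict_mono (r::nat \<Rightarrow> nat)" "\<And>x. x \<in> UNIV \<Longrightarrow> \<exists>l. (\<lambda>n. s (r n) x) \<longlonglongrightarrow> l"
    using function_convergent_subsequence[of "UNIV :: 'i set" s B] assms(2) by auto
  then obtain l where l: "\<And>i. (\<lambda>k. s (r k) i) \<longlonglongrightarrow> l i" by (metis UNIV_I)
  show thesis by (rule that[OF r(1) _ l]) (rule lim[OF assms(1) assms(2) l])
qed

text \<open>
  Banach's fixed point theorem for the supremum norm. The iterates converge uniformly, so that
  \<open>lim\<close> keeps the limit in \<open>W\<close>.
\<close>

lemma contraction_fixpoint:
  assumes T: "\<And>y. y \<in> W \<Longrightarrow> T y \<in> W" and q: "0 \<le> q" "q < 1" and ne: "y0 \<in> W"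
    and lip: "\<And>y y' D. \<lbrakk>y \<in> W; y' \<in> W; \<And>i. cmod (y i - y' i) \<le> D\<rbrakk> \<Longrightarrow> \<forall>i. cmod (T y i - T y' i) \<le> q * D"
  shows "\<exists>y\<in>W. T y = y"
proof -
  define s where "s k = (T ^^ k) y0" for k
  have sW: "s k \<in> W" for k by (induction k) (auto simp: s_def ne T)
  have sS: "s (Suc k) = T (s k)" for k by (simp add: s_def)
  obtain D where D: "\<And>i. cmod (s 1 i - s 0 i) \<le> D" using bdd[OF diff[OF sW sW]] by blast
  have step: "\<forall>i. cmod (s (Suc k) i - s k i) \<le> q ^ k * D" for k
  proof (induction k)
    case 0 then show ?case using D by simp
  next
    case (Suc k)
    then show ?case using lip[OF sW sW, of "Suc k" k "q ^ k * D"] by (simp add: sS mult.assoc)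
  qed
  have D0: "0 \<le> D" using D norm_ge_zero order_trans by blast
  have geo: "(\<lambda>k. q ^ k * D) sums (D / (1 - q))"
    using sums_mult2[OF geometric_sums[of q], of D] q by simp
  have tail: "(\<lambda>j. q ^ (j + k) * D) sums (q ^ k * (D / (1 - q)))" for k
    using sums_mult[OF geo, of "q ^ k"] by (simp add: power_add mult_ac)
  define l where "l i = s 0 i + suminf (\<lambda>k. s (Suc k) i - s k i)" for i
  have summ: "summable (\<lambda>k. s (Suc k) i - s k i)" for i
    by (rule summable_comparison_test'[OF sums_summable[OF geo], of 0]) (use step in auto)
  have partial: "(\<Sum>j<k. s (Suc j) i - s j i) = s k i - s 0 i" for k i
    by (rule sum_lessThan_telescope)
  have conv: "(\<lambda>k. s k i) \<longlonglongrightarrow> l i" for i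
  proof -
    have "(\<lambda>k. \<Sum>j<k. s (Suc j) i - s j i) \<longlonglongrightarrow> suminf (\<lambda>k. s (Suc k) i - s k i)"
      by (rule summable_LIMSEQ[OF summ])
    then have "(\<lambda>k. s k i - s 0 i + s 0 i) \<longlonglongrightarrow> suminf (\<lambda>k. s (Suc k) i - s k i) + s 0 i"
      unfolding partial by (rule tendsto_add) simp
    then show ?thesis by (simp add: l_def add.commute)
  qed
  have far: "cmod (s (k + m) i - s k i) \<le> q ^ k * (D / (1 - q))" for k m i
  proof -
    have "s (k + m) i - s k i = (\<Sum>j<m. s (Suc (k + j)) i - s (k + j) i)"
      using sum_lessThan_telescope[of "\<lambda>j. s (k + j) i" m] by simp
    also have "cmod \<dots> \<le> (\<Sum>j<m. q ^ (j + k) * D)"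
      by (rule sum_norm_le) (use step in \<open>simp add: add.commute\<close>)
    also have "\<dots> \<le> q ^ k * (D / (1 - q))"
      using sum_le_suminf[OF sums_summable[OF tail[of k]], of "{..<m}"] sums_unique[OF tail[of k]] q D0
      by simp
    finally show ?thesis .
  qed
  have near: "cmod (l i - s k i) \<le> q ^ k * (D / (1 - q))" for k i
  proof (rule LIMSEQ_le_const2)
    show "(\<lambda>m. cmod (s (k + m) i - s k i)) \<longlonglongrightarrow> cmod (l i - s k i)"
      using LIMSEQ_ignore_initial_segment[OF conv[of i], of k]
      by (intro tendsto_intros) (simp add: add.commute)
  qed (use far in blast)
  obtain B where B: "\<And>i. cmod (s 0 i) \<le> B" using bdd[OF sW] by blast
  have "cmod (s k i) \<le> B + D / (1 - q)" for k i
    using far[of 0 k i] B[of i] norm_triangle_ineq[of "s k i - s 0 i" "s 0 i"] by simp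
  then have lW: "l \<in> W" using lim[OF sW _ conv] by blast
  have "T l i = l i" for i
  proof -
    have c1: "cmod (T l i - s (Suc k) i) \<le> q * (q ^ k * (D / (1 - q)))" for k
      using lip[OF lW sW near] by (simp add: sS)
    have "(\<lambda>k. q * (q ^ k * (D / (1 - q)))) \<longlonglongrightarrow> q * (0 * (D / (1 - q)))"
      using q by (intro tendsto_intros LIMSEQ_realpow_zero) auto
    then have "(\<lambda>k. q * (q ^ k * (D / (1 - q)))) \<longlonglongrightarrow> 0" by simp
    then have "(\<lambda>k. T l i - s (Suc k) i) \<longlonglongrightarrow> 0"
      by (rule Lim_null_comparison[rotated]) (use c1 in simp)
    moreover have "(\<lambda>k. T l i - s (Suc k) i) \<longlonglongrightarrow> T l i - l i"
      by (intro tendsto_intros LIMSEQ_Suc conv)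
    ultimately show ?thesis using LIMSEQ_unique by fastforce
  qed
  then show ?thesis using lW by blast
qed

text \<open>
  The argument is that of the Gelfand--Mazur theorem. Without an eigenfunction the operator
  \<open>w \<circ> \<sigma> - \<kappa> w\<close> would be bounded below uniformly in \<open>\<kappa>\<close>: normalised almost eigenfunctions have
  a nonzero pointwise limit, which is an exact one. Then it is invertible for all \<open>\<kappa>\<close>, since the set
  of good \<open>\<kappa>\<close> is open, closed and contains 2. The value at \<open>b\<close> of the resolvent is entire
  and tends to 0 at infinity, so it vanishes, although the resolvent at 0 is onto.
\<close>

lemma eigenfunction:
  assumes \<sigma>: "\<sigma> \<in> \<Gamma>" and w0: "w0 \<in> W" "w0 j0 \<noteq> 0"
  shows "\<exists>\<kappa>. \<exists>y\<in>W. y b \<noteq> 0 \<and> (\<forall>i. y (\<sigma> i) = \<kappa> * y i)"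
proof (rule ccontr)
  assume no: "\<nexists>\<kappa>. \<exists>y\<in>W. y b \<noteq> 0 \<and> (\<forall>i. y (\<sigma> i) = \<kappa> * y i)"
  have "\<exists>c>0. \<forall>\<kappa>. \<forall>w\<in>W. \<forall>D. (\<forall>i. cmod (w (\<sigma> i) - \<kappa> * w i) \<le> D) \<longrightarrow> (\<forall>i. c * cmod (w i) \<le> D)"
  proof (rule ccontr)
    assume neg: "\<not> ?thesis"
    have "\<exists>\<kappa> y. y \<in> W \<and> y b = 1 \<and> (\<forall>i. cmod (y i) \<le> 2) \<and>
        (\<forall>i. cmod (y (\<sigma> i) - \<kappa> * y i) \<le> 2 / real (Suc k))" for k
    proof -
      have "1 / real (Suc k) > 0" by simp
      then have "\<not> (\<forall>\<kappa>. \<forall>w\<in>W. \<forall>D. (\<forall>i. cmod (w (\<sigma> i) - \<kappa> * w i) \<le> D) \<longrightarrow>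
          (\<forall>i. 1 / real (Suc k) * cmod (w i) \<le> D))"
        using neg by blast
      then obtain \<kappa> w D j where w: "w \<in> W" and D: "\<And>i. cmod (w (\<sigma> i) - \<kappa> * w i) \<le> D"
        and "\<not> 1 / real (Suc k) * cmod (w j) \<le> D"
        by blast
      then have j: "D < 1 / real (Suc k) * cmod (w j)" by linarith
      have D0: "0 \<le> D" using D norm_ge_zero order_trans by blast
      then have "w j \<noteq> 0" using j by auto
      obtain \<gamma> s where \<gamma>: "\<gamma> \<in> \<Gamma>" and s: "s * w (\<gamma> b) = 1"
        "\<And>i. cmod (s * w i) \<le> 2" "cmod s * cmod (w j) \<le> 2"
        by (rule normalise[OF w \<open>w j \<noteq> 0\<close>]) (rule that)
      have "cmod s * D \<le> cmod s * (1 / real (Suc k) * cmod (w j))"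
        using j by (intro mult_left_mono) auto
      also have "\<dots> = (cmod s * cmod (w j)) / real (Suc k)" by simp
      also have "\<dots> \<le> 2 / real (Suc k)" using s(3) by (intro divide_right_mono) auto
      finally have sD: "cmod s * D \<le> 2 / real (Suc k)" .
      show ?thesis
      proof (intro exI[of _ \<kappa>] exI[of _ "\<lambda>i. s * (w \<circ> \<gamma>) i"] conjI allI)
        show "(\<lambda>i. s * (w \<circ> \<gamma>) i) \<in> W" by (rule scale[OF shift[OF \<gamma> w]])
        fix i
        have "cmod (s * (w \<circ> \<gamma>) (\<sigma> i) - \<kappa> * (s * (w \<circ> \<gamma>) i)) = cmod s * cmod (w (\<sigma> (\<gamma> i)) - \<kappa> * w (\<gamma> i))"
          using comm'[OF \<gamma> \<sigma>] by (simp add: norm_mult [symmetric] algebra_simps)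
        also have "\<dots> \<le> cmod s * D" by (intro mult_left_mono D) simp
        finally show "cmod (s * (w \<circ> \<gamma>) (\<sigma> i) - \<kappa> * (s * (w \<circ> \<gamma>) i)) \<le> 2 / real (Suc k)"
          using sD by simp
      qed (use s in auto)
    qed
    then have "\<forall>k. \<exists>\<kappa> y. y \<in> W \<and> y b = 1 \<and> (\<forall>i. cmod (y i) \<le> 2) \<and>
        (\<forall>i. cmod (y (\<sigma> i) - \<kappa> * y i) \<le> 2 / real (Suc k))" by (rule allI)
    from choice[OF this] obtain \<Lambda> where
      "\<forall>k. \<exists>y. y \<in> W \<and> y b = 1 \<and> (\<forall>i. cmod (y i) \<le> 2) \<and>
        (\<forall>i. cmod (y (\<sigma> i) - \<Lambda> k * y i) \<le> 2 / real (Suc k))" by (rule exE)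
    from choice[OF this] obtain Y where Y: "\<And>k. Y k \<in> W" "\<And>k. Y k b = 1" "\<And>k i. cmod (Y k i) \<le> 2"
      "\<And>k i. cmod (Y k (\<sigma> i) - \<Lambda> k * Y k i) \<le> 2 / real (Suc k)" by blast
    obtain r y where r: "strict_mono (r::nat \<Rightarrow> nat)" and y: "y \<in> W"
      and lim_y: "\<And>i. (\<lambda>k. Y (r k) i) \<longlonglongrightarrow> y i"
      by (rule compactness[of Y 2, OF Y(1,3)]) (rule that)
    have z: "(\<lambda>k. 2 / real (Suc (r k))) \<longlonglongrightarrow> 0"
    proof -
      have "(\<lambda>k. 2 / real (Suc k)) \<longlonglongrightarrow> 0" by real_asymp
      from LIMSEQ_subseq_LIMSEQ[OF this r] show ?thesis by (simp add: o_def)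
    qed
    have res: "(\<lambda>k. Y (r k) (\<sigma> i) - \<Lambda> (r k) * Y (r k) i) \<longlonglongrightarrow> 0" for i
      by (rule Lim_null_comparison[OF _ z]) (use Y(4) in simp)
    have "(\<lambda>k. Y (r k) (\<sigma> b) - (Y (r k) (\<sigma> b) - \<Lambda> (r k) * Y (r k) b)) \<longlonglongrightarrow> y (\<sigma> b) - 0"
      by (intro tendsto_diff lim_y res)
    then have \<Lambda>: "(\<lambda>k. \<Lambda> (r k)) \<longlonglongrightarrow> y (\<sigma> b)" by (simp add: Y)
    have "y (\<sigma> i) = y (\<sigma> b) * y i" for i
    proof -
      have "(\<lambda>k. Y (r k) (\<sigma> i) - \<Lambda> (r k) * Y (r k) i) \<longlonglongrightarrow> y (\<sigma> i) - y (\<sigma> b) * y i"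
        by (intro tendsto_intros lim_y \<Lambda>)
      from LIMSEQ_unique[OF this res] show ?thesis by simp
    qed
    then have "\<forall>i. y (\<sigma> i) = y (\<sigma> b) * y i" by (rule allI)
    moreover have "y b \<noteq> 0" using lim_y[of b] by (simp add: Y LIMSEQ_const_iff)
    ultimately have "\<exists>y'\<in>W. y' b \<noteq> 0 \<and> (\<forall>i. y' (\<sigma> i) = y (\<sigma> b) * y' i)"
      by (intro bexI[of _ y] conjI y)
    then show False by (rule notE[OF no exI])
  qed
  then obtain c where c: "c > 0"
    and lower: "\<And>\<kappa> w D i. \<lbrakk>w \<in> W; \<And>i. cmod (w (\<sigma> i) - \<kappa> * w i) \<le> D\<rbrakk> \<Longrightarrow> c * cmod (w i) \<le> D"
    by blast
  have lower': "cmod (w i) \<le> D / c" if "w \<in> W" "\<And>i. cmod (w (\<sigma> i) - \<kappa> * w i) \<le> D" for \<kappa> w D i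
    using lower[OF that, of i] c by (simp add: pos_le_divide_eq mult.commute)
  define solv where "solv = {\<kappa>. \<forall>w\<in>W. \<exists>y\<in>W. \<forall>i. y (\<sigma> i) - \<kappa> * y i = w i}"
  have "2 \<in> solv"
  proof -
    have "\<exists>y\<in>W. \<forall>i. y (\<sigma> i) - 2 * y i = w i" if w: "w \<in> W" for w
    proof -
      have "\<exists>y\<in>W. (\<lambda>i. (1/2) * ((y \<circ> \<sigma>) i - w i)) = y"
      proof (rule contraction_fixpoint[where q = "1/2" and ?y0.0 = w])
        fix y y' :: "'i \<Rightarrow> complex" and D
        assume D: "\<And>i. cmod (y i - y' i) \<le> D"
        have "1/2 * ((y \<circ> \<sigma>) i - w i) - 1/2 * ((y' \<circ> \<sigma>) i - w i) = 1/2 * (y (\<sigma> i) - y' (\<sigma> i))" for i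
          by (simp add: algebra_simps)
        then show "\<forall>i. cmod (1/2 * ((y \<circ> \<sigma>) i - w i) - 1/2 * ((y' \<circ> \<sigma>) i - w i)) \<le> 1/2 * D"
          using D by (simp only: norm_mult) (auto intro!: mult_mono)
      next
        show "(\<lambda>i. 1/2 * ((y \<circ> \<sigma>) i - w i)) \<in> W" if "y \<in> W" for y
          by (rule scale[OF diff[OF shift[OF \<sigma> that] w]])
      qed (use w in auto)
      then obtain y where y: "y \<in> W" "\<And>i. (1/2) * ((y \<circ> \<sigma>) i - w i) = y i" by metis
      have "y (\<sigma> i) - 2 * y i = w i" for i using y(2)[of i] by (simp add: field_simps)
      then show ?thesis using y by blast
    qed
    then show ?thesis by (simp add: solv_def)
  qed
  moreover have near: "\<kappa> \<in> solv" if \<mu>: "\<mu> \<in> solv" and d: "cmod (\<kappa> - \<mu>) < c" for \<kappa> \<mu>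
  proof -
    have "\<forall>w\<in>W. \<exists>y. y \<in> W \<and> (\<forall>i. y (\<sigma> i) - \<mu> * y i = w i)" using \<mu> unfolding solv_def by blast
    from bchoice[OF this] obtain R where R: "\<And>w. w \<in> W \<Longrightarrow> R w \<in> W"
      "\<And>w i. w \<in> W \<Longrightarrow> R w (\<sigma> i) - \<mu> * R w i = w i" by blast
    have "\<exists>y\<in>W. \<forall>i. y (\<sigma> i) - \<kappa> * y i = w i" if w: "w \<in> W" for w
    proof -
      define T where "T y = R (\<lambda>i. (\<kappa> - \<mu>) * y i + w i)" for y
      have "\<exists>y\<in>W. T y = y"
      proof (rule contraction_fixpoint[where q = "cmod (\<kappa> - \<mu>) / c" and ?y0.0 = w])
        fix y y' :: "'i \<Rightarrow> complex" and D
        assume y: "y \<in> W" "y' \<in> W" and D: "\<And>i. cmod (y i - y' i) \<le> D"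
        have "cmod (T y i - T y' i) \<le> (cmod (\<kappa> - \<mu>) * D) / c" for i
        proof (rule lower'[where \<kappa> = \<mu> and w = "\<lambda>i. T y i - T y' i"])
          show "(\<lambda>i. T y i - T y' i) \<in> W" unfolding T_def using y w by (intro diff R lin)
          fix i
          have T_eq: "T x (\<sigma> i) - \<mu> * T x i = (\<kappa> - \<mu>) * x i + w i" if "x \<in> W" for x
            unfolding T_def by (rule R(2)[OF lin[OF that w]])
          have "T y (\<sigma> i) - T y' (\<sigma> i) - \<mu> * (T y i - T y' i)
              = (T y (\<sigma> i) - \<mu> * T y i) - (T y' (\<sigma> i) - \<mu> * T y' i)"
            by (simp add: right_diff_distrib)
          also have "\<dots> = (\<kappa> - \<mu>) * (y i - y' i)"
            unfolding T_eq[OF y(1)] T_eq[OF y(2)] by (simp add: right_diff_distrib)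
          finally have "T y (\<sigma> i) - T y' (\<sigma> i) - \<mu> * (T y i - T y' i) = (\<kappa> - \<mu>) * (y i - y' i)" .
          then show "cmod (T y (\<sigma> i) - T y' (\<sigma> i) - \<mu> * (T y i - T y' i)) \<le> cmod (\<kappa> - \<mu>) * D"
            using D[of i] by (simp add: norm_mult mult_left_mono)
        qed
        then show "\<forall>i. cmod (T y i - T y' i) \<le> cmod (\<kappa> - \<mu>) / c * D" by simp
      qed (use w d c in \<open>auto simp: T_def intro!: R lin\<close>)
      then obtain y where y: "y \<in> W" "T y = y" by blast
      have "y (\<sigma> i) - \<kappa> * y i = w i" for i
        using R(2)[OF lin[OF y(1) w, of "\<kappa> - \<mu>"], of i] y(2) unfolding T_def by (simp add: algebra_simps)
      then show ?thesis using y by blast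
    qed
    then show ?thesis by (simp add: solv_def)
  qed
  moreover have "open solv" unfolding open_dist using near c by (metis dist_norm)
  moreover have "closed solv" unfolding closed_limpt islimpt_approachable
    using near c by (metis dist_norm norm_minus_commute)
  ultimately have "solv = UNIV" using clopen by blast
  then have "\<forall>\<kappa>. \<forall>w\<in>W. \<exists>y. y \<in> W \<and> (\<forall>i. y (\<sigma> i) - \<kappa> * y i = w i)" unfolding solv_def by blast
  then have "\<forall>\<kappa>. \<exists>R. \<forall>w\<in>W. R w \<in> W \<and> (\<forall>i. R w (\<sigma> i) - \<kappa> * R w i = w i)" by (intro allI bchoice) blast
  from choice[OF this] obtain R where R: "\<And>\<kappa> w. w \<in> W \<Longrightarrow> R \<kappa> w \<in> W"
      "\<And>\<kappa> w i. w \<in> W \<Longrightarrow> R \<kappa> w (\<sigma> i) - \<kappa> * R \<kappa> w i = w i" by blast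
  have uniq: "y i = y' i" if "y \<in> W" "y' \<in> W" "\<And>i. y (\<sigma> i) - \<kappa> * y i = y' (\<sigma> i) - \<kappa> * y' i" for y y' \<kappa> i
  proof -
    have "cmod (y (\<sigma> i) - y' (\<sigma> i) - \<kappa> * (y i - y' i)) \<le> 0" for i
      using that(3)[of i] by (simp add: algebra_simps)
    from lower'[OF diff[OF that(1,2)] this, of i] show ?thesis by simp
  qed
  have bound: "cmod (R \<kappa> w i) \<le> D / c" if "w \<in> W" "\<And>i. cmod (w i) \<le> D" for \<kappa> w D i
    by (rule lower'[of "R \<kappa> w" \<kappa>]) (use R that in auto)
  have vanish: "R \<kappa> w b = 0" if w: "w \<in> W" for \<kappa> w
  proof -
    obtain B where B: "\<And>i. cmod (w i) \<le> B" using bdd[OF w] by blast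
    have B0: "0 \<le> B" using B norm_ge_zero order_trans by blast
    have resolvent: "R \<kappa> w i - R \<mu> w i = (\<kappa> - \<mu>) * R \<kappa> (R \<mu> w) i" if "w \<in> W" for \<kappa> \<mu> w i
    proof (rule uniq[where \<kappa> = \<kappa>])
      show "R \<kappa> w (\<sigma> i) - R \<mu> w (\<sigma> i) - \<kappa> * (R \<kappa> w i - R \<mu> w i)
        = (\<kappa> - \<mu>) * R \<kappa> (R \<mu> w) (\<sigma> i) - \<kappa> * ((\<kappa> - \<mu>) * R \<kappa> (R \<mu> w) i)" for i
      proof -
        have "R \<kappa> w (\<sigma> i) - R \<mu> w (\<sigma> i) - \<kappa> * (R \<kappa> w i - R \<mu> w i)
            = (R \<kappa> w (\<sigma> i) - \<kappa> * R \<kappa> w i) - (R \<mu> w (\<sigma> i) - \<mu> * R \<mu> w i) + (\<kappa> - \<mu>) * R \<mu> w i"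
          by (simp add: algebra_simps)
        also have "\<dots> = (\<kappa> - \<mu>) * (R \<kappa> (R \<mu> w) (\<sigma> i) - \<kappa> * R \<kappa> (R \<mu> w) i)"
          unfolding R(2)[OF that] R(2)[OF R(1)[OF that]] by simp
        also have "\<dots> = (\<kappa> - \<mu>) * R \<kappa> (R \<mu> w) (\<sigma> i) - \<kappa> * ((\<kappa> - \<mu>) * R \<kappa> (R \<mu> w) i)"
          by (simp add: right_diff_distrib mult.left_commute)
        finally show ?thesis .
      qed
    qed (use that in \<open>auto intro!: diff R scale\<close>)
    define f where "f \<kappa> = R \<kappa> w b" for \<kappa>
    have "(f has_field_derivative R \<mu> (R \<mu> w) b) (at \<mu>)" for \<mu>
    proof (rule has_field_derivative_quadratic_error[where C = "B / c / c / c"])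
      fix \<kappa>
      have "f \<kappa> - f \<mu> - (\<kappa> - \<mu>) * R \<mu> (R \<mu> w) b = (\<kappa> - \<mu>) * (R \<kappa> (R \<mu> w) b - R \<mu> (R \<mu> w) b)"
        using resolvent[OF w] by (simp add: f_def algebra_simps)
      also have "\<dots> = (\<kappa> - \<mu>)\<^sup>2 * R \<kappa> (R \<mu> (R \<mu> w)) b"
        using resolvent[OF R(1)[OF w]] by (simp add: power2_eq_square)
      also have "cmod \<dots> \<le> (cmod (\<kappa> - \<mu>))\<^sup>2 * (B / c / c / c)"
        unfolding norm_mult norm_power
        by (intro mult_left_mono bound R w B) simp
      finally show "cmod (f \<kappa> - f \<mu> - (\<kappa> - \<mu>) * R \<mu> (R \<mu> w) b) \<le> B / c / c / c * (cmod (\<kappa> - \<mu>))\<^sup>2"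
        by (simp add: mult.commute)
    qed
    then have "f holomorphic_on UNIV"
      unfolding holomorphic_on_def field_differentiable_def using has_field_derivative_at_within by blast
    moreover have fb: "cmod (f \<kappa>) \<le> B / c" for \<kappa> unfolding f_def by (intro bound w B)
    then have "bounded (range f)" by (auto simp: bounded_iff)
    ultimately have "f constant_on UNIV" by (rule Liouville_theorem)
    then obtain K where K: "\<And>\<kappa>. f \<kappa> = K" unfolding constant_on_def by auto
    have "K = 0"
    proof (rule ccontr)
      assume K0: "K \<noteq> 0"
      define t where "t = (B / c + B + 1) / cmod K"
      have "0 \<le> B / c" using B0 c by simp
      have "R (of_real t) w (\<sigma> b) - of_real t * K = w b" using R(2)[OF w, of "of_real t" b] K by (simp add: f_def)
      then have "of_real t * K = R (of_real t) w (\<sigma> b) - w b" by (simp add: algebra_simps)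
      then have "cmod (of_real t * K) \<le> B / c + B"
        using norm_triangle_ineq4[of "R (of_real t) w (\<sigma> b)" "w b"] bound[OF w B, of "of_real t" "\<sigma> b"] B[of b]
        by simp
      moreover have "cmod (of_real t * K) = B / c + B + 1"
        unfolding norm_mult norm_of_real using K0 B0 \<open>0 \<le> B / c\<close> by (simp add: t_def)
      ultimately show False by simp
    qed
    then show ?thesis using K by (simp add: f_def)
  qed
  obtain \<gamma> where \<gamma>: "\<gamma> \<in> \<Gamma>" "\<gamma> b = j0" using reach[OF w0] by (rule bexE)
  define y where "y = w0 \<circ> \<gamma>"
  have y: "y \<in> W" unfolding y_def by (rule shift[OF \<gamma>(1) w0(1)])
  have "R 0 (y \<circ> \<sigma>) b = y b"
  proof (rule uniq[where \<kappa> = 0])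
    show "R 0 (y \<circ> \<sigma>) \<in> W" by (rule R(1)[OF shift[OF \<sigma> y]])
    show "R 0 (y \<circ> \<sigma>) (\<sigma> i) - 0 * R 0 (y \<circ> \<sigma>) i = y (\<sigma> i) - 0 * y i" for i
      unfolding R(2)[OF shift[OF \<sigma> y]] by simp
  qed (rule y)
  then show False using vanish[OF shift[OF \<sigma> y]] w0(2) \<gamma>(2) by (simp add: y_def)
qed

text \<open>
  An eigenspace is again a shift space, because the shifts commute.
\<close>

lemma joint_eigenfunction:
  assumes "finite F" "F \<subseteq> \<Gamma>" "w0 \<in> W" "w0 j0 \<noteq> 0"
  shows "\<exists>y\<in>W. y b \<noteq> 0 \<and> (\<forall>\<sigma>\<in>F. \<exists>\<kappa>. \<forall>i. y (\<sigma> i) = \<kappa> * y i)"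
  using assms(1,2)
proof (induction rule: finite_induct)
  case empty
  obtain \<gamma> where \<gamma>: "\<gamma> \<in> \<Gamma>" "\<gamma> b = j0" using reach[OF assms(3,4)] by (rule bexE)
  then show ?case using shift[OF \<gamma>(1) assms(3)] assms(4) by (intro bexI[of _ "w0 \<circ> \<gamma>"]) auto
next
  case (insert \<sigma> F)
  have "F \<subseteq> \<Gamma>" "\<sigma> \<in> \<Gamma>" using insert.prems by simp_all
  from insert.IH[OF this(1)] obtain y where y: "y \<in> W" "y b \<noteq> 0"
    and ev: "\<forall>\<sigma>\<in>F. \<exists>\<kappa>. \<forall>i. y (\<sigma> i) = \<kappa> * y i" by (elim bexE conjE)
  define \<Lambda> where "\<Lambda> \<tau> = (SOME \<kappa>. \<forall>i. y (\<tau> i) = \<kappa> * y i)" for \<tau>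
  have \<Lambda>: "y (\<tau> i) = \<Lambda> \<tau> * y i" if "\<tau> \<in> F" for \<tau> i
    using someI_ex[OF ev[rule_format, OF that]] unfolding \<Lambda>_def by (rule spec)
  define W' where "W' = {w\<in>W. \<forall>\<tau>\<in>F. \<forall>i. w (\<tau> i) = \<Lambda> \<tau> * w i}"
  interpret sub: shift_space W' \<Gamma> b
  proof
    fix w w' a assume "w \<in> W'" "w' \<in> W'"
    then show "(\<lambda>i. a * w i + w' i) \<in> W'" using lin by (auto simp: W'_def algebra_simps)
  next
    fix s B l assume s: "\<And>k::nat. s k \<in> W'" and B: "\<And>k i. cmod (s k i) \<le> B"
      and l: "\<And>i. (\<lambda>k. s k i) \<longlonglongrightarrow> l i"
    have "l \<in> W" using s by (intro lim[OF _ B l]) (simp add: W'_def)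
    moreover have "l (\<tau> i) = \<Lambda> \<tau> * l i" if "\<tau> \<in> F" for \<tau> i
    proof (rule LIMSEQ_unique[OF l])
      have "(\<lambda>k. \<Lambda> \<tau> * s k i) \<longlonglongrightarrow> \<Lambda> \<tau> * l i" by (intro tendsto_intros l)
      then show "(\<lambda>k. s k (\<tau> i)) \<longlonglongrightarrow> \<Lambda> \<tau> * l i" using s that by (simp add: W'_def)
    qed
    ultimately show "l \<in> W'" by (simp add: W'_def)
  next
    fix \<gamma> w assume \<gamma>: "\<gamma> \<in> \<Gamma>" and w: "w \<in> W'"
    have "\<gamma> (\<tau> i) = \<tau> (\<gamma> i)" if "\<tau> \<in> F" for \<tau> i
      using that insert.prems by (intro comm'[OF \<gamma>]) auto
    then show "w \<circ> \<gamma> \<in> W'" using shift[OF \<gamma>] w by (auto simp: W'_def)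
  next
    fix w assume "w \<in> W'"
    then show "\<exists>B. \<forall>i. cmod (w i) \<le> B" using bdd[of w] by (simp add: W'_def)
  next
    fix w i assume "w \<in> W'" "w i \<noteq> 0"
    then show "\<exists>\<gamma>\<in>\<Gamma>. \<gamma> b = i" using reach[of w i] by (simp add: W'_def)
  qed (rule comm)
  have "y \<in> W'" using y(1) \<Lambda> by (simp add: W'_def)
  then have "\<exists>\<kappa>. \<exists>y'\<in>W'. y' b \<noteq> 0 \<and> (\<forall>i. y' (\<sigma> i) = \<kappa> * y' i)"
    by (rule sub.eigenfunction[where ?w0.0 = y and ?j0.0 = b, OF \<open>\<sigma> \<in> \<Gamma>\<close> _ y(2)])
  then obtain \<kappa> y' where y': "y' \<in> W'" "y' b \<noteq> 0" "\<forall>i. y' (\<sigma> i) = \<kappa> * y' i" by (elim exE bexE conjE)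
  have "\<exists>\<kappa>. \<forall>i. y' (\<tau> i) = \<kappa> * y' i" if "\<tau> \<in> insert \<sigma> F" for \<tau>
  proof (cases "\<tau> = \<sigma>")
    case True
    then show ?thesis using y'(3) by (intro exI[of _ \<kappa>]) simp
  next
    case False
    then show ?thesis using y'(1) that by (intro exI[of _ "\<Lambda> \<tau>"]) (simp add: W'_def)
  qed
  then show ?case using y'(1,2) by (intro bexI[of _ y'] conjI ballI) (simp_all add: W'_def)
qed

end

section \<open>Evaluation of Laurent polynomials\<close>

lemma laurent_monom_mult: "laurent_monom n * laurent_monom k = laurent_monom (n + k)"
  by (simp add: laurent_monom_def mult_single)

lemma laurent_monom_zero: "laurent_monom 0 = 1"
  by (simp add: laurent_monom_def)

abbreviation (input) supp where "supp f \<equiv> Poly_Mapping.keys f"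

text \<open>
  For \<open>y\<close> translated by \<open>n\<close>, the equation \<open>pairing = 0\<close> is the linear recurrence with coefficients
  \<open>f\<close> at the place \<open>n\<close>.
\<close>

definition pairing :: "(int ^ 'd \<Rightarrow> complex) \<Rightarrow> ('d::finite) laurent \<Rightarrow> complex" where
  "pairing y f = (\<Sum>n\<in>supp f. of_int (Poly_Mapping.lookup f n) * y n)"

lemma pairing_superset:
  assumes "finite A" "supp f \<subseteq> A"
  shows "pairing y f = (\<Sum>n\<in>A. of_int (Poly_Mapping.lookup f n) * y n)"
  unfolding pairing_def by (rule sum.mono_neutral_left[OF assms]) (simp add: in_keys_iff)

lemma pairing_diff: "pairing y (f - g) = pairing y f - pairing y g"
proof -
  let ?A = "supp f \<union> supp g"
  have "supp (f - g) \<subseteq> ?A" by (rule keys_diff)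
  then show ?thesis
    by (subst (1 2 3) pairing_superset[of ?A]) (auto simp: lookup_minus algebra_simps sum_subtractf)
qed

lemma pairing_zero: "pairing y 0 = 0"
  by (simp add: pairing_def)

lemma pairing_monom: "pairing y (laurent_monom n) = y n"
  by (simp add: pairing_def laurent_monom_def)

lemma pairing_one: "pairing y 1 = y 0"
  by (simp add: pairing_def)

lemma pairing_linear: "pairing (\<lambda>n. a * y n + y' n) f = a * pairing y f + pairing y' f"
  by (simp add: pairing_def sum.distrib sum_distrib_left algebra_simps)

lemma pairing_cong: "(\<And>n. n \<in> supp f \<Longrightarrow> y n = y' n) \<Longrightarrow> pairing y f = pairing y' f"
  by (simp add: pairing_def)

lemma pairing_tendsto: "(\<And>n. (\<lambda>k. s k n) \<longlonglongrightarrow> y n) \<Longrightarrow> (\<lambda>k. pairing (s k) f) \<longlonglongrightarrow> pairing y f"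
  unfolding pairing_def by (intro tendsto_sum tendsto_mult tendsto_const)

definition monom_val :: "complex ^ 'd::finite \<Rightarrow> int ^ 'd \<Rightarrow> complex" where
  "monom_val z n = (\<Prod>i\<in>UNIV. (z $ i) powi (n $ i))"

lemma laurent_eval_pairing: "laurent_eval f z = pairing (monom_val z) f"
  by (simp add: laurent_eval_def pairing_def monom_val_def)

lemma laurent_eval_diff: "laurent_eval (f - g) z = laurent_eval f z - laurent_eval g z"
  by (simp only: laurent_eval_pairing pairing_diff)

lemma laurent_eval_zero: "laurent_eval 0 z = 0"
  by (simp only: laurent_eval_pairing pairing_zero)

lemma laurent_eval_add: "laurent_eval (f + g) z = laurent_eval f z + laurent_eval g z"
proof -
  have "laurent_eval (f - (0 - g)) z = laurent_eval f z - (0 - laurent_eval g z)"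
    by (simp only: laurent_eval_diff laurent_eval_zero)
  then show ?thesis by simp
qed

lemma laurent_eval_monom: "laurent_eval (laurent_monom n) z = monom_val z n"
  by (simp add: laurent_eval_def laurent_monom_def monom_val_def)

lemma monom_val_zero: "monom_val z 0 = 1"
  by (simp add: monom_val_def)

lemma laurent_eval_one: "laurent_eval 1 z = 1"
  using laurent_eval_monom[of 0 z] by (simp add: laurent_monom_def monom_val_zero)

lemma monom_val_add:
  assumes "\<And>i. z $ i \<noteq> 0"
  shows "monom_val z (n + k) = monom_val z n * monom_val z k"
  using assms by (simp add: monom_val_def power_int_add prod.distrib)

lemma monom_val_nonzero:
  assumes "\<And>i. z $ i \<noteq> 0"
  shows "monom_val z n \<noteq> 0"
  using assms by (simp add: monom_val_def)

lemma laurent_induct [case_names zero monom diff]: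
  fixes f :: "('d::finite) laurent"
  assumes "P 0" "\<And>n. n \<in> supp f \<Longrightarrow> P (laurent_monom n)" "\<And>f g. P f \<Longrightarrow> P g \<Longrightarrow> P (f - g)"
  shows "P f"
  by (rule frag_induction[of f "supp f"]) (use assms in \<open>auto simp: laurent_monom_def\<close>)

lemma laurent_eval_mult:
  assumes "\<And>i. z $ i \<noteq> 0"
  shows "laurent_eval (f * g) z = laurent_eval f z * laurent_eval g z"
proof (induction f rule: laurent_induct)
  case (monom n)
  show ?case
    by (induction g rule: laurent_induct)
       (simp_all add: laurent_monom_mult laurent_eval_monom monom_val_add[OF assms] laurent_eval_diff
         laurent_eval_zero right_diff_distrib)
qed (simp_all add: laurent_eval_zero laurent_eval_diff left_diff_distrib)


section \<open>Laurent polynomials with support in a set\<close>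

definition laurents_in :: "(int ^ 'd) set \<Rightarrow> ('d::finite) laurent set" where
  "laurents_in A = {f. supp f \<subseteq> A}"

lemma laurents_in_zero: "0 \<in> laurents_in A"
  by (simp add: laurents_in_def)

lemma laurents_in_add: "\<lbrakk>f \<in> laurents_in A; g \<in> laurents_in A\<rbrakk> \<Longrightarrow> f + g \<in> laurents_in A"
  using Poly_Mapping.keys_add[of f g] by (auto simp: laurents_in_def)

lemma laurents_in_uminus: "f \<in> laurents_in A \<Longrightarrow> - f \<in> laurents_in A"
  by (simp add: laurents_in_def)

lemma laurents_in_diff: "\<lbrakk>f \<in> laurents_in A; g \<in> laurents_in A\<rbrakk> \<Longrightarrow> f - g \<in> laurents_in A"
  using laurents_in_add[of f A "- g"] by (simp add: laurents_in_uminus)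

lemma laurents_in_monom: "n \<in> A \<Longrightarrow> laurent_monom n \<in> laurents_in A"
  by (simp add: laurents_in_def laurent_monom_def)

lemma laurents_in_mult:
  assumes "f \<in> laurents_in A" "g \<in> laurents_in B" "\<And>n k. \<lbrakk>n \<in> A; k \<in> B\<rbrakk> \<Longrightarrow> n + k \<in> C"
  shows "f * g \<in> laurents_in C"
  using assms Poly_Mapping.keys_mult[of f g] by (fastforce simp: laurents_in_def)

lemma laurents_in_mono: "A \<subseteq> B \<Longrightarrow> laurents_in A \<subseteq> laurents_in B"
  by (auto simp: laurents_in_def)


section \<open>Modules over the ring of Laurent polynomials\<close>

locale laurent_module = Module.module laurent_ring M
  for M :: "(('d::finite) laurent, 'm) module" (structure)
begin

lemma laurent_smult_closed [simp, intro]: "m \<in> carrier M \<Longrightarrow> f \<odot> m \<in> carrier M"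
  using smult_closed[of f m] by (simp add: laurent_ring_def)

lemma laurent_add_smult: "m \<in> carrier M \<Longrightarrow> (f + g) \<odot> m = f \<odot> m \<oplus> g \<odot> m"
  using smult_l_distr[of f g m] by (simp add: laurent_ring_def)

lemma laurent_smult_add: "\<lbrakk>m \<in> carrier M; m' \<in> carrier M\<rbrakk> \<Longrightarrow> f \<odot> (m \<oplus> m') = f \<odot> m \<oplus> f \<odot> m'"
  using smult_r_distr[of f m m'] by (simp add: laurent_ring_def)

lemma laurent_mult_smult: "m \<in> carrier M \<Longrightarrow> (f * g) \<odot> m = f \<odot> (g \<odot> m)"
  using smult_assoc1[of f g m] by (simp add: laurent_ring_def)

lemma laurent_one_smult [simp]: "m \<in> carrier M \<Longrightarrow> 1 \<odot> m = m"
  using smult_one[of m] by (simp add: laurent_ring_def)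

lemma laurent_zero_smult [simp]: "m \<in> carrier M \<Longrightarrow> 0 \<odot> m = \<zero>"
  using smult_l_null[of m] by (simp add: laurent_ring_def)

lemma laurent_smult_zero [simp]: "f \<odot> \<zero> = \<zero>"
  using smult_r_null[of f] by (simp add: laurent_ring_def)

lemma laurent_smult_commute: "m \<in> carrier M \<Longrightarrow> f \<odot> (g \<odot> m) = g \<odot> (f \<odot> m)"
  by (metis laurent_mult_smult mult.commute)

lemma laurent_uminus_smult: "m \<in> carrier M \<Longrightarrow> (- f) \<odot> m = \<ominus> (f \<odot> m)"
  using laurent_add_smult[of m "- f" f] M.minus_equality[of "(- f) \<odot> m" "f \<odot> m"] by simp

lemma laurent_diff_smult: "m \<in> carrier M \<Longrightarrow> (f - g) \<odot> m = f \<odot> m \<oplus> \<ominus> (g \<odot> m)"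
  using laurent_add_smult[of m f "- g"] by (simp add: laurent_uminus_smult)

lemma laurent_uminus_eq: "m \<in> carrier M \<Longrightarrow> \<ominus> m = (- 1) \<odot> m"
  by (simp add: laurent_uminus_smult)

text \<open>
  Coefficients are restricted to a set \<open>I\<close>, which will be the whole ring, a subring or an ideal.
  Generators are kept in a list for the sake of induction.
\<close>

primrec span :: "'d laurent set \<Rightarrow> 'm list \<Rightarrow> 'm set" where
  "span I [] = {\<zero>}"
| "span I (m # ms) = {a \<odot> m \<oplus> y |a y. a \<in> I \<and> y \<in> span I ms}"

lemma span_closed: "set ms \<subseteq> carrier M \<Longrightarrow> span I ms \<subseteq> carrier M"
  by (induction ms) auto

lemma span_zero:
  assumes "0 \<in> I" "set ms \<subseteq> carrier M"
  shows "\<zero> \<in> span I ms"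
  using assms(2)
proof (induction ms)
  case (Cons m ms)
  then have "\<zero> = 0 \<odot> m \<oplus> \<zero>" by simp
  then show ?case using Cons assms(1) by (auto intro!: exI[of _ 0] exI[of _ "\<zero>"])
qed simp

lemma span_add:
  assumes I: "\<And>a b. \<lbrakk>a \<in> I; b \<in> I\<rbrakk> \<Longrightarrow> a + b \<in> I" and "set ms \<subseteq> carrier M"
    and "x \<in> span I ms" "y \<in> span I ms"
  shows "x \<oplus> y \<in> span I ms"
  using assms(2-)
proof (induction ms arbitrary: x y)
  case (Cons m ms)
  then have m: "m \<in> carrier M" "set ms \<subseteq> carrier M" by auto
  from Cons.prems obtain a x' b y' where xy: "a \<in> I" "x' \<in> span I ms" "x = a \<odot> m \<oplus> x'"
    "b \<in> I" "y' \<in> span I ms" "y = b \<odot> m \<oplus> y'" by auto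
  then have "x' \<in> carrier M" "y' \<in> carrier M" using span_closed[OF m(2), of I] by auto
  then have "x \<oplus> y = (a + b) \<odot> m \<oplus> (x' \<oplus> y')"
    using m xy by (simp add: laurent_add_smult M.a_ac)
  then show ?case using Cons.IH[OF m(2) xy(2,5)] I[OF xy(1,4)] by auto
qed simp

lemma span_smult:
  assumes I: "\<And>a. a \<in> I \<Longrightarrow> f * a \<in> J" and "set ms \<subseteq> carrier M" and "x \<in> span I ms"
  shows "f \<odot> x \<in> span J ms"
  using assms(2-)
proof (induction ms arbitrary: x)
  case (Cons m ms)
  then have m: "m \<in> carrier M" "set ms \<subseteq> carrier M" by auto
  from Cons.prems obtain a x' where x: "a \<in> I" "x' \<in> span I ms" "x = a \<odot> m \<oplus> x'" by auto
  then have "x' \<in> carrier M" using span_closed[OF m(2), of I] by auto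
  then have "f \<odot> x = (f * a) \<odot> m \<oplus> f \<odot> x'"
    using m x by (simp add: laurent_smult_add laurent_mult_smult)
  then show ?case using Cons.IH[OF m(2) x(2)] I[OF x(1)] by auto
qed simp

lemma span_tail:
  assumes "0 \<in> I" "set (m # ms) \<subseteq> carrier M" "x \<in> span I ms"
  shows "x \<in> span I (m # ms)"
proof -
  have "x = 0 \<odot> m \<oplus> x" using assms span_closed[of ms I] by auto
  then have "\<exists>a y. x = a \<odot> m \<oplus> y \<and> a \<in> I \<and> y \<in> span I ms" using assms by blast
  then show ?thesis by simp
qed

lemma span_gen:
  assumes "0 \<in> I" "set ms \<subseteq> carrier M" "m \<in> set ms" "a \<in> I"
  shows "a \<odot> m \<in> span I ms"
  using assms(2,3)
proof (induction ms)
  case (Cons k ms)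
  show ?case
  proof (cases "m = k")
    case True
    have "a \<odot> k = a \<odot> k \<oplus> \<zero>" using Cons by simp
    moreover have "\<zero> \<in> span I ms" using Cons.prems by (intro span_zero[OF assms(1)]) simp
    ultimately have "\<exists>b y. a \<odot> k = b \<odot> k \<oplus> y \<and> b \<in> I \<and> y \<in> span I ms" using assms(4) by blast
    then show ?thesis using True by simp
  next
    case False
    then show ?thesis using Cons span_tail[OF assms(1) Cons.prems(1)] by auto
  qed
qed simp

lemma span_subset:
  assumes "set ms \<subseteq> carrier M" "\<zero> \<in> N" "\<And>x y. \<lbrakk>x \<in> N; y \<in> N\<rbrakk> \<Longrightarrow> x \<oplus> y \<in> N"
    "\<And>a m. \<lbrakk>a \<in> I; m \<in> set ms\<rbrakk> \<Longrightarrow> a \<odot> m \<in> N"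
  shows "span I ms \<subseteq> N"
  using assms(1,4) by (induction ms) (auto intro!: assms(2,3))

text \<open>
  Nakayama's lemma for a set \<open>T\<close> that behaves like \<open>1 + I\<close>, or like the complement of a prime
  ideal \<open>I\<close>. The generators are eliminated one after the other: from \<open>t k = a k + y\<close> follows
  \<open>(t - a) k = y\<close>, and multiplication by \<open>t - a\<close> removes \<open>k\<close> from all relations.
\<close>

lemma nakayama:
  assumes I: "0 \<in> I" "\<And>a b. \<lbrakk>a \<in> I; b \<in> I\<rbrakk> \<Longrightarrow> a + b \<in> I" "\<And>a b. \<lbrakk>a \<in> I; b \<in> I\<rbrakk> \<Longrightarrow> a * b \<in> I"
    and T: "\<And>s t. \<lbrakk>s \<in> T; t \<in> T\<rbrakk> \<Longrightarrow> s * t \<in> T" "\<And>t a. \<lbrakk>t \<in> T; a \<in> I\<rbrakk> \<Longrightarrow> t * a \<in> I"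
      "\<And>t a. \<lbrakk>t \<in> T; a \<in> I\<rbrakk> \<Longrightarrow> t - a \<in> T"
    and B: "B \<subseteq> carrier M" "set ms \<subseteq> B" "t \<in> T" "\<And>m. m \<in> B \<Longrightarrow> t \<odot> m \<in> span I ms"
  shows "\<exists>t\<in>T. \<forall>m\<in>B. t \<odot> m = \<zero>"
  using B(2-)
proof (induction ms arbitrary: t)
  case Nil
  then show ?case by auto
next
  case (Cons k ms)
  have ms: "set ms \<subseteq> carrier M" and k: "k \<in> carrier M" "k \<in> B" using Cons.prems(1) B(1) by auto
  from Cons.prems(3)[OF k(2)] obtain a y where a: "a \<in> I" "y \<in> span I ms" "t \<odot> k = a \<odot> k \<oplus> y" by auto
  have yc: "y \<in> carrier M" using a(2) span_closed[OF ms] by auto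
  have "(t - a) \<odot> k = y"
    using k yc by (simp add: laurent_diff_smult a(3) M.a_ac M.r_neg2 M.r_neg1) (metis M.a_comm M.r_neg1 M.a_inv_closed laurent_smult_closed M.r_neg M.r_zero M.a_assoc)
  define t' where "t' = t - a"
  have t': "t' \<in> T" "t' \<odot> k = y" unfolding t'_def using T(3)[OF Cons.prems(2) a(1)] \<open>(t - a) \<odot> k = y\<close> by auto
  show ?case
  proof (rule Cons.IH[of "t' * t"])
    show "set ms \<subseteq> B" using Cons.prems(1) by auto
    show "t' * t \<in> T" by (rule T(1)[OF t'(1) Cons.prems(2)])
    fix m assume m: "m \<in> B"
    then have mc: "m \<in> carrier M" using B(1) by auto
    from Cons.prems(3)[OF m] obtain b x where b: "b \<in> I" "x \<in> span I ms" "t \<odot> m = b \<odot> k \<oplus> x" by auto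
    have xc: "x \<in> carrier M" using b(2) span_closed[OF ms] by auto
    have "(t' * t) \<odot> m = t' \<odot> (b \<odot> k \<oplus> x)" using mc by (simp add: laurent_mult_smult b(3))
    also have "\<dots> = b \<odot> (t' \<odot> k) \<oplus> t' \<odot> x"
      using k xc by (simp add: laurent_smult_add laurent_smult_commute[of k t' b])
    also have "\<dots> = b \<odot> y \<oplus> t' \<odot> x" by (simp add: t'(2))
    also have "\<dots> \<in> span I ms"
      by (rule span_add[OF I(2) ms span_smult[OF I(3)[OF b(1)] ms a(2)] span_smult[OF T(2)[OF t'(1)] ms b(2)]])
    finally show "(t' * t) \<odot> m \<in> span I ms" .
  qed
qed

definition annihilator :: "'d laurent set" where
  "annihilator = {f. \<forall>m\<in>carrier M. f \<odot> m = \<zero>}"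

lemma kills_span:
  assumes "set ms \<subseteq> carrier M" "\<And>m. m \<in> set ms \<Longrightarrow> t \<odot> m = \<zero>" "x \<in> span I ms"
  shows "t \<odot> x = \<zero>"
  using assms
proof (induction ms arbitrary: x)
  case (Cons k ms)
  then obtain a y where "a \<in> I" "y \<in> span I ms" "x = a \<odot> k \<oplus> y" by auto
  moreover have "y \<in> carrier M" using Cons.prems calculation span_closed[of ms I] by auto
  ultimately show ?case using Cons by (auto simp: laurent_smult_add laurent_smult_commute[of k t a])
qed simp

text \<open>
  Let \<open>q\<close> be the prime ideal of polynomials vanishing at \<open>z\<close>. By Nakayama's lemma the module,
  localised at \<open>q\<close>, is larger than \<open>q\<close> times itself. Adding generators to the latter one by one,
  the whole localised module is reached at a last generator \<open>m0\<close>; modulo everything before, it is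
  a line over the residue field, and the coefficient of \<open>m0\<close>, evaluated at \<open>z\<close>, is the functional.
  A common denominator \<open>t\<close> suffices, so no division is needed.
\<close>

lemma evaluation_functional:
  assumes z: "\<And>i. z $ i \<noteq> 0" and gen: "set ms \<subseteq> carrier M" "carrier M = span UNIV ms"
    and ann: "\<And>f. f \<in> annihilator \<Longrightarrow> laurent_eval f z = 0"
  obtains \<phi> m0 where "m0 \<in> carrier M" "\<phi> m0 \<noteq> 0"
    "\<And>m m'. \<lbrakk>m \<in> carrier M; m' \<in> carrier M\<rbrakk> \<Longrightarrow> \<phi> (m \<oplus> m') = \<phi> m + (\<phi> m' :: complex)"
    "\<And>f m. m \<in> carrier M \<Longrightarrow> \<phi> (f \<odot> m) = laurent_eval f z * \<phi> m"
proof -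
  note ev = laurent_eval_mult[OF z] laurent_eval_add laurent_eval_diff laurent_eval_zero laurent_eval_one
  define q where "q = {f. laurent_eval f z = 0}"
  define N where "N l = {x \<oplus> y |x y. x \<in> span q ms \<and> y \<in> span UNIV l}" for l
  define Pr where "Pr l \<longleftrightarrow> (\<exists>t. t \<notin> q \<and> (\<forall>m\<in>set ms. t \<odot> m \<in> N l))" for l
  have qc: "span q ms \<subseteq> carrier M" by (rule span_closed[OF gen(1)])
  have N_closed: "N l \<subseteq> carrier M" if "set l \<subseteq> carrier M" for l
    using qc span_closed[OF that, of UNIV] by (auto simp: N_def)
  have N_add: "x \<oplus> y \<in> N l" if l: "set l \<subseteq> carrier M" and xy: "x \<in> N l" "y \<in> N l" for l x y
  proof -
    from xy obtain a b c d where *: "a \<in> span q ms" "b \<in> span UNIV l" "x = a \<oplus> b"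
      "c \<in> span q ms" "d \<in> span UNIV l" "y = c \<oplus> d" by (auto simp: N_def)
    then have "a \<in> carrier M" "b \<in> carrier M" "c \<in> carrier M" "d \<in> carrier M"
      using qc span_closed[OF l, of UNIV] by auto
    then have "x \<oplus> y = (a \<oplus> c) \<oplus> (b \<oplus> d)" using * by (simp add: M.a_ac)
    moreover have "a \<oplus> c \<in> span q ms" by (rule span_add) (use * gen(1) in \<open>auto simp: q_def ev\<close>)
    moreover have "b \<oplus> d \<in> span UNIV l" by (rule span_add) (use * l in auto)
    ultimately show ?thesis by (auto simp: N_def)
  qed
  have N_smult: "f \<odot> x \<in> N l" if l: "set l \<subseteq> carrier M" and x: "x \<in> N l" for l x f
  proof -
    from x obtain a b where *: "a \<in> span q ms" "b \<in> span UNIV l" "x = a \<oplus> b" by (auto simp: N_def)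
    then have "a \<in> carrier M" "b \<in> carrier M" using qc span_closed[OF l, of UNIV] by auto
    then have "f \<odot> x = f \<odot> a \<oplus> f \<odot> b" using * by (simp add: laurent_smult_add)
    moreover have "f \<odot> a \<in> span q ms" by (rule span_smult[of q]) (use * gen(1) in \<open>auto simp: q_def ev\<close>)
    moreover have "f \<odot> b \<in> span UNIV l" by (rule span_smult[of UNIV]) (use * l in auto)
    ultimately show ?thesis by (auto simp: N_def)
  qed
  have N_zero: "\<zero> \<in> N l" if "set l \<subseteq> carrier M" for l
  proof -
    have "\<zero> \<in> span q ms" "\<zero> \<in> span UNIV l" using gen(1) that ev by (auto intro!: span_zero simp: q_def)
    then show ?thesis unfolding N_def by (auto intro!: exI[of _ "\<zero>"])
  qed
  have all: "t \<odot> m \<in> N l" if l: "set l \<subseteq> carrier M" and t: "\<forall>m\<in>set ms. t \<odot> m \<in> N l"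
    and m: "m \<in> carrier M" for t m l
  proof -
    have "span UNIV ms \<subseteq> {m \<in> carrier M. t \<odot> m \<in> N l}"
    proof (rule span_subset[OF gen(1)])
      fix a k assume "k \<in> set ms"
      then show "a \<odot> k \<in> {m \<in> carrier M. t \<odot> m \<in> N l}"
        using gen(1) N_smult[OF l] t by (auto simp: laurent_smult_commute[of k t a])
    qed (use l N_zero N_add in \<open>auto simp: laurent_smult_add\<close>)
    then show ?thesis using m gen(2) by auto
  qed
  have notNil: "\<not> Pr []"
  proof
    assume "Pr []"
    then obtain t where t: "t \<notin> q" "\<And>m. m \<in> set ms \<Longrightarrow> t \<odot> m \<in> N []" by (auto simp: Pr_def)
    have "t \<odot> m \<in> span q ms" if m: "m \<in> set ms" for m
    proof -
      obtain x where "x \<in> span q ms" "t \<odot> m = x \<oplus> \<zero>" using t(2)[OF m] by (auto simp: N_def)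
      then show ?thesis using qc by auto
    qed
    then have "\<exists>t\<in>- q. \<forall>m\<in>set ms. t \<odot> m = \<zero>"
      by (intro nakayama[of q "- q" "set ms" ms t]) (use t(1) gen(1) in \<open>auto simp: q_def ev\<close>)
    then obtain s where s: "s \<notin> q" "\<And>m. m \<in> set ms \<Longrightarrow> s \<odot> m = \<zero>" by auto
    have "s \<in> annihilator" unfolding annihilator_def using kills_span[OF gen(1) s(2)] gen(2) by auto
    then show False using ann s(1) by (auto simp: q_def)
  qed
  have "Pr ms"
  proof -
    have "1 \<odot> m \<in> N ms" if m: "m \<in> set ms" for m
    proof -
      have "\<zero> \<in> span q ms" using gen(1) ev by (auto intro!: span_zero simp: q_def)
      moreover have "1 \<odot> m \<in> span UNIV ms" using gen(1) m by (intro span_gen) auto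
      moreover have "1 \<odot> m = \<zero> \<oplus> 1 \<odot> m" using m gen(1) by auto
      ultimately show ?thesis unfolding N_def by blast
    qed
    then show ?thesis unfolding Pr_def by (intro exI[of _ 1]) (auto simp: q_def ev)
  qed
  have "\<exists>m0 l. Pr (m0 # l) \<and> \<not> Pr l \<and> m0 \<in> carrier M \<and> set l \<subseteq> carrier M"
    if "Pr l" "set l \<subseteq> carrier M" for l
    using that
  proof (induction l)
    case Nil
    then show ?case using notNil by simp
  next
    case (Cons k l)
    then show ?case by (cases "Pr l") auto
  qed
  from this[OF \<open>Pr ms\<close> gen(1)] obtain m0 l where l: "Pr (m0 # l)" "\<not> Pr l" "m0 \<in> carrier M" "set l \<subseteq> carrier M"
    by blast
  from l(1) obtain t where t: "t \<notin> q" "\<forall>m\<in>set ms. t \<odot> m \<in> N (m0 # l)" by (auto simp: Pr_def)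
  have ex: "\<exists>h. \<exists>n\<in>N l. t \<odot> m = h \<odot> m0 \<oplus> n" if "m \<in> carrier M" for m
  proof -
    from all[OF _ t(2) that] l obtain x h y where *: "x \<in> span q ms" "y \<in> span UNIV l" "t \<odot> m = x \<oplus> (h \<odot> m0 \<oplus> y)"
      by (auto simp: N_def)
    then have "x \<in> carrier M" "y \<in> carrier M" using qc span_closed[OF l(4), of UNIV] by auto
    then have "t \<odot> m = h \<odot> m0 \<oplus> (x \<oplus> y)" using * l(3) by (simp add: M.a_ac)
    moreover have "x \<oplus> y \<in> N l" using * by (auto simp: N_def)
    ultimately show ?thesis by blast
  qed
  have uniq: "laurent_eval h z = laurent_eval h' z"
    if "n \<in> N l" "n' \<in> N l" and eq: "h \<odot> m0 \<oplus> n = h' \<odot> m0 \<oplus> n'" for h h' n n'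
  proof (rule ccontr)
    assume ne: "laurent_eval h z \<noteq> laurent_eval h' z"
    have nc: "n \<in> carrier M" "n' \<in> carrier M" using that N_closed[OF l(4)] by auto
    have "(h - h') \<odot> m0 = h \<odot> m0 \<oplus> n \<oplus> (\<ominus> n \<oplus> \<ominus> (h' \<odot> m0))"
      using nc l(3) by (simp add: laurent_diff_smult M.a_ac M.r_neg2 M.r_neg1)
    also have "\<dots> = n' \<oplus> \<ominus> n"
      using nc l(3) unfolding eq by (simp add: M.a_ac M.r_neg2 M.r_neg1 M.r_neg)
    also have "\<dots> = n' \<oplus> (- 1) \<odot> n" using nc by (simp add: laurent_uminus_eq)
    also have "\<dots> \<in> N l" using that l(4) by (intro N_add N_smult)
    finally have hm: "(h - h') \<odot> m0 \<in> N l" .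
    have "((h - h') * t) \<odot> m \<in> N l" if "m \<in> set ms" for m
    proof -
      have m: "m \<in> carrier M" using that gen(1) by auto
      obtain k y where y: "y \<in> N l" "t \<odot> m = k \<odot> m0 \<oplus> y" using ex[OF m] by auto
      have yc: "y \<in> carrier M" using y N_closed[OF l(4)] by auto
      have "((h - h') * t) \<odot> m = k \<odot> ((h - h') \<odot> m0) \<oplus> (h - h') \<odot> y"
        using m yc l(3) by (simp add: laurent_mult_smult y(2) laurent_smult_add laurent_smult_commute[of m0 "h - h'" k])
      also have "\<dots> \<in> N l" by (rule N_add[OF l(4) N_smult[OF l(4) hm] N_smult[OF l(4) y(1)]])
      finally show ?thesis .
    qed
    moreover have "(h - h') * t \<notin> q" using ne t(1) by (simp add: q_def ev)
    ultimately have "Pr l" unfolding Pr_def by blast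
    then show False using l(2) by simp
  qed
  define \<phi> where "\<phi> m = laurent_eval (SOME h. \<exists>n\<in>N l. t \<odot> m = h \<odot> m0 \<oplus> n) z" for m
  have \<phi>: "\<phi> m = laurent_eval h z" if m: "m \<in> carrier M" and n: "n \<in> N l" "t \<odot> m = h \<odot> m0 \<oplus> n" for m h n
  proof -
    obtain n' where "n' \<in> N l" "t \<odot> m = (SOME h. \<exists>n\<in>N l. t \<odot> m = h \<odot> m0 \<oplus> n) \<odot> m0 \<oplus> n'"
      using someI_ex[OF ex[OF m]] by blast
    then have "(SOME h. \<exists>n\<in>N l. t \<odot> m = h \<odot> m0 \<oplus> n) \<odot> m0 \<oplus> n' = h \<odot> m0 \<oplus> n" using n(2) by metis
    then show ?thesis unfolding \<phi>_def using n(1) \<open>n' \<in> N l\<close> by (intro uniq)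
  qed
  show thesis
  proof (rule that[of m0 \<phi>])
    show "m0 \<in> carrier M" by (rule l(3))
    have "\<phi> m0 = laurent_eval t z" by (rule \<phi>[OF l(3) N_zero[OF l(4)]]) (use l(3) in simp)
    then show "\<phi> m0 \<noteq> 0" using t(1) by (simp add: q_def)
  next
    fix m m' assume m: "m \<in> carrier M" "m' \<in> carrier M"
    obtain h n where h: "n \<in> N l" "t \<odot> m = h \<odot> m0 \<oplus> n" using ex[OF m(1)] by auto
    obtain h' n' where h': "n' \<in> N l" "t \<odot> m' = h' \<odot> m0 \<oplus> n'" using ex[OF m(2)] by auto
    have nc: "n \<in> carrier M" "n' \<in> carrier M" using h h' N_closed[OF l(4)] by auto
    have "\<phi> (m \<oplus> m') = laurent_eval (h + h') z"
    proof (rule \<phi>[OF _ N_add[OF l(4) h(1) h'(1)]])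
      show "t \<odot> (m \<oplus> m') = (h + h') \<odot> m0 \<oplus> (n \<oplus> n')"
        using m nc l(3) by (simp add: laurent_smult_add h(2) h'(2) laurent_add_smult M.a_ac)
    qed (use m in simp)
    then show "\<phi> (m \<oplus> m') = \<phi> m + \<phi> m'"
      using \<phi>[OF m(1) h] \<phi>[OF m(2) h'] by (simp add: ev)
  next
    fix f m assume m: "m \<in> carrier M"
    obtain h n where h: "n \<in> N l" "t \<odot> m = h \<odot> m0 \<oplus> n" using ex[OF m] by auto
    have nc: "n \<in> carrier M" using h N_closed[OF l(4)] by auto
    have "\<phi> (f \<odot> m) = laurent_eval (f * h) z"
    proof (rule \<phi>[OF _ N_smult[OF l(4) h(1)]])
      show "t \<odot> (f \<odot> m) = (f * h) \<odot> m0 \<oplus> f \<odot> n"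
        using m nc l(3) by (simp add: laurent_smult_commute[of m t f] h(2) laurent_smult_add laurent_mult_smult)
    qed (use m in simp)
    then show "\<phi> (f \<odot> m) = laurent_eval f z * \<phi> m"
      using \<phi>[OF m h] by (simp add: ev)
  qed
qed

end

section \<open>Noetherian modules and associated primes\<close>

lemma noetherian_maximal_submodule:
  assumes "noetherian_module R M" and F: "\<And>N. N \<in> F \<Longrightarrow> submodule N R M" "F \<noteq> {}"
  shows "\<exists>N\<in>F. \<forall>N'\<in>F. N \<subseteq> N' \<longrightarrow> N' = N"
proof (rule ccontr)
  assume no: "\<not> ?thesis"
  have ex: "\<exists>N'. N' \<in> F \<and> N \<subset> N'" if "N \<in> F" for N
    using no that by blast
  obtain N0 where "N0 \<in> F" using F(2) by blast
  then have N0: "\<exists>N. N \<in> F" by blast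
  have "\<exists>C. \<forall>k::nat. C k \<in> F \<and> C k \<subset> C (Suc k)"
    by (rule dependent_nat_choice[OF N0]) (rule ex)
  then obtain C :: "nat \<Rightarrow> _" where "\<forall>k. C k \<in> F \<and> C k \<subset> C (Suc k)" by (rule exE)
  then have C: "C k \<in> F" "C k \<subset> C (Suc k)" for k by simp_all
  have "\<exists>n. \<forall>k\<ge>n. C k = C n"
    by (rule noetherian_module.ascending_chain[OF assms(1)]) (simp_all add: F(1) C psubset_imp_subset)
  then obtain n where n: "\<forall>k\<ge>n. C k = C n" by (rule exE)
  have "C (Suc n) = C n" by (rule n[THEN spec, THEN mp]) simp
  then show False using C(2)[of n] by simp
qed

lemma laurent_module_if_noetherian: "noetherian_module laurent_ring M \<Longrightarrow> laurent_module M"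
  by (simp add: laurent_module_def noetherian_module_def)

lemma laurent_ring_sel:
  "carrier laurent_ring = UNIV" "f \<otimes>\<^bsub>laurent_ring\<^esub> g = f * g" "f \<oplus>\<^bsub>laurent_ring\<^esub> g = f + g"
  "\<one>\<^bsub>laurent_ring\<^esub> = 1" "\<zero>\<^bsub>laurent_ring\<^esub> = 0"
  by (simp_all add: laurent_ring_def)

lemma laurent_ring_uminus: "\<ominus>\<^bsub>laurent_ring\<^esub> f = - f"
proof -
  interpret L: cring laurent_ring by (rule cring_laurent_ring)
  show ?thesis by (rule L.minus_equality) (simp_all add: laurent_ring_sel)
qed

context laurent_module begin

lemma laurent_submoduleI:
  assumes "N \<subseteq> carrier M" "\<zero> \<in> N" "\<And>x y. \<lbrakk>x \<in> N; y \<in> N\<rbrakk> \<Longrightarrow> x \<oplus> y \<in> N"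
    "\<And>f x. x \<in> N \<Longrightarrow> f \<odot> x \<in> N"
  shows "submodule N laurent_ring M"
proof (rule submoduleI)
  fix x assume x: "x \<in> N"
  then have "\<ominus> x = (- 1) \<odot> x" using assms(1) by (intro laurent_uminus_eq) auto
  then show "\<ominus> x \<in> N" using assms(4)[OF x] by simp
qed (use assms in auto)

lemma span_submodule:
  assumes "set ms \<subseteq> carrier M"
  shows "submodule (span UNIV ms) laurent_ring M"
proof (rule laurent_submoduleI)
  show "span UNIV ms \<subseteq> carrier M" by (rule span_closed[OF assms])
  show "\<zero> \<in> span UNIV ms" by (rule span_zero[OF _ assms]) simp
next
  fix x y assume "x \<in> span UNIV ms" "y \<in> span UNIV ms"
  then show "x \<oplus> y \<in> span UNIV ms" by (rule span_add[OF _ assms, rotated]) simp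
next
  fix f x assume "x \<in> span UNIV ms"
  then show "f \<odot> x \<in> span UNIV ms" by (rule span_smult[OF _ assms, rotated]) simp
qed

lemma noetherian_finitely_generated:
  assumes "noetherian_module laurent_ring M"
  obtains ms where "set ms \<subseteq> carrier M" "carrier M = span UNIV ms"
proof -
  let ?F = "{span UNIV ms |ms. set ms \<subseteq> carrier M}"
  have "\<exists>N\<in>?F. \<forall>N'\<in>?F. N \<subseteq> N' \<longrightarrow> N' = N"
  proof (rule noetherian_maximal_submodule[OF assms, of ?F])
    have "set [] \<subseteq> carrier M" by simp
    then show "?F \<noteq> {}" by blast
  qed (use span_submodule in auto)
  then obtain N0 where "N0 \<in> ?F" and N0: "\<forall>N'\<in>?F. N0 \<subseteq> N' \<longrightarrow> N' = N0" by (rule bexE)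
  then obtain ms where ms: "set ms \<subseteq> carrier M" "N0 = span UNIV ms" by blast
  have N: "span UNIV ks = span UNIV ms" if "set ks \<subseteq> carrier M" "span UNIV ms \<subseteq> span UNIV ks" for ks
    using N0 that unfolding ms(2) by blast
  have "m \<in> span UNIV ms" if m: "m \<in> carrier M" for m
  proof -
    have c: "set (m # ms) \<subseteq> carrier M" using m ms(1) by auto
    have "span UNIV ms \<subseteq> span UNIV (m # ms)" using span_tail[OF _ c, of UNIV] by blast
    then have "span UNIV (m # ms) = span UNIV ms" by (rule N[OF c])
    moreover have "1 \<odot> m \<in> span UNIV (m # ms)" by (rule span_gen) (use c in simp_all)
    ultimately show ?thesis using m by simp
  qed
  then show thesis using that[OF ms(1)] span_closed[OF ms(1), of UNIV] by blast
qed

lemma annihilator_of_element_ideal: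
  assumes m: "m \<in> carrier M"
  shows "ideal {f. f \<odot> m = \<zero>} laurent_ring"
proof (rule idealI)
  show "ring (laurent_ring :: 'd laurent ring)" by (rule cring.axioms(1)[OF cring_laurent_ring])
  show "subgroup {f. f \<odot> m = \<zero>} (add_monoid laurent_ring)"
  proof (rule subgroup.intro)
    fix f g assume "f \<in> {f. f \<odot> m = \<zero>}" "g \<in> {f. f \<odot> m = \<zero>}"
    then show "f \<otimes>\<^bsub>add_monoid laurent_ring\<^esub> g \<in> {f. f \<odot> m = \<zero>}"
      using m by (simp add: laurent_ring_sel laurent_add_smult)
  next
    fix f assume "f \<in> {f. f \<odot> m = \<zero>}"
    then have "- f \<in> {f. f \<odot> m = \<zero>}" using m by (simp add: laurent_uminus_smult)
    then show "inv\<^bsub>add_monoid laurent_ring\<^esub> f \<in> {f. f \<odot> m = \<zero>}"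
      unfolding laurent_ring_uminus[symmetric] a_inv_def .
  qed (use m in \<open>simp_all add: laurent_ring_sel\<close>)
  fix f g assume "f \<in> {f. f \<odot> m = \<zero>}"
  then show "g \<otimes>\<^bsub>laurent_ring\<^esub> f \<in> {f. f \<odot> m = \<zero>}" "f \<otimes>\<^bsub>laurent_ring\<^esub> g \<in> {f. f \<odot> m = \<zero>}"
    using m laurent_smult_commute[OF m, of f g] by (simp_all add: laurent_ring_sel laurent_mult_smult)
qed

text \<open>
  If the localisation at \<open>T\<close> is not zero, some element has an annihilator disjoint from \<open>T\<close>.
  Among the multiples of such an element, one with maximal annihilator disjoint from \<open>T\<close> has a
  prime annihilator. So the localisation is zero, and finitely many generators have a common
  annihilating element in \<open>T\<close>.
\<close>

lemma annihilator_meets: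
  assumes noeth: "noetherian_module laurent_ring M"
    and T: "1 \<in> T" "\<And>s t. \<lbrakk>s \<in> T; t \<in> T\<rbrakk> \<Longrightarrow> s * t \<in> T"
    and ass: "\<And>p. p \<in> associated_primes laurent_ring M \<Longrightarrow> T \<inter> p \<noteq> {}"
  shows "T \<inter> annihilator \<noteq> {}"
proof -
  have torsion: "\<exists>t\<in>T. t \<odot> m = \<zero>" if m: "m \<in> carrier M" for m
  proof (rule ccontr)
    assume no: "\<not> (\<exists>t\<in>T. t \<odot> m = \<zero>)"
    \<comment> \<open>The annihilator of the f-multiple of m, encoded as a submodule so that the chain condition applies.\<close>
    define N where "N f = {h \<odot> m |h. h \<odot> (f \<odot> m) = \<zero>}" for f
    let ?F = "{N f |f. \<forall>t\<in>T. t \<odot> (f \<odot> m) \<noteq> \<zero>}"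
    have "\<exists>N0\<in>?F. \<forall>N'\<in>?F. N0 \<subseteq> N' \<longrightarrow> N' = N0"
    proof (rule noetherian_maximal_submodule[OF noeth, of ?F])
      have "\<forall>t\<in>T. t \<odot> (1 \<odot> m) \<noteq> \<zero>" using no m by simp
      then show "?F \<noteq> {}" by blast
    next
      have "submodule (N f) laurent_ring M" for f
      proof (rule laurent_submoduleI)
        have "0 \<odot> (f \<odot> m) = \<zero>" using m by simp
        then have "0 \<odot> m \<in> N f" unfolding N_def by blast
        then show "\<zero> \<in> N f" using m by simp
      next
        fix x y assume "x \<in> N f" "y \<in> N f"
        from \<open>x \<in> N f\<close> obtain h where h: "x = h \<odot> m" "h \<odot> (f \<odot> m) = \<zero>" unfolding N_def by blast
        from \<open>y \<in> N f\<close> obtain k where k: "y = k \<odot> m" "k \<odot> (f \<odot> m) = \<zero>" unfolding N_def by blast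
        have "x \<oplus> y = (h + k) \<odot> m" "(h + k) \<odot> (f \<odot> m) = \<zero>"
          using m h k by (simp_all add: laurent_add_smult)
        then show "x \<oplus> y \<in> N f" unfolding N_def by blast
      next
        fix g x assume "x \<in> N f"
        then obtain h where "x = h \<odot> m" "h \<odot> (f \<odot> m) = \<zero>" unfolding N_def by blast
        then have "g \<odot> x = (g * h) \<odot> m" "(g * h) \<odot> (f \<odot> m) = \<zero>"
          using m by (simp_all add: laurent_mult_smult)
        then show "g \<odot> x \<in> N f" unfolding N_def by blast
      qed (use m in \<open>auto simp: N_def\<close>)
      then show "submodule N' laurent_ring M" if "N' \<in> ?F" for N' using that by auto
    qed
    then obtain N0 where "N0 \<in> ?F" and N0: "\<forall>N'\<in>?F. N0 \<subseteq> N' \<longrightarrow> N' = N0" by (rule bexE)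
    then obtain f where f: "\<forall>t\<in>T. t \<odot> (f \<odot> m) \<noteq> \<zero>" and N0f: "N0 = N f" by auto
    have N0: "N g = N f" if "\<forall>t\<in>T. t \<odot> (g \<odot> m) \<noteq> \<zero>" "N f \<subseteq> N g" for g
      using N0 that unfolding N0f by blast
    define m' where "m' = f \<odot> m"
    have m': "m' \<in> carrier M" using m by (simp add: m'_def)
    \<comment> \<open>By maximality, a further multiple has no larger annihilator as long as the latter misses T.\<close>
    have maxi: "h \<odot> m' = \<zero>" if k: "\<And>t. t \<in> T \<Longrightarrow> (t * k) \<odot> m' \<noteq> \<zero>" and h: "(h * k) \<odot> m' = \<zero>" for h k
    proof -
      have eq: "g \<odot> ((k * f) \<odot> m) = (g * k) \<odot> m'" for g using m m' by (simp add: m'_def laurent_mult_smult)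
      have sub: "N f \<subseteq> N (k * f)"
      proof
        fix x assume "x \<in> N f"
        then obtain g where g: "x = g \<odot> m" "g \<odot> m' = \<zero>" unfolding N_def m'_def by blast
        then have "(g * k) \<odot> m' = \<zero>" using m' by (simp add: laurent_mult_smult laurent_smult_commute[of m' g k])
        then show "x \<in> N (k * f)" unfolding N_def eq using g(1) by blast
      qed
      have Nkf: "N (k * f) = N f" by (rule N0[OF _ sub]) (use k eq in simp)
      have "h \<odot> m \<in> N (k * f)" unfolding N_def eq using h by blast
      then have "h \<odot> m \<in> N f" unfolding Nkf .
      then obtain g where g: "h \<odot> m = g \<odot> m" "g \<odot> m' = \<zero>" unfolding N_def m'_def by blast
      have "h \<odot> m' = f \<odot> (h \<odot> m)" unfolding m'_def using m by (rule laurent_smult_commute)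
      also have "\<dots> = f \<odot> (g \<odot> m)" by (rule arg_cong[OF g(1)])
      also have "\<dots> = g \<odot> m'" unfolding m'_def using m by (rule laurent_smult_commute)
      finally show ?thesis using g(2) by (rule trans)
    qed
    define p where "p = {f. f \<odot> m' = \<zero>}"
    have disj: "t \<notin> p" if "t \<in> T" for t using bspec[OF f that] by (simp add: p_def m'_def)
    have prime: "a \<in> p \<or> b \<in> p" if ab: "a * b \<in> p" for a b
    proof (cases "\<exists>t\<in>T. t * b \<in> p")
      case True
      then obtain t where t: "t \<in> T" "t * b \<in> p" by blast
      have "b \<odot> m' = \<zero>"
      proof (rule maxi[of t])
        show "(s * t) \<odot> m' \<noteq> \<zero>" if "s \<in> T" for s using disj[OF T(2)[OF that t(1)]] by (simp add: p_def)
        show "(b * t) \<odot> m' = \<zero>" using t(2) by (simp add: p_def mult.commute)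
      qed
      then show ?thesis by (simp add: p_def)
    next
      case False
      have "a \<odot> m' = \<zero>" by (rule maxi[of b]) (use False ab in \<open>simp_all add: p_def\<close>)
      then show ?thesis by (simp add: p_def)
    qed
    have "primeideal p laurent_ring"
    proof (rule primeidealI)
      show "ideal p laurent_ring" unfolding p_def by (rule annihilator_of_element_ideal[OF m'])
      show "cring (laurent_ring :: 'd laurent ring)" by (rule cring_laurent_ring)
      show "carrier laurent_ring \<noteq> p" using disj[OF T(1)] by (auto simp: laurent_ring_sel)
    qed (use prime in \<open>auto simp: laurent_ring_sel\<close>)
    then have "p \<in> associated_primes laurent_ring M"
      using m' unfolding associated_primes_def p_def by (auto simp: laurent_ring_sel)
    then show False using ass disj by blast
  qed
  obtain ms where ms: "set ms \<subseteq> carrier M" "carrier M = span UNIV ms"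
    by (rule noetherian_finitely_generated[OF noeth])
  have "\<exists>t\<in>T. \<forall>m\<in>set l. t \<odot> m = \<zero>" if "set l \<subseteq> carrier M" for l
    using that
  proof (induction l)
    case Nil
    then show ?case using T(1) by auto
  next
    case (Cons k l)
    have k: "k \<in> carrier M" and l: "set l \<subseteq> carrier M" using Cons.prems by simp_all
    obtain t where t: "t \<in> T" "\<forall>m\<in>set l. t \<odot> m = \<zero>" using Cons.IH[OF l] by (rule bexE)
    obtain s where s: "s \<in> T" "s \<odot> k = \<zero>" using torsion[OF k] by (rule bexE)
    have "(t * s) \<odot> m = \<zero>" if m: "m \<in> set (k # l)" for m
    proof (cases "m = k")
      case True
      then show ?thesis using k s(2) by (simp add: laurent_mult_smult)
    next
      case False
      then have "m \<in> set l" using m by simp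
      then have "t \<odot> m = \<zero>" by (rule bspec[OF t(2)])
      moreover have "m \<in> carrier M" using l \<open>m \<in> set l\<close> by (rule subsetD)
      ultimately show ?thesis by (simp add: laurent_mult_smult laurent_smult_commute[of m t s])
    qed
    then show ?case by (intro bexI[OF _ T(2)[OF t(1) s(1)]] ballI)
  qed
  from this[OF ms(1)] obtain t where t: "t \<in> T" "\<forall>m\<in>set ms. t \<odot> m = \<zero>" by (rule bexE)
  have "t \<odot> m = \<zero>" if "m \<in> carrier M" for m
    by (rule kills_span[OF ms(1) bspec[OF t(2)] that[unfolded ms(2)]])
  then have "t \<in> annihilator" by (simp add: annihilator_def)
  then show ?thesis using t(1) by blast
qed

end

section \<open>Characters that are trivial on a subgroup\<close>

text \<open>
  The choice of a root different from 1 is what makes separation of points possible.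
\<close>

lemma unit_root_not_one:
  assumes "cmod c = 1" "d \<ge> (2::nat)"
  obtains b where "b ^ d = c" "b \<noteq> 1" "cmod b = 1"
proof (cases "c = 1")
  case True
  define x where "x = 2 * pi / real d"
  have x: "0 < x" "x \<le> pi" using assms(2) pi_gt_zero by (auto simp: x_def field_simps)
  have "cos x < cos 0" by (rule cos_monotone_0_pi) (use x in auto)
  then have "Re (cis x) \<noteq> Re 1" by simp
  then have "cis x \<noteq> 1" by (rule contrapos_nn) (simp only:)
  moreover have "cis x ^ d = 1" using assms(2) by (simp add: Complex.DeMoivre x_def)
  ultimately show thesis using that[of "cis x"] True by simp
next
  case False
  have "cis (Arg c / real d) ^ d = cis (Arg c)" using assms(2) by (simp add: Complex.DeMoivre)
  also have "\<dots> = c" using assms(1) cis_Arg_unique[of c "Arg c"] rcis_cmod_Arg[of c] by (simp add: rcis_def)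
  finally have root: "cis (Arg c / real d) ^ d = c" .
  moreover have "cis (Arg c / real d) \<noteq> 1"
  proof
    assume "cis (Arg c / real d) = 1"
    then have "c = 1 ^ d" using root by (simp only:)
    then show False using False by simp
  qed
  ultimately show thesis by (rule that) simp
qed

context laurent_module begin

text \<open>
  The graph of a character of a subgroup; graphs are convenient for Zorn's lemma. Inverses
  are written as multiples by \<open>- 1\<close>.
\<close>

definition partial_character :: "('m \<times> complex) set \<Rightarrow> bool" where
  "partial_character F \<longleftrightarrow> F \<subseteq> carrier M \<times> sphere 0 1 \<and>
     (\<forall>x c y d. (x, c) \<in> F \<longrightarrow> (y, d) \<in> F \<longrightarrow> (x \<oplus> y, c * d) \<in> F) \<and>
     (\<forall>x c. (x, c) \<in> F \<longrightarrow> ((- 1) \<odot> x, inverse c) \<in> F) \<and>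
     (\<zero>, 1) \<in> F \<and> (\<forall>c. (\<zero>, c) \<in> F \<longrightarrow> c = 1)"

lemma partial_characterD:
  assumes "partial_character F"
  shows "(x, c) \<in> F \<Longrightarrow> x \<in> carrier M" "(x, c) \<in> F \<Longrightarrow> cmod c = 1"
    "\<lbrakk>(x, c) \<in> F; (y, d) \<in> F\<rbrakk> \<Longrightarrow> (x \<oplus> y, c * d) \<in> F"
    "(x, c) \<in> F \<Longrightarrow> ((- 1) \<odot> x, inverse c) \<in> F"
    "(\<zero>, 1) \<in> F" "(\<zero>, c) \<in> F \<Longrightarrow> c = 1"
  using assms unfolding partial_character_def by auto

lemma partial_character_unique:
  assumes F: "partial_character F" and c: "(x, c) \<in> F" and d: "(x, d) \<in> F"
  shows "c = d"
proof -
  have x: "x \<in> carrier M" by (rule partial_characterD(1)[OF F c])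
  have "d \<noteq> 0" using partial_characterD(2)[OF F d] by auto
  have "x \<oplus> (- 1) \<odot> x = \<zero>" using laurent_add_smult[OF x, of 1 "- 1"] x by simp
  then have "(\<zero>, c * inverse d) \<in> F"
    using partial_characterD(3)[OF F c partial_characterD(4)[OF F d]] by simp
  then have "c * inverse d = 1" by (rule partial_characterD(6)[OF F])
  then show ?thesis using \<open>d \<noteq> 0\<close> by (simp add: field_simps)
qed

lemma partial_character_power:
  assumes F: "partial_character F" and c: "(x, c) \<in> F"
  shows "(of_int k \<odot> x, c powi k) \<in> F"
proof -
  have x: "x \<in> carrier M" by (rule partial_characterD(1)[OF F c])
  have nat: "(of_nat n \<odot> x, c ^ n) \<in> F" for n
  proof (induction n)
    case 0
    then show ?case using x partial_characterD(5)[OF F] by simp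
  next
    case (Suc n)
    have "of_nat (Suc n) \<odot> x = x \<oplus> of_nat n \<odot> x" using x by (simp add: laurent_add_smult)
    then show ?case using partial_characterD(3)[OF F c Suc] by simp
  qed
  show ?thesis
  proof (cases "k \<ge> 0")
    case True
    then show ?thesis using nat[of "nat k"] by (simp add: power_int_def)
  next
    case False
    then have k: "of_int k = (- 1 :: 'd laurent) * of_nat (nat (- k))" by simp
    have "(- 1) \<odot> (of_nat (nat (- k)) \<odot> x) = of_int k \<odot> x"
      unfolding k by (rule laurent_mult_smult[OF x, symmetric])
    then show ?thesis using partial_characterD(4)[OF F nat[of "nat (- k)"]] False
      by (simp add: power_int_def power_inverse)
  qed
qed

text \<open>
  The circle is divisible: the new value \<open>b\<close> at \<open>y\<close> only has to be compatible with the values at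
  the multiples of \<open>y\<close> in the domain, which are the multiples of a least one.
\<close>

lemma partial_character_extend:
  assumes F: "partial_character F" and y: "y \<in> carrier M" "y \<notin> Domain F"
  obtains F' b where "partial_character F'" "F \<subseteq> F'" "(y, b) \<in> F'" "b \<noteq> 1"
proof -
  note FD = partial_characterD[OF F]
  have "\<exists>b. b \<noteq> 1 \<and> cmod b = 1 \<and> (\<forall>k c. (of_int k \<odot> y, c) \<in> F \<longrightarrow> c = b powi k)"
  proof (cases "\<exists>k\<ge>(1::nat). of_nat k \<odot> y \<in> Domain F")
    case True
    define d where "d = (LEAST k. k \<ge> (1::nat) \<and> of_nat k \<odot> y \<in> Domain F)"
    have "d \<ge> 1 \<and> of_nat d \<odot> y \<in> Domain F" unfolding d_def by (rule LeastI_ex[OF True])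
    then have d: "d \<ge> 1" "of_nat d \<odot> y \<in> Domain F" by (blast, blast)
    have least: "\<not> (k \<ge> 1 \<and> of_nat k \<odot> y \<in> Domain F)" if "k < d" for k
      using not_less_Least[OF that[unfolded d_def]] .
    have "d \<noteq> 1" using d(2) y by auto
    then have d2: "d \<ge> 2" using d(1) by simp
    obtain c where c: "(of_nat d \<odot> y, c) \<in> F" using d(2) by (rule DomainE)
    obtain b where b: "b ^ d = c" "b \<noteq> 1" "cmod b = 1" by (rule unit_root_not_one[OF FD(2)[OF c] d2])
    have "c' = b powi k" if c': "(of_int k \<odot> y, c') \<in> F" for k c'
    proof -
      define q r where "q = k div int d" and "r = nat (k mod int d)"
      have r: "int r = k mod int d" "r < d" using d(1) by (simp_all add: r_def nat_less_iff)
      have kqr: "k = int d * q + int r" by (simp add: q_def r(1))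
      have "((- 1) \<odot> (of_int q \<odot> (of_nat d \<odot> y)), inverse (c powi q)) \<in> F"
        by (intro FD(4) partial_character_power[OF F c])
      from FD(3)[OF c' this]
      have *: "(of_int k \<odot> y \<oplus> (- 1) \<odot> (of_int q \<odot> (of_nat d \<odot> y)), c' * inverse (c powi q)) \<in> F" .
      have "of_int k \<odot> y \<oplus> (- 1) \<odot> (of_int q \<odot> (of_nat d \<odot> y)) = (of_int k + (- 1) * (of_int q * of_nat d)) \<odot> y"
        using y by (simp only: laurent_mult_smult laurent_add_smult laurent_smult_closed)
      also have "of_int k + (- 1) * (of_int q * of_nat d) = (of_nat r :: 'd laurent)"
        unfolding kqr by simp
      finally have **: "(of_nat r \<odot> y, c' * inverse (c powi q)) \<in> F" using * by simp
      then have "of_nat r \<odot> y \<in> Domain F" by (rule DomainI)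
      then have "r = 0" using least[OF r(2)] by linarith
      then have "(\<zero>, c' * inverse (c powi q)) \<in> F" using ** y by simp
      then have "c' * inverse (c powi q) = 1" by (rule FD(6))
      moreover have "c powi q \<noteq> 0" using FD(2)[OF c] by auto
      ultimately have "c' = c powi q" by (simp add: field_simps)
      then show ?thesis unfolding kqr \<open>r = 0\<close> b(1)[symmetric] by (simp add: power_int_mult)
    qed
    then show ?thesis using b by blast
  next
    case False
    have "c = (- 1) powi k" if c: "(of_int k \<odot> y, c) \<in> F" for k c
    proof (cases "k = 0")
      case True
      then show ?thesis using c y FD(6) by simp
    next
      case k: False
      have "of_nat (nat \<bar>k\<bar>) \<odot> y \<in> Domain F"
      proof (cases "k > 0")
        case True
        then show ?thesis using DomainI[OF c] by simp
      next
        case False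
        then have "of_nat (nat \<bar>k\<bar>) = (- 1 :: 'd laurent) * of_int k" by simp
        then have "of_nat (nat \<bar>k\<bar>) \<odot> y = ((- 1) * of_int k) \<odot> y" by (rule arg_cong)
        also have "\<dots> = (- 1) \<odot> (of_int k \<odot> y)" by (rule laurent_mult_smult[OF y(1)])
        finally have "of_nat (nat \<bar>k\<bar>) \<odot> y = (- 1) \<odot> (of_int k \<odot> y)" .
        then show ?thesis using DomainI[OF FD(4)[OF c]] by simp
      qed
      moreover have "nat \<bar>k\<bar> \<ge> 1" using k by simp
      ultimately show ?thesis using False by blast
    qed
    then show ?thesis by (intro exI[of _ "- 1"]) simp
  qed
  then obtain b where b: "b \<noteq> 1" "cmod b = 1" "\<And>k c. (of_int k \<odot> y, c) \<in> F \<Longrightarrow> c = b powi k" by blast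
  have b0: "b \<noteq> 0" using b(2) by auto
  define F' where "F' = {(x \<oplus> of_int k \<odot> y, c * b powi k) |x c k. (x, c) \<in> F}"
  have F'I: "(x \<oplus> of_int k \<odot> y, c * b powi k) \<in> F'" if "(x, c) \<in> F" for x c k
    unfolding F'_def using that by blast
  have F'E: thesis if "(z, e) \<in> F'" "\<And>x c k. \<lbrakk>(x, c) \<in> F; z = x \<oplus> of_int k \<odot> y; e = c * b powi k\<rbrakk> \<Longrightarrow> thesis"
    for z e thesis using that unfolding F'_def by blast
  have "partial_character F'"
    unfolding partial_character_def
  proof (intro conjI allI impI)
    show "F' \<subseteq> carrier M \<times> sphere 0 1"
    proof (intro subrelI)
      fix z e assume "(z, e) \<in> F'"
      then show "(z, e) \<in> carrier M \<times> sphere 0 1"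
      proof (rule F'E)
        fix x c k assume 1: "(x, c) \<in> F" "z = x \<oplus> of_int k \<odot> y" "e = c * b powi k"
        then show ?thesis using FD(1)[OF 1(1)] FD(2)[OF 1(1)] b(2) y(1) by (simp add: norm_mult norm_power_int)
      qed
    qed
  next
    fix z e z' e' assume "(z, e) \<in> F'"
    then obtain x c k where 1: "(x, c) \<in> F" "z = x \<oplus> of_int k \<odot> y" "e = c * b powi k" by (rule F'E)
    assume "(z', e') \<in> F'"
    then obtain x' c' k' where 2: "(x', c') \<in> F" "z' = x' \<oplus> of_int k' \<odot> y" "e' = c' * b powi k'" by (rule F'E)
    have "z \<oplus> z' = (x \<oplus> x') \<oplus> of_int (k + k') \<odot> y"
      using FD(1)[OF 1(1)] FD(1)[OF 2(1)] y by (simp add: 1 2 laurent_add_smult M.a_ac)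
    moreover have "e * e' = (c * c') * b powi (k + k')" by (simp add: 1 2 power_int_add b0)
    ultimately show "(z \<oplus> z', e * e') \<in> F'" using F'I[OF FD(3)[OF 1(1) 2(1)], of "k + k'"] by simp
  next
    fix z e assume "(z, e) \<in> F'"
    then obtain x c k where 1: "(x, c) \<in> F" "z = x \<oplus> of_int k \<odot> y" "e = c * b powi k" by (rule F'E)
    have "(- 1) \<odot> z = (- 1) \<odot> x \<oplus> ((- 1) * of_int k) \<odot> y"
      unfolding 1(2) using FD(1)[OF 1(1)] y by (simp only: laurent_smult_add laurent_mult_smult laurent_smult_closed)
    moreover have "(- 1) * of_int k = (of_int (- k) :: 'd laurent)" by simp
    moreover have "inverse e = inverse c * b powi (- k)" by (simp add: 1 power_int_minus)
    ultimately show "((- 1) \<odot> z, inverse e) \<in> F'" using F'I[OF FD(4)[OF 1(1)], of "- k"] by simp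
  next
    show "(\<zero>, 1) \<in> F'" using F'I[OF FD(5), of 0] y by simp
  next
    fix e assume "(\<zero>, e) \<in> F'"
    then obtain x c k where 1: "(x, c) \<in> F" "\<zero> = x \<oplus> of_int k \<odot> y" "e = c * b powi k" by (rule F'E)
    have x: "x \<in> carrier M" by (rule FD(1)[OF 1(1)])
    have "of_int k \<odot> y = \<ominus> x" using M.minus_equality[of "of_int k \<odot> y" x] 1(2) x y by (simp add: M.a_comm)
    then have "(of_int k \<odot> y, inverse c) \<in> F" using FD(4)[OF 1(1)] x by (simp add: laurent_uminus_eq)
    then have "inverse c = b powi k" by (rule b(3))
    moreover have "c \<noteq> 0" using FD(2)[OF 1(1)] by auto
    ultimately show "e = 1" unfolding 1(3) by (metis right_inverse)
  qed
  moreover have "F \<subseteq> F'"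
  proof (rule subrelI)
    fix x c assume "(x, c) \<in> F"
    then show "(x, c) \<in> F'" using F'I[of x c 0] FD(1) y by simp
  qed
  moreover have "(y, b) \<in> F'" using F'I[OF FD(5), of 1] y by simp
  ultimately show thesis by (rule that[OF _ _ _ b(1)])
qed

lemma character_separates:
  assumes N: "N \<subseteq> carrier M" "\<zero> \<in> N" "\<And>x y. \<lbrakk>x \<in> N; y \<in> N\<rbrakk> \<Longrightarrow> x \<oplus> y \<in> N" "\<And>x. x \<in> N \<Longrightarrow> (- 1) \<odot> x \<in> N"
    and y: "y \<in> carrier M" "y \<notin> N"
  shows "\<exists>\<xi>\<in>characters M. (\<forall>x\<in>N. \<xi> x = 1) \<and> \<xi> y \<noteq> 1"
proof -
  have "partial_character (N \<times> {1})" using N unfolding partial_character_def by auto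
  moreover have "y \<notin> Domain (N \<times> {1})" using y(2) by auto
  ultimately obtain F1 b where F1: "partial_character F1" "N \<times> {1} \<subseteq> F1" "(y, b) \<in> F1" "b \<noteq> 1"
    by (rule partial_character_extend[OF _ y(1)])
  let ?A = "{F. partial_character F \<and> F1 \<subseteq> F}"
  have "\<exists>F\<in>?A. \<forall>X\<in>?A. F \<subseteq> X \<longrightarrow> X = F"
  proof (rule subset_Zorn_nonempty)
    show "?A \<noteq> {}" using F1(1) by blast
    fix \<C> assume ne: "\<C> \<noteq> {}" and ch: "subset.chain ?A \<C>"
    then have P: "\<And>F. F \<in> \<C> \<Longrightarrow> partial_character F" and sub: "\<And>F. F \<in> \<C> \<Longrightarrow> F1 \<subseteq> F"
      by (auto simp: subset_chain_def)
    have two: "\<exists>F\<in>\<C>. p \<in> F \<and> q \<in> F" if pq: "p \<in> \<Union>\<C>" "q \<in> \<Union>\<C>" for p q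
    proof -
      obtain F G where FG: "F \<in> \<C>" "p \<in> F" "G \<in> \<C>" "q \<in> G" using pq by blast
      then have "F \<subseteq> G \<or> G \<subseteq> F" using ch by (auto simp: subset_chain_def)
      then show ?thesis using FG by blast
    qed
    have "partial_character (\<Union>\<C>)"
      unfolding partial_character_def
    proof (intro conjI allI impI)
      show "\<Union>\<C> \<subseteq> carrier M \<times> sphere 0 1" using P unfolding partial_character_def by blast
    next
      fix x c z d assume "(x, c) \<in> \<Union>\<C>" "(z, d) \<in> \<Union>\<C>"
      then obtain F where F: "F \<in> \<C>" "(x, c) \<in> F" "(z, d) \<in> F" using two by blast
      then show "(x \<oplus> z, c * d) \<in> \<Union>\<C>" using partial_characterD(3)[OF P[OF F(1)] F(2,3)] by blast
    next
      fix x c assume "(x, c) \<in> \<Union>\<C>"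
      then obtain F where F: "F \<in> \<C>" "(x, c) \<in> F" by blast
      then show "((- 1) \<odot> x, inverse c) \<in> \<Union>\<C>" using partial_characterD(4)[OF P[OF F(1)] F(2)] by blast
    next
      show "(\<zero>, 1) \<in> \<Union>\<C>" using ne partial_characterD(5)[OF P] by blast
    next
      fix c assume "(\<zero>, c) \<in> \<Union>\<C>"
      then obtain F where F: "F \<in> \<C>" "(\<zero>, c) \<in> F" by blast
      then show "c = 1" using partial_characterD(6)[OF P[OF F(1)]] by blast
    qed
    then show "\<Union>\<C> \<in> ?A" using ne sub by blast
  qed
  then obtain F where "F \<in> ?A" and Fmax: "\<forall>X\<in>?A. F \<subseteq> X \<longrightarrow> X = F" by (rule bexE)
  then have F: "partial_character F" "F1 \<subseteq> F" by simp_all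
  have maxi: "X = F" if "partial_character X" "F1 \<subseteq> X" "F \<subseteq> X" for X
    using Fmax that by simp
  have "x \<in> Domain F" if x: "x \<in> carrier M" for x
  proof (rule ccontr)
    assume nx: "x \<notin> Domain F"
    obtain F' c where "partial_character F'" "F \<subseteq> F'" "(x, c) \<in> F'" "c \<noteq> 1"
      by (rule partial_character_extend[OF F(1) x nx])
    then have "F' = F" using F(2) by (intro maxi[OF _ order_trans])
    then show False using \<open>(x, c) \<in> F'\<close> nx by (auto intro: DomainI)
  qed
  then have "\<forall>x\<in>carrier M. \<exists>c. (x, c) \<in> F" by (simp add: Domain_iff)
  from bchoice[OF this] obtain f where f: "\<And>x. x \<in> carrier M \<Longrightarrow> (x, f x) \<in> F" by blast
  define \<xi> where "\<xi> = restrict f (carrier M)"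
  have val: "\<xi> x = c" if "(x, c) \<in> F" for x c
  proof -
    have "x \<in> carrier M" by (rule partial_characterD(1)[OF F(1) that])
    then show ?thesis unfolding \<xi>_def using partial_character_unique[OF F(1) f that] by simp
  qed
  have "\<xi> \<in> characters M"
    unfolding characters_def
  proof (intro CollectI conjI ballI)
    show "\<xi> \<in> carrier M \<rightarrow>\<^sub>E sphere 0 1"
      using partial_characterD(2)[OF F(1) f] by (auto simp: \<xi>_def)
    fix x z assume "x \<in> carrier M" "z \<in> carrier M"
    then have "\<xi> (x \<oplus> z) = f x * f z" by (intro val partial_characterD(3)[OF F(1)] f)
    then show "\<xi> (x \<oplus> z) = \<xi> x * \<xi> z" using \<open>x \<in> carrier M\<close> \<open>z \<in> carrier M\<close> by (simp add: \<xi>_def)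
  qed
  moreover have "\<xi> x = 1" if "x \<in> N" for x using F1(2) F(2) that by (intro val) auto
  moreover have "\<xi> y \<noteq> 1" using val[of y b] F1(3,4) F(2) by auto
  ultimately show ?thesis by blast
qed

end

section \<open>Expansiveness in terms of characters\<close>

lemma infdist_half_space:
  assumes "norm v = 1"
  shows "x \<bullet> v \<le> infdist x (half_space v)"
proof -
  have ne: "half_space v \<noteq> {}" by (auto simp: half_space_def intro!: exI[of _ 0])
  show ?thesis unfolding infdist_notempty[OF ne]
  proof (rule cINF_greatest[OF ne])
    fix h assume "h \<in> half_space v"
    then have "x \<bullet> v \<le> (x - h) \<bullet> v" by (simp add: half_space_def inner_diff_left)
    also have "\<dots> \<le> norm (x - h) * norm v" by (rule norm_cauchy_schwarz)
    finally show "x \<bullet> v \<le> dist x h" using assms by (simp add: dist_norm)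
  qed
qed

definition half_lattice :: "real ^ 'd::finite \<Rightarrow> (int ^ 'd) set" where
  "half_lattice v = {n. lattice_point n \<bullet> v \<le> 0}"

lemma lattice_point_add: "lattice_point (n + k) = lattice_point n + lattice_point k"
  by (simp add: lattice_point_def vec_eq_iff)

lemma lattice_point_uminus: "lattice_point (- n) = - lattice_point n"
  by (simp add: lattice_point_def vec_eq_iff)

lemma lattice_point_diff: "lattice_point (n - k) = lattice_point n - lattice_point k"
  by (simp add: lattice_point_def vec_eq_iff)

lemma lattice_point_zero: "lattice_point 0 = 0"
  by (simp add: lattice_point_def vec_eq_iff)

lemma half_lattice_add: "\<lbrakk>n \<in> half_lattice v; k \<in> half_lattice v\<rbrakk> \<Longrightarrow> n + k \<in> half_lattice v"
  by (simp add: half_lattice_def lattice_point_add inner_add_left)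

lemma lattice_point_axis: "lattice_point (axis i c) = axis i (of_int c)"
  by (simp add: lattice_point_def vec_eq_iff axis_def)

lemma exists_high_lattice_point:
  assumes "norm v = 1"
  obtains k :: "int ^ 'd::finite" where "lattice_point k \<bullet> (v :: real ^ 'd) \<ge> t"
proof -
  have "v \<noteq> 0" using assms by auto
  then obtain i where i: "v $ i \<noteq> 0" by (auto simp: vec_eq_iff)
  obtain c :: int where c: "\<bar>t\<bar> / \<bar>v $ i\<bar> \<le> of_int c" using ex_le_of_int by blast
  then have "\<bar>t\<bar> \<le> of_int c * \<bar>v $ i\<bar>" using i by (simp add: field_simps)
  then have "t \<le> lattice_point (axis i (if v $ i > 0 then c else - c)) \<bullet> v"
    by (auto simp: lattice_point_axis inner_axis' abs_if split: if_splits)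
  then show thesis by (rule that)
qed

lemma half_space_subset_thicken: "t \<ge> 0 \<Longrightarrow> half_space v \<subseteq> thicken (half_space v) t"
  by (auto simp: thicken_def)

lemma thicken_half_space_subset:
  assumes "norm v = 1"
  shows "thicken (half_space v) t \<subseteq> {x. x \<bullet> v \<le> t}"
  using infdist_half_space[OF assms] order_trans by (fastforce simp: thicken_def)

lemma topspace_dual_space: "topspace (dual_space M) = characters M"
  by (auto simp: dual_space_def characters_def)

lemma characters_norm: "\<lbrakk>\<xi> \<in> characters M; x \<in> carrier M\<rbrakk> \<Longrightarrow> cmod (\<xi> x) = 1"
  by (auto simp: characters_def PiE_iff)

lemma characters_add:
  "\<lbrakk>\<xi> \<in> characters M; x \<in> carrier M; y \<in> carrier M\<rbrakk> \<Longrightarrow> \<xi> (x \<oplus>\<^bsub>M\<^esub> y) = \<xi> x * \<xi> y"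
  by (simp add: characters_def)

lemma dual_space_neighbourhood:
  assumes U: "openin (dual_space M) U" and \<eta>: "\<eta> \<in> U"
  obtains J e where "finite J" "J \<subseteq> carrier M" "e > 0"
    "\<forall>\<xi>\<in>characters M. (\<forall>m\<in>J. dist (\<eta> m) (\<xi> m) < e) \<longrightarrow> \<xi> \<in> U"
proof -
  let ?S = "top_of_set (sphere 0 1 :: complex set)"
  obtain V where V: "openin (product_topology (\<lambda>_. ?S) (carrier M)) V" "U = V \<inter> characters M"
    using U by (auto simp: dual_space_def openin_subtopology)
  have "\<eta> \<in> V" using \<eta> V(2) by simp
  obtain B where B: "finite {i \<in> carrier M. B i \<noteq> topspace ?S}" "\<And>i. i \<in> carrier M \<Longrightarrow> openin ?S (B i)"
    "\<eta> \<in> Pi\<^sub>E (carrier M) B" "Pi\<^sub>E (carrier M) B \<subseteq> V"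
    using V(1)[unfolded openin_product_topology_alt, THEN bspec, OF \<open>\<eta> \<in> V\<close>] by (elim exE conjE) (rule that; simp)
  define J where "J = {i \<in> carrier M. B i \<noteq> topspace ?S}"
  have "\<exists>e>0. \<forall>z\<in>sphere 0 1. dist (\<eta> i) z < e \<longrightarrow> z \<in> B i" if i: "i \<in> carrier M" for i
  proof -
    obtain W where W: "open W" "B i = sphere 0 1 \<inter> W" using B(2)[OF i] by (auto simp: openin_open)
    have "\<eta> i \<in> W" using B(3) i W(2) by (auto simp: PiE_iff)
    then obtain e where "e > 0" "ball (\<eta> i) e \<subseteq> W" using W(1) open_contains_ball by blast
    then show ?thesis using W(2) by (intro exI[of _ e]) (auto simp: subset_iff)
  qed
  then have "\<forall>i\<in>carrier M. \<exists>e. e > 0 \<and> (\<forall>z\<in>sphere 0 1. dist (\<eta> i) z < e \<longrightarrow> z \<in> B i)" by blast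
  from bchoice[OF this] obtain E where E: "\<And>i. i \<in> carrier M \<Longrightarrow> E i > 0"
    "\<And>i z. \<lbrakk>i \<in> carrier M; z \<in> sphere 0 1; dist (\<eta> i) z < E i\<rbrakk> \<Longrightarrow> z \<in> B i" by blast
  define e where "e = Min (insert 1 (E ` J))"
  have fin: "finite J" and sub: "J \<subseteq> carrier M" using B(1) by (auto simp: J_def)
  have e: "e > 0" "\<And>i. i \<in> J \<Longrightarrow> e \<le> E i" unfolding e_def using fin sub E(1) by auto
  show thesis
  proof (rule that[OF fin sub e(1)], intro ballI impI)
    fix \<xi> assume \<xi>: "\<xi> \<in> characters M" and "\<forall>m\<in>J. dist (\<eta> m) (\<xi> m) < e"
    then have close: "\<And>m. m \<in> J \<Longrightarrow> dist (\<eta> m) (\<xi> m) < e" by blast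
    have ext: "\<xi> \<in> carrier M \<rightarrow>\<^sub>E sphere 0 1" using \<xi> by (simp add: characters_def)
    have "\<xi> i \<in> B i" if i: "i \<in> carrier M" for i
    proof (cases "i \<in> J")
      case True
      then have "dist (\<eta> i) (\<xi> i) < E i" using close[OF True] e(2)[OF True] by linarith
      then show ?thesis using E(2)[OF i] ext i by (auto simp: PiE_iff)
    next
      case False
      then show ?thesis using i ext by (auto simp: J_def PiE_iff)
    qed
    then have "\<xi> \<in> Pi\<^sub>E (carrier M) B" using ext by (auto simp: PiE_iff)
    then show "\<xi> \<in> U" using B(4) V(2) \<xi> by blast
  qed
qed

text \<open>
  Evaluation at \<open>m\<close> is continuous on a compact metric space, hence uniformly continuous.
\<close>

lemma dual_space_uniform:
  assumes T: "compact_space (dual_space M)" and \<rho>: "compatible_metric (dual_space M) \<rho>"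
    and S: "finite S" "S \<subseteq> carrier M" and e: "e > 0"
  shows "\<exists>d>0. \<forall>\<xi>\<in>characters M. \<forall>\<eta>\<in>characters M. \<rho> \<xi> \<eta> < d \<longrightarrow> (\<forall>m\<in>S. dist (\<xi> m) (\<eta> m) < e)"
  using S
proof (induction S rule: finite_induct)
  case empty
  show ?case by (intro exI[of _ 1]) auto
next
  case (insert m S)
  interpret r: Metric_space "topspace (dual_space M)" \<rho> using \<rho> by (simp add: compatible_metric_def)
  define X where "X = metric (topspace (dual_space M), \<rho>)"
  define Y where "Y = metric (UNIV :: complex set, dist)"
  have [simp]: "mspace X = topspace (dual_space M)" "mdist X = \<rho>" "mspace Y = UNIV" "mdist Y = dist"
    by (simp_all add: X_def Y_def r.Metric_space_axioms Met_TC.Metric_space_axioms)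
  have X: "mtopology_of X = dual_space M" and Y: "mtopology_of Y = euclidean"
    using \<rho> by (simp_all add: mtopology_of_def compatible_metric_def)
  have "continuous_map (dual_space M) euclidean (\<lambda>\<xi>. \<xi> m)"
    using continuous_map_product_projection[of m "carrier M" "\<lambda>_. top_of_set (sphere 0 1 :: complex set)"] insert.prems
    unfolding dual_space_def by (intro continuous_map_from_subtopology) (simp add: continuous_map_in_subtopology)
  then have "uniformly_continuous_map X Y (\<lambda>\<xi>. \<xi> m)"
    using T by (intro continuous_imp_uniformly_continuous_map) (simp_all add: X Y)
  then have "\<exists>d>0. \<forall>\<xi>\<in>characters M. \<forall>\<eta>\<in>characters M. \<rho> \<xi> \<eta> < d \<longrightarrow> dist (\<xi> m) (\<eta> m) < e"
    using e by (simp add: uniformly_continuous_map_def topspace_dual_space dist_commute r.commute)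
  then obtain d1 where d1: "d1 > 0" "\<And>\<xi> \<eta>. \<lbrakk>\<xi> \<in> characters M; \<eta> \<in> characters M; \<rho> \<xi> \<eta> < d1\<rbrakk> \<Longrightarrow> dist (\<xi> m) (\<eta> m) < e"
    by blast
  obtain d2 where d2: "d2 > 0" "\<And>\<xi> \<eta> m. \<lbrakk>\<xi> \<in> characters M; \<eta> \<in> characters M; \<rho> \<xi> \<eta> < d2; m \<in> S\<rbrakk> \<Longrightarrow> dist (\<xi> m) (\<eta> m) < e"
    using insert by (auto; blast)
  show ?case
    by (rule exI[of _ "min d1 d2"]) (use d1 d2 in auto)
qed

context laurent_module begin

lemma trivial_character: "(\<lambda>m\<in>carrier M. 1) \<in> characters M"
  by (auto simp: characters_def)

lemma dual_action_apply: "m \<in> carrier M \<Longrightarrow> dual_action M n \<xi> m = \<xi> (laurent_monom n \<odot> m)"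
  by (simp add: dual_action_def)

lemma dual_action_character: "\<xi> \<in> characters M \<Longrightarrow> dual_action M n \<xi> \<in> characters M"
  using dual_action_closed[of M \<xi> n] module_axioms by (simp add: topspace_dual_space)

lemma compact_dual: "compact_space (dual_space M)"
  by (rule compact_dual_space) unfold_locales

text \<open>
  Expansiveness along the half-space without a metric and without thickening. A thickened
  half-space lies in a translate by a lattice point, which is absorbed by the set \<open>S\<close>.
\<close>

definition character_expansive :: "real ^ 'd \<Rightarrow> bool" where
  "character_expansive v \<longleftrightarrow> (\<exists>S. finite S \<and> S \<subseteq> carrier M \<and> (\<exists>\<delta>>0. \<forall>\<xi>\<in>characters M.
     (\<forall>n\<in>half_lattice v. \<forall>m\<in>S. cmod (\<xi> (laurent_monom n \<odot> m) - 1) \<le> \<delta>) \<longrightarrow> (\<forall>m\<in>carrier M. \<xi> m = 1)))"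

lemma expansive_imp_character_expansive:
  assumes v: "norm v = 1" and exp: "expansive_along (dual_space M) (dual_action M) (half_space v)"
  shows "character_expansive v"
proof -
  from exp obtain \<rho> \<epsilon> t where \<rho>: "compatible_metric (dual_space M) \<rho>" and \<epsilon>: "\<epsilon> > 0" and t: "t > 0"
    and ex: "\<And>x y. \<lbrakk>x \<in> characters M; y \<in> characters M;
      orbit_dist \<rho> (dual_action M) (thicken (half_space v) t) x y \<le> \<epsilon>\<rbrakk> \<Longrightarrow> x = y"
    by (auto simp: expansive_along_def metric_expansive_along_def topspace_dual_space)
  interpret r: Metric_space "topspace (dual_space M)" \<rho> using \<rho> by (simp add: compatible_metric_def)
  define u where "u = (\<lambda>m\<in>carrier M. 1 :: complex)"
  have u: "u \<in> characters M" unfolding u_def by (rule trivial_character)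
  have top: "r.mtopology = dual_space M" using \<rho> by (simp add: compatible_metric_def)
  have "openin (dual_space M) (r.mball u \<epsilon>)" using r.openin_mball[of u \<epsilon>] unfolding top .
  moreover have "u \<in> topspace (dual_space M)" using u by (simp only: topspace_dual_space)
  then have "u \<in> r.mball u \<epsilon>" using \<epsilon> by simp
  ultimately obtain J e where J: "finite J" "J \<subseteq> carrier M" and e: "e > 0"
    and nbh: "\<forall>\<xi>\<in>characters M. (\<forall>m\<in>J. dist (u m) (\<xi> m) < e) \<longrightarrow> \<xi> \<in> r.mball u \<epsilon>"
    by (rule dual_space_neighbourhood)
  obtain k :: "int ^ 'd" where k: "lattice_point k \<bullet> v \<ge> t" by (rule exists_high_lattice_point[OF v])
  show ?thesis
    unfolding character_expansive_def
  proof (intro exI[of _ "(\<lambda>m. laurent_monom k \<odot> m) ` J"] exI[of _ "e / 2"] conjI ballI impI)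
    fix \<xi> m
    assume \<xi>: "\<xi> \<in> characters M" and m: "m \<in> carrier M" and
      small: "\<forall>n\<in>half_lattice v. \<forall>m\<in>(\<lambda>m. laurent_monom k \<odot> m) ` J. cmod (\<xi> (laurent_monom n \<odot> m) - 1) \<le> e / 2"
    let ?N = "{n. lattice_point n \<in> thicken (half_space v) t}"
    have ne: "?N \<noteq> {}"
      using half_space_subset_thicken[of t v] t by (auto simp: half_space_def lattice_point_zero intro!: exI[of _ 0])
    have fixed: "dual_action M n u = u" for n by (auto simp: dual_action_def u_def)
    have "\<rho> (dual_action M n \<xi>) (dual_action M n u) \<le> \<epsilon>" if n: "n \<in> ?N" for n
    proof -
      have "lattice_point n \<bullet> v \<le> t" using n thicken_half_space_subset[OF v] by auto
      then have nk: "n - k \<in> half_lattice v" using k by (simp add: half_lattice_def lattice_point_diff inner_diff_left)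
      have "dist (u m) (dual_action M n \<xi> m) < e" if "m \<in> J" for m
      proof -
        have mc: "m \<in> carrier M" using that J by auto
        have "laurent_monom n \<odot> m = laurent_monom (n - k) \<odot> (laurent_monom k \<odot> m)"
          using laurent_mult_smult[OF mc, of "laurent_monom (n - k)" "laurent_monom k"] by (simp add: laurent_monom_mult)
        then have "cmod (\<xi> (laurent_monom n \<odot> m) - 1) \<le> e / 2" using small nk that by simp
        then show ?thesis using mc e by (simp add: u_def dual_action_apply dist_norm norm_minus_commute)
      qed
      then have "dual_action M n \<xi> \<in> r.mball u \<epsilon>" using nbh dual_action_character[OF \<xi>] by blast
      then have "\<rho> u (dual_action M n \<xi>) < \<epsilon>" by simp
      then show ?thesis unfolding fixed by (simp add: r.commute)
    qed
    then have "(SUP n\<in>?N. \<rho> (dual_action M n \<xi>) (dual_action M n u)) \<le> \<epsilon>" using ne by (intro cSUP_least)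
    then have "orbit_dist \<rho> (dual_action M) (thicken (half_space v) t) \<xi> u \<le> \<epsilon>"
      unfolding orbit_dist_def if_not_P[OF ne] .
    then have "\<xi> = u" by (rule ex[OF \<xi> u])
    then show "\<xi> m = 1" using m by (simp add: u_def)
  qed (use J e in auto)
qed

text \<open>
  The quotient of two characters with close orbits is a character close to the trivial one.
\<close>

lemma character_expansive_imp_expansive:
  assumes c: "countable (carrier M)" and exp: "character_expansive v"
  shows "expansive_along (dual_space M) (dual_action M) (half_space v)"
proof -
  obtain A \<rho> where A: "Metric_space A \<rho>" "dual_space M = Metric_space.mtopology A \<rho>"
    using metrizable_dual_space[OF c] unfolding metrizable_space_def by (elim exE conjE)
  have top: "topspace (dual_space M) = A" unfolding A(2) by (rule Metric_space.topspace_mtopology[OF A(1)])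
  have \<rho>: "compatible_metric (dual_space M) \<rho>"
    unfolding compatible_metric_def top by (rule conjI[OF A(1) A(2)[symmetric]])
  from exp obtain S \<delta> where S: "finite S" "S \<subseteq> carrier M" and \<delta>: "\<delta> > 0"
    and ex: "\<forall>\<xi>\<in>characters M. (\<forall>n\<in>half_lattice v. \<forall>m\<in>S. cmod (\<xi> (laurent_monom n \<odot> m) - 1) \<le> \<delta>)
      \<longrightarrow> (\<forall>m\<in>carrier M. \<xi> m = 1)"
    unfolding character_expansive_def by (elim exE conjE)
  obtain d where d: "d > 0" and uni: "\<forall>\<xi>\<in>characters M. \<forall>\<eta>\<in>characters M. \<rho> \<xi> \<eta> < d \<longrightarrow> (\<forall>m\<in>S. dist (\<xi> m) (\<eta> m) < \<delta>)"
    using dual_space_uniform[OF compact_dual \<rho> S \<delta>] by (elim exE conjE)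
  obtain B where B: "\<And>x y. \<lbrakk>x \<in> characters M; y \<in> characters M\<rbrakk> \<Longrightarrow> \<rho> x y \<le> B"
    using compatible_metric_bounded[OF compact_dual \<rho>] unfolding topspace_dual_space by blast
  have "\<xi> = \<eta>" if \<xi>: "\<xi> \<in> characters M" and \<eta>: "\<eta> \<in> characters M"
    and le: "orbit_dist \<rho> (dual_action M) (thicken (half_space v) 1) \<xi> \<eta> \<le> d / 2" for \<xi> \<eta>
  proof -
    let ?N = "{n. lattice_point n \<in> thicken (half_space v) 1}"
    have sub: "half_lattice v \<subseteq> ?N"
      using half_space_subset_thicken[of 1 v] by (auto simp: half_lattice_def half_space_def)
    have "0 \<in> half_lattice v" by (simp add: half_lattice_def lattice_point_zero)
    then have ne: "?N \<noteq> {}" using sub by blast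
    define \<zeta> where "\<zeta> = (\<lambda>m\<in>carrier M. \<xi> m / \<eta> m)"
    have nz: "\<eta> m \<noteq> 0" if "m \<in> carrier M" for m using characters_norm[OF \<eta> that] by auto
    have "\<zeta> \<in> characters M"
      unfolding characters_def \<zeta>_def
      using characters_norm[OF \<xi>] characters_norm[OF \<eta>] characters_add[OF \<xi>] characters_add[OF \<eta>]
      by (auto simp: norm_divide)
    moreover have "cmod (\<zeta> (laurent_monom n \<odot> m) - 1) \<le> \<delta>" if n: "n \<in> half_lattice v" and m: "m \<in> S" for n m
    proof -
      have mc: "m \<in> carrier M" using m S by auto
      have "\<rho> (dual_action M n \<xi>) (dual_action M n \<eta>) \<le> (SUP n\<in>?N. \<rho> (dual_action M n \<xi>) (dual_action M n \<eta>))"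
        using n sub by (intro cSUP_upper bdd_aboveI2[where M = B] B dual_action_character \<xi> \<eta>) auto
      also have "\<dots> \<le> d / 2" using le unfolding orbit_dist_def if_not_P[OF ne] .
      finally have "\<rho> (dual_action M n \<xi>) (dual_action M n \<eta>) < d" using d by simp
      then have "dist (dual_action M n \<xi> m) (dual_action M n \<eta> m) < \<delta>"
        using uni dual_action_character[OF \<xi>] dual_action_character[OF \<eta>] m by blast
      then have *: "cmod (\<xi> (laurent_monom n \<odot> m) - \<eta> (laurent_monom n \<odot> m)) < \<delta>"
        using mc by (simp add: dual_action_apply dist_norm)
      let ?m = "laurent_monom n \<odot> m"
      have "\<zeta> ?m - 1 = (\<xi> ?m - \<eta> ?m) / \<eta> ?m" using mc nz[of ?m] by (simp add: \<zeta>_def diff_divide_distrib)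
      then have "cmod (\<zeta> ?m - 1) = cmod (\<xi> ?m - \<eta> ?m)" using characters_norm[OF \<eta>, of ?m] mc by (simp add: norm_divide)
      then show ?thesis using * by simp
    qed
    ultimately have triv: "\<forall>m\<in>carrier M. \<zeta> m = 1" using ex by blast
    show ?thesis
    proof (rule PiE_ext)
      show "\<xi> \<in> carrier M \<rightarrow>\<^sub>E sphere 0 1" "\<eta> \<in> carrier M \<rightarrow>\<^sub>E sphere 0 1"
        using \<xi> \<eta> by (simp_all add: characters_def)
      show "\<xi> m = \<eta> m" if "m \<in> carrier M" for m
        using triv that nz[OF that] by (simp add: \<zeta>_def)
    qed
  qed
  then have "metric_expansive_along (topspace (dual_space M)) \<rho> (dual_action M) (half_space v)"
    unfolding metric_expansive_along_def topspace_dual_space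
    by (intro exI[of _ "d / 2"] exI[of _ 1] conjI ballI impI half_gt_zero d zero_less_one)
  then show ?thesis using \<rho> unfolding expansive_along_def by blast
qed

end

section \<open>Half-spaces\<close>

lemma half_lattice_zero: "0 \<in> half_lattice v"
  by (simp add: half_lattice_def lattice_point_zero)

definition strict_half_lattice :: "real ^ 'd::finite \<Rightarrow> (int ^ 'd) set" where
  "strict_half_lattice v = {n. lattice_point n \<bullet> v < 0}"

abbreviation (input) strict_laurents where
  "strict_laurents v \<equiv> laurents_in (strict_half_lattice v)"

lemma strict_add: "\<lbrakk>n \<in> strict_half_lattice v; k \<in> half_lattice v\<rbrakk> \<Longrightarrow> n + k \<in> strict_half_lattice v"
  by (simp add: strict_half_lattice_def half_lattice_def lattice_point_add inner_add_left)

lemma strict_laurents_mult: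
  assumes "f \<in> strict_laurents v" "g \<in> strict_laurents v"
  shows "f * g \<in> strict_laurents v"
  by (rule laurents_in_mult[OF assms]) (simp add: strict_half_lattice_def lattice_point_add inner_add_left)

definition half_units :: "real ^ 'd::finite \<Rightarrow> 'd laurent set" where
  "half_units v = {1 - g |g. g \<in> strict_laurents v}"

lemma half_units_one:
  fixes v :: "real ^ 'd::finite"
  shows "1 \<in> half_units v"
proof -
  have "(1 :: 'd laurent) = 1 - 0" by simp
  then show ?thesis unfolding half_units_def using laurents_in_zero by blast
qed

lemma half_units_mult:
  assumes "s \<in> half_units v" "t \<in> half_units v"
  shows "s * t \<in> half_units v"
proof -
  obtain a b where ab: "a \<in> strict_laurents v" "s = 1 - a"
    "b \<in> strict_laurents v" "t = 1 - b" using assms unfolding half_units_def by blast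
  have "s * t = 1 - (a + (b - a * b))" by (simp add: ab algebra_simps)
  moreover have "a + (b - a * b) \<in> strict_laurents v"
    using ab strict_laurents_mult by (intro laurents_in_add laurents_in_diff)
  ultimately show ?thesis unfolding half_units_def by blast
qed

text \<open>
  The finitely many exponents of \<open>g\<close> stay away from the boundary, so those of its powers
  move arbitrarily far into the half-space.
\<close>

lemma deep_power:
  assumes "g \<in> strict_laurents v"
  shows "\<exists>j. g ^ j \<in> laurents_in {n. lattice_point n \<bullet> v \<le> - K}"
proof -
  have "\<exists>c>0. \<forall>n\<in>supp g. lattice_point n \<bullet> v \<le> - c"
  proof (cases "supp g = {}")
    case True
    then show ?thesis by (intro exI[of _ 1]) simp
  next
    case False
    let ?V = "(\<lambda>n. lattice_point n \<bullet> v) ` supp g"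
    have fin: "finite ?V" "?V \<noteq> {}" using False by simp_all
    define c where "c = Max ?V"
    have "c \<in> ?V" unfolding c_def by (rule Max_in[OF fin])
    then have "c < 0" using assms by (auto simp: laurents_in_def strict_half_lattice_def)
    moreover have "\<forall>n\<in>supp g. lattice_point n \<bullet> v \<le> c"
      unfolding c_def using fin by (intro ballI Max_ge) simp_all
    ultimately show ?thesis by (intro exI[of _ "- c"]) simp
  qed
  then obtain c where c: "c > 0" "\<forall>n\<in>supp g. lattice_point n \<bullet> v \<le> - c" by (elim exE conjE)
  have pow: "g ^ j \<in> laurents_in {n. lattice_point n \<bullet> v \<le> - (real j * c)}" for j
  proof (induction j)
    case 0
    then show ?case by (simp add: laurents_in_def lattice_point_zero)
  next
    case (Suc j)
    have g: "g \<in> laurents_in {n. lattice_point n \<bullet> v \<le> - c}" using c(2) by (auto simp: laurents_in_def)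
    show ?case unfolding power_Suc
      by (rule laurents_in_mult[OF g Suc]) (simp add: lattice_point_add inner_add_left algebra_simps)
  qed
  obtain j where "K / c \<le> real j" using real_arch_simple by blast
  then have sub: "{n. lattice_point n \<bullet> v \<le> - (real j * c)} \<subseteq> {n. lattice_point n \<bullet> v \<le> - K}"
    using c(1) by (auto simp: field_simps)
  have "g ^ j \<in> laurents_in {n. lattice_point n \<bullet> v \<le> - K}"
    by (rule subsetD[OF laurents_in_mono[OF sub] pow])
  then show ?thesis by (rule exI)
qed

lemma deep_unit:
  assumes "g \<in> strict_laurents v" "1 - g \<in> I" "\<And>f h. f \<in> I \<Longrightarrow> f * h \<in> I"
  shows "\<exists>g'. g' \<in> laurents_in {n. lattice_point n \<bullet> v \<le> - K} \<and> 1 - g' \<in> I"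
proof -
  obtain j where "g ^ j \<in> laurents_in {n. lattice_point n \<bullet> v \<le> - K}" using deep_power[OF assms(1)] by (rule exE)
  moreover have "1 - g ^ j \<in> I" unfolding one_diff_power_eq by (rule assms(3)[OF assms(2)])
  ultimately show ?thesis by blast
qed

text \<open>
  If \<open>1 - g\<close> lies in \<open>I\<close>, the class of \<open>f\<close> does not change when \<open>f\<close> is multiplied by a high power
  of \<open>g\<close>, which shifts its support into the half-space.
\<close>

lemma half_representative:
  assumes g: "g \<in> strict_laurents v" "1 - g \<in> I"
    and I: "\<And>f h. f \<in> I \<Longrightarrow> f * h \<in> I"
  shows "\<exists>h\<in>laurents_in (half_lattice v). f - h \<in> I"
proof -
  let ?K = "\<Sum>n\<in>supp f. \<bar>lattice_point n \<bullet> v\<bar>"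
  have "\<exists>u. u \<in> laurents_in {n. lattice_point n \<bullet> v \<le> - ?K} \<and> 1 - u \<in> I"
    by (rule deep_unit[OF g]) (rule I)
  then obtain u where u: "u \<in> laurents_in {n. lattice_point n \<bullet> v \<le> - ?K}" "1 - u \<in> I" by (elim exE conjE)
  have "lattice_point n \<bullet> v \<le> ?K" if "n \<in> supp f" for n
    using member_le_sum[OF that, of "\<lambda>n. \<bar>lattice_point n \<bullet> v\<bar>"] by simp
  then have f: "f \<in> laurents_in {n. lattice_point n \<bullet> v \<le> ?K}" by (auto simp: laurents_in_def)
  have "f * u \<in> laurents_in (half_lattice v)"
    by (rule laurents_in_mult[OF f u(1)]) (simp add: half_lattice_def lattice_point_add inner_add_left)
  moreover have "f - f * u \<in> I" using I[OF u(2), of f] by (simp add: algebra_simps)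
  ultimately show ?thesis by blast
qed

text \<open>
  A linear functional that is nonpositive on the lattice points of a half-space is so on the
  interior, since rounding down \<open>k x\<close> approximates the direction of \<open>x\<close> for large \<open>k\<close>; hence it is a
  nonnegative multiple of the normal, also when the normal is irrational.
\<close>

lemma lattice_functional_nonpos:
  fixes v w :: "real ^ 'd::finite"
  assumes v: "norm v = 1" and w: "\<And>n. n \<in> half_lattice v \<Longrightarrow> lattice_point n \<bullet> w \<le> 0"
  shows "\<exists>t\<ge>0. w = t *\<^sub>R v"
proof -
  have vv: "v \<bullet> v = 1" using v by (simp add: dot_square_norm)
  have neg: "x \<bullet> w \<le> 0" if x: "x \<bullet> v < 0" for x
  proof (rule ccontr)
    assume "\<not> x \<bullet> w \<le> 0"
    then have xw: "x \<bullet> w > 0" by simp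
    define C where "C y = (\<Sum>i\<in>UNIV. \<bar>y $ i\<bar>)" for y :: "real ^ 'd"
    obtain k :: nat where k: "max (C v / (- (x \<bullet> v))) (C w / (x \<bullet> w)) < real k" using reals_Archimedean2 by blast
    have k1: "C v < real k * (- (x \<bullet> v))" "C w < real k * (x \<bullet> w)"
    proof -
      have "C v / (- (x \<bullet> v)) < real k" "C w / (x \<bullet> w) < real k" using k by simp_all
      moreover have "- (x \<bullet> v) > 0" using x by simp
      ultimately show "C v < real k * (- (x \<bullet> v))" "C w < real k * (x \<bullet> w)"
        using xw by (simp_all only: pos_divide_less_eq)
    qed
    define n where "n = (\<chi> i. \<lfloor>real k * x $ i\<rfloor>)"
    have err: "\<bar>lattice_point n \<bullet> y - real k * (x \<bullet> y)\<bar> \<le> C y" for y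
    proof -
      have "lattice_point n \<bullet> y - real k * (x \<bullet> y) = (\<Sum>i\<in>UNIV. (of_int \<lfloor>real k * x $ i\<rfloor> - real k * x $ i) * y $ i)"
        by (simp add: inner_vec_def lattice_point_def n_def sum_distrib_left sum_subtractf algebra_simps)
      also have "\<bar>\<dots>\<bar> \<le> (\<Sum>i\<in>UNIV. \<bar>(of_int \<lfloor>real k * x $ i\<rfloor> - real k * x $ i) * y $ i\<bar>)" by (rule sum_abs)
      also have "\<dots> \<le> C y" unfolding C_def
      proof (rule sum_mono)
        fix i
        have "\<bar>of_int \<lfloor>real k * x $ i\<rfloor> - real k * x $ i\<bar> \<le> 1" by linarith
        then show "\<bar>(of_int \<lfloor>real k * x $ i\<rfloor> - real k * x $ i) * y $ i\<bar> \<le> \<bar>y $ i\<bar>"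
          unfolding abs_mult by (rule mult_left_le_one_le[rotated 2]) simp_all
      qed
      finally show ?thesis .
    qed
    have "lattice_point n \<bullet> v \<le> 0" using err[of v] k1(1) by (simp add: abs_le_iff)
    then have "lattice_point n \<bullet> w \<le> 0" by (intro w) (simp add: half_lattice_def)
    then show False using err[of w] k1(2) by (simp add: abs_le_iff)
  qed
  define x where "x = w - (w \<bullet> v) *\<^sub>R v"
  have xv: "x \<bullet> v = 0" by (simp add: x_def inner_diff_left vv)
  then have xw: "x \<bullet> w = x \<bullet> x" by (simp add: x_def inner_diff_right inner_diff_left inner_commute)
  have "x \<bullet> x \<le> 0 + e" if "e > 0" for e
  proof -
    define \<eta> where "\<eta> = e / (\<bar>v \<bullet> w\<bar> + 1)"
    have \<eta>: "\<eta> > 0" using that by (simp add: \<eta>_def)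
    have "(x - \<eta> *\<^sub>R v) \<bullet> w \<le> 0" by (rule neg) (simp add: inner_diff_left xv vv \<eta>)
    then have "x \<bullet> x \<le> \<eta> * (v \<bullet> w)" by (simp add: inner_diff_left xw)
    also have "\<dots> \<le> \<eta> * (\<bar>v \<bullet> w\<bar> + 1)" using \<eta> by (intro mult_left_mono) auto
    also have "\<dots> = e" unfolding \<eta>_def by (simp add: add_nonneg_eq_0_iff)
    finally show ?thesis by simp
  qed
  then have "x \<bullet> x \<le> 0" by (rule field_le_epsilon)
  then have "x = 0" using inner_ge_zero[of x] inner_eq_zero_iff[of x] by linarith
  then have "w = (w \<bullet> v) *\<^sub>R v" by (simp add: x_def)
  moreover have "(- v) \<bullet> w \<le> 0" by (rule neg) (simp add: vv)
  then have "w \<bullet> v \<ge> 0" by (simp add: inner_commute)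
  ultimately show ?thesis by blast
qed

lemma ln_monom_val:
  assumes z: "\<And>i. z $ i \<noteq> 0"
  shows "ln (cmod (monom_val z n)) = lattice_point n \<bullet> log_abs z"
proof -
  have "cmod (monom_val z n) = (\<Prod>i\<in>UNIV. cmod (z $ i) powi (n $ i))"
    by (simp add: monom_val_def prod_norm[symmetric] norm_power_int)
  also have "\<dots> = (\<Prod>i\<in>UNIV. cmod (z $ i) powr of_int (n $ i))"
    using z by (intro prod.cong refl powr_real_of_int'[symmetric]) simp_all
  also have "ln \<dots> = (\<Sum>i\<in>UNIV. of_int (n $ i) * ln (cmod (z $ i)))"
    using z by (subst ln_prod) simp_all
  finally show ?thesis by (simp add: inner_vec_def lattice_point_def log_abs_def)
qed


section \<open>Bounded solutions and points of the variety\<close>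

text \<open>
  Functions on the lattice points of the half-space, extended by 0, with a recurrence for each
  member of \<open>I\<close> wherever all its terms lie in the half-space.
\<close>

definition bounded_solutions :: "real ^ 'd::finite \<Rightarrow> 'd laurent set \<Rightarrow> (int ^ 'd \<Rightarrow> complex) set" where
  "bounded_solutions v I = {y. (\<forall>n. n \<notin> half_lattice v \<longrightarrow> y n = 0) \<and> (\<exists>B. \<forall>n. cmod (y n) \<le> B) \<and>
     (\<forall>f\<in>I. \<forall>n. (\<forall>k\<in>supp f. n + k \<in> half_lattice v) \<longrightarrow> pairing (\<lambda>k. y (n + k)) f = 0)}"

text \<open>
  Fixing the points outside the half-space keeps composition with a shift inside the space of
  functions that vanish there.
\<close>

definition half_shift :: "real ^ 'd::finite \<Rightarrow> int ^ 'd \<Rightarrow> int ^ 'd \<Rightarrow> int ^ 'd" where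
  "half_shift v h n = (if n \<in> half_lattice v then n + h else n)"

lemma shift_space_bounded_solutions:
  "shift_space (bounded_solutions v I) (half_shift v ` half_lattice v) 0"
proof
  fix y y' a assume y: "y \<in> bounded_solutions v I" and y': "y' \<in> bounded_solutions v I"
  obtain B B' where B: "\<forall>n. cmod (y n) \<le> B" and B': "\<forall>n. cmod (y' n) \<le> B'"
    using y y' by (auto simp: bounded_solutions_def)
  have "cmod (a * y n + y' n) \<le> cmod a * B + B'" for n
    using norm_triangle_ineq[of "a * y n" "y' n"] B B' mult_left_mono[of "cmod (y n)" B "cmod a"]
    by (simp add: norm_mult) (smt (verit, best))
  then have "\<exists>B. \<forall>n. cmod (a * y n + y' n) \<le> B" by blast
  then show "(\<lambda>n. a * y n + y' n) \<in> bounded_solutions v I"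
    using y y' by (auto simp: bounded_solutions_def pairing_linear)
next
  fix y assume "y \<in> bounded_solutions v I"
  then show "\<exists>B. \<forall>n. cmod (y n) \<le> B" by (simp add: bounded_solutions_def)
next
  fix s B l assume s: "\<And>k::nat. s k \<in> bounded_solutions v I" and B: "\<And>k n. cmod (s k n) \<le> B"
    and l: "\<And>n. (\<lambda>k. s k n) \<longlonglongrightarrow> l n"
  have l1: "l n = 0" if "n \<notin> half_lattice v" for n
    using l[of n] s that by (simp add: bounded_solutions_def LIMSEQ_const_iff)
  have l2: "cmod (l n) \<le> B" for n
    by (rule LIMSEQ_le_const2[OF tendsto_norm[OF l]]) (use B in blast)
  have l3: "pairing (\<lambda>k. l (n + k)) f = 0"
    if "f \<in> I" "\<forall>k\<in>supp f. n + k \<in> half_lattice v" for f n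
  proof -
    have "(\<lambda>k. pairing (\<lambda>j. s k (n + j)) f) \<longlonglongrightarrow> pairing (\<lambda>j. l (n + j)) f" by (rule pairing_tendsto[OF l])
    moreover have "pairing (\<lambda>j. s k (n + j)) f = 0" for k using s that by (simp add: bounded_solutions_def)
    ultimately show ?thesis by (simp add: LIMSEQ_const_iff)
  qed
  show "l \<in> bounded_solutions v I" unfolding bounded_solutions_def
    by (intro CollectI conjI allI ballI impI exI[of _ B] l1 l2 l3) (assumption | erule (1) bspec)+
next
  fix \<gamma> y assume "\<gamma> \<in> half_shift v ` half_lattice v" and y: "y \<in> bounded_solutions v I"
  then obtain h where h: "h \<in> half_lattice v" "\<gamma> = half_shift v h" by blast
  obtain B where B: "\<forall>n. cmod (y n) \<le> B" using y by (auto simp: bounded_solutions_def)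
  have l1: "(y \<circ> \<gamma>) n = 0" if "n \<notin> half_lattice v" for n
    using y that by (simp add: h half_shift_def bounded_solutions_def)
  have l3: "pairing (\<lambda>k. (y \<circ> \<gamma>) (n + k)) f = 0"
    if f: "f \<in> I" and n: "\<forall>k\<in>supp f. n + k \<in> half_lattice v" for f n
  proof -
    have eq: "n + h + k = n + k + h" for k by (simp add: add.assoc add.commute)
    have "n + h + k \<in> half_lattice v" if "k \<in> supp f" for k
      unfolding eq by (rule half_lattice_add[OF bspec[OF n that] h(1)])
    then have "pairing (\<lambda>k. y (n + h + k)) f = 0" using y f unfolding bounded_solutions_def by blast
    moreover have "pairing (\<lambda>k. (y \<circ> \<gamma>) (n + k)) f = pairing (\<lambda>k. y (n + h + k)) f"
      unfolding eq by (rule pairing_cong) (use n in \<open>simp add: h half_shift_def\<close>)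
    ultimately show ?thesis by simp
  qed
  have l2: "cmod ((y \<circ> \<gamma>) n) \<le> B" for n using B by simp
  show "y \<circ> \<gamma> \<in> bounded_solutions v I" unfolding bounded_solutions_def
    by (intro CollectI conjI allI ballI impI exI[of _ B] l1 l2 l3) (assumption | erule (1) bspec)+
next
  fix \<gamma> \<gamma>' assume "\<gamma> \<in> half_shift v ` half_lattice v" "\<gamma>' \<in> half_shift v ` half_lattice v"
  then show "\<gamma> \<circ> \<gamma>' = \<gamma>' \<circ> \<gamma>"
    by (auto simp: half_shift_def fun_eq_iff half_lattice_add add_ac)
next
  fix y i assume "y \<in> bounded_solutions v I" "y i \<noteq> 0"
  then have "i \<in> half_lattice v" by (auto simp: bounded_solutions_def)
  then show "\<exists>\<gamma>\<in>half_shift v ` half_lattice v. \<gamma> 0 = i"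
    by (intro bexI[of _ "half_shift v i"]) (simp_all add: half_shift_def half_lattice_zero)
qed


text \<open>
  A joint eigenfunction \<open>y\<close> for a basis of the lattice consisting of points of the half-space has
  nonzero eigenvalues, because the recurrence \<open>1 - h\<close> expresses \<open>y 0\<close> by values at points that are
  deep enough to be translates by a basis vector. So the eigenvalues are monomials in the
  coordinates of a point \<open>z\<close> of the torus.
\<close>

lemma variety_point_of_bounded_solution:
  fixes v :: "real ^ 'd::finite"
  assumes v: "norm v = 1" and I: "\<And>f h. f \<in> I \<Longrightarrow> f * h \<in> I"
    and g: "g \<in> strict_laurents v" "1 - g \<in> I"
    and y0: "y0 \<in> bounded_solutions v I" "y0 j0 \<noteq> 0"
  shows "\<exists>z\<in>laurent_variety I. \<exists>t\<ge>0. log_abs z = t *\<^sub>R v"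
proof -
  interpret shift_space "bounded_solutions v I" "half_shift v ` half_lattice v" 0
    by (rule shift_space_bounded_solutions)
  \<comment> \<open>A basis of the lattice that consists of points of the half-space.\<close>
  define s :: "'d \<Rightarrow> int" where "s i = (if v $ i \<le> 0 then 1 else - 1)" for i
  define e :: "'d \<Rightarrow> int ^ 'd" where "e i = axis i (s i)" for i
  have ss: "s i * s i = 1" for i by (simp add: s_def)
  have eP: "e i \<in> half_lattice v" for i
    by (simp add: half_lattice_def e_def s_def lattice_point_axis inner_axis')
  have "\<exists>y\<in>bounded_solutions v I. y 0 \<noteq> 0 \<and>
      (\<forall>\<sigma>\<in>(\<lambda>i. half_shift v (e i)) ` UNIV. \<exists>\<kappa>. \<forall>n. y (\<sigma> n) = \<kappa> * y n)"
    by (rule joint_eigenfunction[OF _ _ y0]) (use eP in auto)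
  then obtain y where y: "y \<in> bounded_solutions v I" and y00: "y 0 \<noteq> 0"
    and ev: "\<forall>\<sigma>\<in>(\<lambda>i. half_shift v (e i)) ` UNIV. \<exists>\<kappa>. \<forall>n. y (\<sigma> n) = \<kappa> * y n"
    by (elim bexE conjE)
  have "\<exists>\<kappa>. \<forall>n. y (half_shift v (e i) n) = \<kappa> * y n" for i
    by (rule bspec[OF ev]) blast
  then obtain \<kappa> where \<kappa>: "\<forall>i n. y (half_shift v (e i) n) = \<kappa> i * y n" by metis
  have step: "y (n + e i) = \<kappa> i * y n" if "n \<in> half_lattice v" for n i
    using \<kappa>[THEN spec, THEN spec, of i n] that by (simp add: half_shift_def)
  have rel: "pairing (\<lambda>k. y (n + k)) f = 0" if "f \<in> I" "\<And>k. k \<in> supp f \<Longrightarrow> n + k \<in> half_lattice v" for f n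
    using y that by (simp add: bounded_solutions_def)
  have \<kappa>0: "\<kappa> i \<noteq> 0" for i
  proof
    assume 0: "\<kappa> i = 0"
    have "\<exists>h. h \<in> laurents_in {n. lattice_point n \<bullet> v \<le> - (- (lattice_point (e i) \<bullet> v))} \<and> 1 - h \<in> I"
      by (rule deep_unit[OF g]) (rule I)
    then obtain h where h: "h \<in> laurents_in {n. lattice_point n \<bullet> v \<le> - (- (lattice_point (e i) \<bullet> v))}" "1 - h \<in> I"
      by (elim exE conjE)
    have hP: "k - e i \<in> half_lattice v" if "k \<in> supp h" for k
      using h(1) that by (auto simp: laurents_in_def half_lattice_def lattice_point_diff inner_diff_left)
    have "pairing y (1 - h) = 0"
    proof -
      have "k \<in> half_lattice v" if "k \<in> supp (1 - h)" for k
      proof -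
        have "k = 0 \<or> k \<in> supp h" using that keys_diff[of 1 h] by auto
        then show ?thesis using half_lattice_add[OF hP eP, of k i] half_lattice_zero by auto
      qed
      then show ?thesis using rel[OF h(2), of 0] by simp
    qed
    moreover have "pairing y h = 0"
    proof -
      have "y k = 0" if "k \<in> supp h" for k using step[OF hP[OF that], of i] 0 by simp
      then show ?thesis by (simp add: pairing_def)
    qed
    ultimately show False using y00 by (simp add: pairing_diff pairing_one)
  qed
  \<comment> \<open>The sign s i is its own inverse, so the monomial of z at e i is the eigenvalue.\<close>
  define z :: "complex ^ 'd" where "z = (\<chi> i. \<kappa> i powi s i)"
  have z: "z $ i \<noteq> 0" for i using \<kappa>0 by (simp add: z_def)
  have ze: "monom_val z (e i) = \<kappa> i" for i
  proof -
    have "monom_val z (e i) = (\<Prod>j\<in>UNIV. if j = i then z $ i powi s i else 1)"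
      unfolding monom_val_def by (rule prod.cong) (auto simp: e_def axis_def)
    also have "\<dots> = \<kappa> i powi (s i * s i)" by (simp add: z_def power_int_mult)
    finally show ?thesis by (simp add: ss)
  qed
  define G where "G = {m \<in> half_lattice v. \<forall>n\<in>half_lattice v. y (n + m) = monom_val z m * y n}"
  have GD: "y (n + m) = monom_val z m * y n" "m \<in> half_lattice v" if "m \<in> G" "n \<in> half_lattice v" for m n
    using that by (simp_all add: G_def)
  have G0: "0 \<in> G" by (simp add: G_def half_lattice_zero monom_val_zero)
  have Ge: "m + e i \<in> G" if m: "m \<in> G" for m i
    unfolding G_def
  proof (intro CollectI conjI ballI)
    show "m + e i \<in> half_lattice v" by (rule half_lattice_add[OF GD(2)[OF m half_lattice_zero] eP])
    fix n assume n: "n \<in> half_lattice v"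
    have "y (n + (m + e i)) = \<kappa> i * y (n + m)"
      using step[OF half_lattice_add[OF n GD(2)[OF m n]], of i] by (simp add: add.assoc)
    then show "y (n + (m + e i)) = monom_val z (m + e i) * y n"
      using GD(1)[OF m n] by (simp add: monom_val_add[OF z] ze)
  qed
  \<comment> \<open>Nonnegative combinations of the basis; every lattice point is a difference of two of them.\<close>
  define Q where "Q a = (\<chi> i. s i * int (a i))" for a :: "'d \<Rightarrow> nat"
  have QG: "Q a \<in> G" for a
  proof (induction "sum a UNIV" arbitrary: a)
    case 0
    then have "Q a = 0" by (simp add: Q_def vec_eq_iff)
    then show ?case using G0 by simp
  next
    case (Suc k)
    have "sum a UNIV \<noteq> 0" using Suc.hyps(2) by linarith
    then obtain i where "a i \<noteq> 0" by (rule sum.not_neutral_contains_not_neutral)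
    then have i: "a i > 0" by simp
    define b where "b = a(i := a i - 1)"
    have "sum a UNIV = a i + sum a (UNIV - {i})" "sum b UNIV = b i + sum b (UNIV - {i})" by (simp_all add: sum.remove)
    moreover have "sum b (UNIV - {i}) = sum a (UNIV - {i})" by (rule sum.cong) (auto simp: b_def)
    ultimately have "k = sum b UNIV" using Suc.hyps(2) i by (simp add: b_def)
    then have "Q b \<in> G" by (rule Suc.hyps(1))
    moreover have "Q a = Q b + e i" using i by (auto simp: Q_def e_def b_def vec_eq_iff axis_def of_nat_diff algebra_simps)
    ultimately show ?case using Ge by simp
  qed
  have mono: "y n = monom_val z n * y 0" if n: "n \<in> half_lattice v" for n
  proof -
    define a b where "a i = nat (s i * n $ i)" and "b i = nat (- (s i * n $ i))" for i
    have "n $ i + s i * int (b i) = s i * int (a i)" for i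
      by (auto simp: a_def b_def s_def)
    then have nQ: "n + Q b = 0 + Q a" by (simp add: Q_def vec_eq_iff)
    have "monom_val z (Q b) * y n = y (n + Q b)" by (rule GD(1)[OF QG n, symmetric])
    also have "\<dots> = monom_val z (Q a) * y 0" unfolding nQ by (rule GD(1)[OF QG half_lattice_zero])
    also have "Q a = n + Q b" using nQ by simp
    finally have "monom_val z (Q b) * y n = monom_val z (Q b) * (monom_val z n * y 0)"
      by (simp add: monom_val_add[OF z])
    then show ?thesis using monom_val_nonzero[OF z] by simp
  qed
  have "laurent_eval f z = 0" if f: "f \<in> I" for f
  proof -
    obtain k :: "int ^ 'd" where k: "lattice_point k \<bullet> v \<ge> (\<Sum>n\<in>supp f. \<bar>lattice_point n \<bullet> v\<bar>)"
      by (rule exists_high_lattice_point[OF v])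
    have kP: "- k + n \<in> half_lattice v" if n: "n \<in> supp f" for n
    proof -
      have "\<bar>lattice_point n \<bullet> v\<bar> \<le> (\<Sum>n\<in>supp f. \<bar>lattice_point n \<bullet> v\<bar>)"
        by (rule member_le_sum[OF n]) simp_all
      then show ?thesis using k by (simp add: half_lattice_def lattice_point_diff inner_diff_left)
    qed
    have "0 = pairing (\<lambda>n. y (- k + n)) f" using rel[OF f kP] by simp
    also have "\<dots> = pairing (\<lambda>n. (monom_val z (- k) * y 0) * monom_val z n + 0) f"
    proof (rule pairing_cong)
      fix n assume n: "n \<in> supp f"
      show "y (- k + n) = (monom_val z (- k) * y 0) * monom_val z n + 0"
        unfolding mono[OF kP[OF n]] monom_val_add[OF z] by simp
    qed
    also have "\<dots> = monom_val z (- k) * y 0 * laurent_eval f z"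
      unfolding pairing_linear laurent_eval_pairing by (simp add: pairing_def)
    finally show ?thesis using y00 monom_val_nonzero[OF z] by simp
  qed
  then have zV: "z \<in> laurent_variety I" using z by (simp add: laurent_variety_def)
  obtain B where B: "\<forall>n. cmod (y n) \<le> B" using y by (auto simp: bounded_solutions_def)
  have le1: "cmod (monom_val z n) \<le> 1" if n: "n \<in> half_lattice v" for n
  proof (rule ccontr)
    assume "\<not> cmod (monom_val z n) \<le> 1"
    then have "1 < cmod (monom_val z n)" by simp
    from real_arch_pow[OF this] obtain j where j: "B / cmod (y 0) < cmod (monom_val z n) ^ j" by (rule exE)
    have "\<exists>m\<in>half_lattice v. monom_val z m = monom_val z n ^ j"
    proof (induction j)
      case 0
      then show ?case using half_lattice_zero[of v] by (auto intro!: bexI[of _ 0] simp: monom_val_zero)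
    next
      case (Suc j)
      then obtain m where "m \<in> half_lattice v" "monom_val z m = monom_val z n ^ j" by (rule bexE)
      then show ?case using half_lattice_add[OF n, of m] by (intro bexI[of _ "n + m"]) (simp_all add: monom_val_add[OF z])
    qed
    then obtain m where m: "m \<in> half_lattice v" "monom_val z m = monom_val z n ^ j" by (rule bexE)
    have "cmod (monom_val z n) ^ j * cmod (y 0) \<le> B"
      using B[THEN spec, of m] mono[OF m(1)] m(2) by (simp add: norm_mult norm_power)
    then show False using j y00 by (simp add: divide_less_eq)
  qed
  have "lattice_point n \<bullet> log_abs z \<le> 0" if "n \<in> half_lattice v" for n
    unfolding ln_monom_val[OF z, symmetric] using le1[OF that] monom_val_nonzero[OF z, of n] by (simp add: ln_le_zero_iff)
  then have "\<exists>t\<ge>0. log_abs z = t *\<^sub>R v" by (rule lattice_functional_nonpos[OF v])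
  then show ?thesis using zV by blast
qed

section \<open>The criterion for a finitely generated module\<close>

text \<open>
  The first conjunct says that the quotient of the ring by an ideal \<open>I\<close> is Noetherian over the half-space ring.
\<close>

definition half_condition :: "real ^ 'd::finite \<Rightarrow> 'd laurent set \<Rightarrow> bool" where
  "half_condition v I \<longleftrightarrow> (\<exists>g\<in>strict_laurents v. 1 - g \<in> I) \<and>
     {t *\<^sub>R v |t. t \<ge> 0} \<inter> log_abs ` laurent_variety I = {}"

lemma countable_laurent: "countable (UNIV :: ('d::finite) laurent set)"
proof -
  let ?G = "\<lambda>f :: 'd laurent. (\<lambda>n. (n, Poly_Mapping.lookup f n)) ` supp f"
  have "inj ?G"
  proof (rule injI)
    fix f g :: "'d laurent" assume eq: "?G f = ?G g"
    have sub: "Poly_Mapping.lookup h n = Poly_Mapping.lookup h' n"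
      if "?G h = ?G h'" "n \<in> supp h" for h h' :: "'d laurent" and n
    proof -
      have "(n, Poly_Mapping.lookup h n) \<in> ?G h" using that(2) by (rule imageI)
      then show ?thesis unfolding that(1) by auto
    qed
    have "supp f = fst ` ?G f" by force
    also have "\<dots> = supp g" unfolding eq by force
    finally have keys: "supp f = supp g" .
    show "f = g"
    proof (rule poly_mapping_eqI)
      fix n show "Poly_Mapping.lookup f n = Poly_Mapping.lookup g n"
        using sub[OF eq, of n] keys by (cases "n \<in> supp f") (auto simp: in_keys_iff)
    qed
  qed
  moreover have "countable (range ?G)"
    by (rule countable_subset[OF _ countable_Collect_finite]) auto
  ultimately show ?thesis by (rule countable_image_inj_on[rotated])
qed

lemma disjoint_imageI: "(\<And>x. x \<in> B \<Longrightarrow> f x \<notin> A) \<Longrightarrow> A \<inter> f ` B = {}"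
  by auto

context laurent_module begin

lemma countable_span: "countable I \<Longrightarrow> countable (span I ms)"
proof (induction ms)
  case (Cons m ms)
  have "span I (m # ms) = (\<lambda>(a, y). a \<odot> m \<oplus> y) ` (I \<times> span I ms)" by auto
  then show ?case using Cons by simp
qed simp

lemma laurent_smult_eq_iff:
  assumes m: "m \<in> carrier M"
  shows "(f - g) \<odot> m = \<zero> \<longleftrightarrow> f \<odot> m = g \<odot> m"
proof
  assume 0: "(f - g) \<odot> m = \<zero>"
  have "f \<odot> m = (g + (f - g)) \<odot> m" by simp
  also have "\<dots> = g \<odot> m \<oplus> \<zero>" unfolding laurent_add_smult[OF m] 0 ..
  finally show "f \<odot> m = g \<odot> m" using m by simp
next
  assume "f \<odot> m = g \<odot> m"
  then show "(f - g) \<odot> m = \<zero>" using m by (simp add: laurent_diff_smult M.r_neg)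
qed

lemma annihilator_mult: "f \<in> annihilator \<Longrightarrow> f * h \<in> annihilator"
  by (simp add: annihilator_def laurent_mult_smult)

lemma character_zero: "\<xi> \<in> characters M \<Longrightarrow> \<xi> \<zero> = 1"
  using characters_add[of \<xi> M \<zero> \<zero>] characters_norm[of \<xi> M \<zero>] by auto

lemma character_diff:
  assumes \<xi>: "\<xi> \<in> characters M" and x: "x \<in> carrier M" and y: "y \<in> carrier M"
  shows "\<xi> (x \<oplus> \<ominus> y) = \<xi> x / \<xi> y"
proof -
  have "\<xi> (\<ominus> y) * \<xi> y = 1"
    using characters_add[OF \<xi> M.a_inv_closed[OF y] y] character_zero[OF \<xi>] y by (simp add: M.l_neg)
  moreover have "\<xi> y \<noteq> 0" using characters_norm[OF \<xi> y] by auto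
  ultimately have "\<xi> (\<ominus> y) = 1 / \<xi> y" by (simp add: field_simps)
  then show ?thesis using characters_add[OF \<xi> x M.a_inv_closed[OF y]] by simp
qed

lemma character_trivial_on_smult:
  assumes \<xi>: "\<xi> \<in> characters M" and m: "m \<in> carrier M"
    and triv: "\<And>n. n \<in> A \<Longrightarrow> \<xi> (laurent_monom n \<odot> m) = 1" and f: "f \<in> laurents_in A"
  shows "\<xi> (f \<odot> m) = 1"
  using f unfolding laurents_in_def mem_Collect_eq
proof (induction f rule: frag_induction)
  case zero
  then show ?case using m character_zero[OF \<xi>] by simp
next
  case (one n)
  then show ?case using triv by (simp add: laurent_monom_def)
next
  case (diff f g)
  then show ?case using m \<xi> by (simp add: laurent_diff_smult character_diff)
qed

lemma character_trivial_on_span: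
  assumes \<xi>: "\<xi> \<in> characters M" and ms: "set ms \<subseteq> carrier M"
    and triv: "\<And>f m. \<lbrakk>f \<in> I; m \<in> set ms\<rbrakk> \<Longrightarrow> \<xi> (f \<odot> m) = 1" and x: "x \<in> span I ms"
  shows "\<xi> x = 1"
proof -
  have "span I ms \<subseteq> {x \<in> carrier M. \<xi> x = 1}"
    by (rule span_subset[OF ms]) (use ms \<xi> triv in \<open>auto simp: character_zero characters_add\<close>)
  then show ?thesis using x by blast
qed

text \<open>
  The arguments of the values of a character satisfy modulo \<open>2 \<pi>\<close> the recurrences that the values
  satisfy multiplicatively; small arguments therefore satisfy them exactly.
\<close>

lemma exp_pairing_Arg:
  assumes \<xi>: "\<xi> \<in> characters M" and m: "m \<in> carrier M"
  shows "exp (\<i> * pairing (\<lambda>k. of_real (Arg (\<xi> (laurent_monom (n + k) \<odot> m)))) f) = \<xi> (laurent_monom n \<odot> (f \<odot> m))"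
proof (induction f rule: laurent_induct)
  case zero
  then show ?case using m character_zero[OF \<xi>] by (simp add: pairing_zero)
next
  case (monom k)
  have "laurent_monom (n + k) \<odot> m = laurent_monom n \<odot> (laurent_monom k \<odot> m)"
    using laurent_mult_smult[OF m, of "laurent_monom n" "laurent_monom k"] by (simp add: laurent_monom_mult)
  moreover have "exp (\<i> * of_real (Arg c)) = c" if "cmod c = 1" for c
  proof -
    have "c \<noteq> 0" using that by auto
    then show ?thesis using Arg_eq[of c] that by simp
  qed
  ultimately show ?case using characters_norm[OF \<xi>] m by (simp add: pairing_monom)
next
  case (diff f g)
  have "laurent_monom n \<odot> ((f - g) \<odot> m) = laurent_monom n \<odot> (f \<odot> m) \<oplus> \<ominus> (laurent_monom n \<odot> (g \<odot> m))"
    using m by (simp add: laurent_diff_smult laurent_smult_add laurent_uminus_eq laurent_smult_commute[of _ _ "- 1"])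
  then show ?case using diff m by (simp add: pairing_diff right_diff_distrib exp_diff character_diff[OF \<xi>])
qed

lemma bounded_pairing_zero:
  assumes \<xi>: "\<xi> \<in> characters M" and m: "m \<in> carrier M" and f: "f \<in> annihilator"
    and small: "\<And>k. k \<in> supp f \<Longrightarrow> \<bar>Arg (\<xi> (laurent_monom (n + k) \<odot> m))\<bar> \<le> e"
    and e: "(\<Sum>k\<in>supp f. \<bar>of_int (Poly_Mapping.lookup f k)\<bar>) * e < 2 * pi"
  shows "pairing (\<lambda>k. of_real (Arg (\<xi> (laurent_monom (n + k) \<odot> m)))) f = 0"
proof -
  define s where "s = (\<Sum>k\<in>supp f. of_int (Poly_Mapping.lookup f k) * Arg (\<xi> (laurent_monom (n + k) \<odot> m)))"
  have s: "pairing (\<lambda>k. of_real (Arg (\<xi> (laurent_monom (n + k) \<odot> m)))) f = of_real s"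
    by (simp add: pairing_def s_def)
  have "f \<odot> m = \<zero>" using f m by (simp add: annihilator_def)
  then have "exp (\<i> * of_real s) = 1"
    using exp_pairing_Arg[OF \<xi> m, of n f] character_zero[OF \<xi>] unfolding s by simp
  then obtain k :: int where k: "s = of_int (2 * k) * pi" unfolding exp_eq_1 by auto
  have "\<bar>s\<bar> \<le> (\<Sum>k\<in>supp f. \<bar>of_int (Poly_Mapping.lookup f k) * Arg (\<xi> (laurent_monom (n + k) \<odot> m))\<bar>)"
    unfolding s_def by (rule sum_abs)
  also have "\<dots> \<le> (\<Sum>k\<in>supp f. \<bar>of_int (Poly_Mapping.lookup f k)\<bar> * e)"
    unfolding abs_mult by (intro sum_mono mult_left_mono small) auto
  also have "\<dots> < 2 * pi" using e by (simp add: sum_distrib_right)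
  finally have "\<bar>of_int (2 * k) * pi\<bar> < 2 * pi" unfolding k .
  then have "\<bar>real_of_int k\<bar> < 1" by (simp add: abs_mult)
  then have "k = 0" by linarith
  then show ?thesis using s k by simp
qed

text \<open>
  Characters that are closer and closer to 1 on the half-space are nontrivial there, as every
  element is congruent to one with coefficients in the half-space ring. Their arguments,
  divided by a nearly maximal one and translated so that it sits at 0, have a nonzero limit.
\<close>

theorem character_expansive_if_half_condition:
  assumes v: "norm v = 1" and gen: "set ms \<subseteq> carrier M" "carrier M = span UNIV ms"
    and cond: "half_condition v annihilator"
  shows "character_expansive v"
proof (rule ccontr)
  assume non: "\<not> character_expansive v"
  obtain g where g: "g \<in> strict_laurents v" "1 - g \<in> annihilator"
    using cond unfolding half_condition_def by blast
  define norm1 where "norm1 f = (\<Sum>k\<in>supp f. \<bar>real_of_int (Poly_Mapping.lookup f k)\<bar>)" for f :: "'d laurent"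
  have determined: "\<forall>x\<in>carrier M. \<xi> x = 1"
    if \<xi>: "\<xi> \<in> characters M" and triv: "\<And>n m. \<lbrakk>n \<in> half_lattice v; m \<in> set ms\<rbrakk> \<Longrightarrow> \<xi> (laurent_monom n \<odot> m) = 1" for \<xi>
  proof
    fix x assume "x \<in> carrier M"
    then have x: "x \<in> span UNIV ms" using gen(2) by simp
    show "\<xi> x = 1"
    proof (rule character_trivial_on_span[OF \<xi> gen(1) _ x])
      fix f :: "'d laurent" and m assume m: "m \<in> set ms"
      have mc: "m \<in> carrier M" using m gen(1) by blast
      have "\<exists>h\<in>laurents_in (half_lattice v). f - h \<in> annihilator"
        by (rule half_representative[OF g]) (rule annihilator_mult)
      then obtain h where h: "h \<in> laurents_in (half_lattice v)" "f - h \<in> annihilator" by (rule bexE)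
      then have "(f - h) \<odot> m = \<zero>" using mc by (simp add: annihilator_def)
      then have "f \<odot> m = h \<odot> m" using laurent_smult_eq_iff[OF mc] by simp
      then show "\<xi> (f \<odot> m) = 1"
        using character_trivial_on_smult[OF \<xi> mc triv[OF _ m] h(1)] by simp
    qed
  qed
  have ex: "\<exists>y. y 0 = 1 \<and> (\<forall>n. cmod (y n) \<le> 2) \<and> (\<forall>n. n \<notin> half_lattice v \<longrightarrow> y n = 0) \<and>
      (\<forall>f\<in>annihilator. \<forall>n. norm1 f < real (Suc j) \<longrightarrow> (\<forall>k\<in>supp f. n + k \<in> half_lattice v)
        \<longrightarrow> pairing (\<lambda>k. y (n + k)) f = 0)" for j
  proof -
    define e where "e = 1 / real (Suc j)"
    have e: "e > 0" by (simp add: e_def)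
    have "isCont Arg 1" by (rule continuous_at_Arg) (simp add: complex_nonpos_Reals_iff)
    then obtain \<delta> where \<delta>: "\<delta> > 0" "\<And>c. dist c 1 < \<delta> \<Longrightarrow> dist (Arg c) (Arg 1) < e"
      using e unfolding continuous_at_eps_delta by blast
    have "\<not> (\<forall>\<xi>\<in>characters M. (\<forall>n\<in>half_lattice v. \<forall>m\<in>set ms. cmod (\<xi> (laurent_monom n \<odot> m) - 1) \<le> \<delta> / 2)
        \<longrightarrow> (\<forall>m\<in>carrier M. \<xi> m = 1))"
    proof
      assume *: "\<forall>\<xi>\<in>characters M. (\<forall>n\<in>half_lattice v. \<forall>m\<in>set ms. cmod (\<xi> (laurent_monom n \<odot> m) - 1) \<le> \<delta> / 2)
        \<longrightarrow> (\<forall>m\<in>carrier M. \<xi> m = 1)"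
      have "character_expansive v" unfolding character_expansive_def
        by (intro exI[of _ "set ms"] exI[of _ "\<delta> / 2"] conjI finite_set gen(1) half_gt_zero \<delta>(1) *)
      then show False using non by simp
    qed
    then obtain \<xi> where \<xi>: "\<xi> \<in> characters M"
      and small: "\<forall>n\<in>half_lattice v. \<forall>m\<in>set ms. cmod (\<xi> (laurent_monom n \<odot> m) - 1) \<le> \<delta> / 2"
      and nontriv: "\<not> (\<forall>m\<in>carrier M. \<xi> m = 1)" by blast
    have "\<not> (\<forall>n\<in>half_lattice v. \<forall>m\<in>set ms. \<xi> (laurent_monom n \<odot> m) = 1)"
      using determined[OF \<xi>] nontriv by blast
    then obtain n0 m where n0: "n0 \<in> half_lattice v" and m: "m \<in> set ms" and ne: "\<xi> (laurent_monom n0 \<odot> m) \<noteq> 1" by blast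
    have mc: "m \<in> carrier M" using m gen(1) by blast
    define \<theta> where "\<theta> n = Arg (\<xi> (laurent_monom n \<odot> m))" for n
    have \<theta>: "\<bar>\<theta> n\<bar> \<le> e" if n: "n \<in> half_lattice v" for n
    proof -
      have "cmod (\<xi> (laurent_monom n \<odot> m) - 1) \<le> \<delta> / 2" using small n m by blast
      then have "dist (\<xi> (laurent_monom n \<odot> m)) 1 < \<delta>" using \<delta>(1) by (simp add: dist_norm)
      from \<delta>(2)[OF this] show ?thesis by (simp add: \<theta>_def dist_real_def)
    qed
    define x where "x n = (if n \<in> half_lattice v then complex_of_real (\<theta> n) else 0)" for n
    have xb: "cmod (x n) \<le> e" for n using \<theta>[of n] e by (simp add: x_def)
    have "\<theta> n0 \<noteq> 0"
    proof
      assume "\<theta> n0 = 0"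
      moreover have "\<xi> (laurent_monom n0 \<odot> m) \<noteq> 0" using characters_norm[OF \<xi>, of "laurent_monom n0 \<odot> m"] mc by auto
      ultimately show False
        using Arg_eq[of "\<xi> (laurent_monom n0 \<odot> m)"] characters_norm[OF \<xi>, of "laurent_monom n0 \<odot> m"] mc ne
        by (simp add: \<theta>_def)
    qed
    then have "x n0 \<noteq> 0" using n0 by (simp add: x_def)
    obtain i where i: "x i \<noteq> 0" "\<forall>k. cmod (x k) \<le> 2 * cmod (x i)"
      using near_maximum[of x e n0, OF xb \<open>x n0 \<noteq> 0\<close>] by (elim exE conjE)
    have iP: "i \<in> half_lattice v" using i(1) by (simp add: x_def split: if_splits)
    define y where "y n = (if n \<in> half_lattice v then x (n + i) / x i else 0)" for n
    have "pairing (\<lambda>k. y (n + k)) f = 0"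
      if f: "f \<in> annihilator" and f1: "norm1 f < real (Suc j)" and nk: "\<forall>k\<in>supp f. n + k \<in> half_lattice v" for f n
    proof -
      have nki: "n + i + k \<in> half_lattice v" if "k \<in> supp f" for k
      proof -
        have "(n + k) + i \<in> half_lattice v" by (rule half_lattice_add[OF bspec[OF nk that] iP])
        then show ?thesis by (simp add: ac_simps)
      qed
      have "norm1 f * e < 1" using f1 by (simp add: e_def divide_less_eq)
      also have "1 < 2 * pi" using pi_gt3 by simp
      finally have "norm1 f * e < 2 * pi" .
      then have zero: "pairing (\<lambda>k. of_real (\<theta> (n + i + k))) f = 0"
        unfolding \<theta>_def norm1_def
        by (intro bounded_pairing_zero[OF \<xi> mc f, where e = e]) (use \<theta> nki in \<open>simp_all add: \<theta>_def\<close>)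
      have "pairing (\<lambda>k. y (n + k)) f = pairing (\<lambda>k. (1 / x i) * of_real (\<theta> (n + i + k)) + 0) f"
      proof (rule pairing_cong)
        fix k assume k: "k \<in> supp f"
        have eq: "n + k + i = n + i + k" by (simp add: ac_simps)
        have "x (n + i + k) = of_real (\<theta> (n + i + k))" using nki[OF k] by (simp add: x_def)
        moreover have "y (n + k) = x (n + i + k) / x i" using bspec[OF nk k] unfolding y_def eq by simp
        ultimately show "y (n + k) = (1 / x i) * of_real (\<theta> (n + i + k)) + 0" by simp
      qed
      also have "\<dots> = 0" unfolding pairing_linear zero by (simp add: pairing_def)
      finally show ?thesis .
    qed
    moreover have "cmod (y n) \<le> 2" for n
      using i(2)[THEN spec, of "n + i"] i(1) by (simp add: y_def norm_divide divide_le_eq)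
    moreover have "y 0 = 1" using i(1) by (simp add: y_def half_lattice_zero)
    moreover have "\<forall>n. n \<notin> half_lattice v \<longrightarrow> y n = 0" by (simp add: y_def)
    ultimately show ?thesis by (intro exI[of _ y] conjI allI ballI impI) simp_all
  qed
  obtain Y where Y: "\<forall>j. Y j 0 = 1 \<and> (\<forall>n. cmod (Y j n) \<le> 2) \<and> (\<forall>n. n \<notin> half_lattice v \<longrightarrow> Y j n = 0) \<and>
      (\<forall>f\<in>annihilator. \<forall>n. norm1 f < real (Suc j) \<longrightarrow> (\<forall>k\<in>supp f. n + k \<in> half_lattice v)
        \<longrightarrow> pairing (\<lambda>k. Y j (n + k)) f = 0)" by (rule exE[OF choice[OF allI[OF ex]]])
  note Yj = spec[OF Y]
  have Y0: "Y j 0 = 1" for j by (rule Yj[THEN conjunct1])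
  have Yb: "cmod (Y j n) \<le> 2" for j n by (rule Yj[THEN conjunct2, THEN conjunct1, THEN spec])
  have Yout: "Y j n = 0" if "n \<notin> half_lattice v" for j n
    by (rule Yj[THEN conjunct2, THEN conjunct2, THEN conjunct1, THEN spec, THEN mp, OF that])
  note Yrel = Yj[THEN conjunct2, THEN conjunct2, THEN conjunct2]
  have "\<exists>r. strict_mono (r :: nat \<Rightarrow> nat) \<and> (\<forall>n. \<exists>l. (\<lambda>j. Y (r j) n) \<longlonglongrightarrow> l)"
  proof (rule function_convergent_subsequence[of "UNIV :: (int ^ 'd) set" Y 2, OF countableI_type Yb])
    fix r :: "nat \<Rightarrow> nat"
    assume "strict_mono r" and r: "\<And>n. n \<in> UNIV \<Longrightarrow> \<exists>l. (\<lambda>j. Y (r j) n) \<longlonglongrightarrow> l"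
    then show ?thesis by (intro exI[of _ r] conjI allI r UNIV_I)
  qed
  then obtain r where r: "strict_mono (r :: nat \<Rightarrow> nat)" and conv: "\<forall>n. \<exists>l. (\<lambda>j. Y (r j) n) \<longlonglongrightarrow> l"
    by (elim exE conjE)
  from choice[OF conv] obtain y where y: "\<forall>n. (\<lambda>j. Y (r j) n) \<longlonglongrightarrow> y n" by (rule exE)
  have "pairing (\<lambda>k. y (n + k)) f = 0"
    if f: "f \<in> annihilator" and nk: "\<forall>k\<in>supp f. n + k \<in> half_lattice v" for f n
  proof (rule LIMSEQ_unique)
    show "(\<lambda>j. pairing (\<lambda>k. Y (r j) (n + k)) f) \<longlonglongrightarrow> pairing (\<lambda>k. y (n + k)) f"
      by (rule pairing_tendsto) (use y in simp)
    obtain j0 :: nat where j0: "norm1 f < real j0" using reals_Archimedean2 by blast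
    have "pairing (\<lambda>k. Y (r j) (n + k)) f = 0" if "j \<ge> j0" for j
    proof -
      have "j \<le> r j" by (rule seq_suble[OF r])
      then have "norm1 f < real (Suc (r j))" using j0 that by linarith
      then show ?thesis using Yrel[THEN bspec, OF f, THEN spec, THEN mp, THEN mp, OF _ nk] by simp
    qed
    then show "(\<lambda>j. pairing (\<lambda>k. Y (r j) (n + k)) f) \<longlonglongrightarrow> 0"
      by (intro tendsto_eventually eventually_sequentiallyI[of j0])
  qed
  moreover have "cmod (y n) \<le> 2" for n
    by (rule LIMSEQ_le_const2[OF tendsto_norm[OF y[THEN spec]]]) (simp add: Yb)
  moreover have "y n = 0" if "n \<notin> half_lattice v" for n
    using y[THEN spec, of n] by (simp add: Yout[OF that] LIMSEQ_const_iff)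
  ultimately have y_sol: "y \<in> bounded_solutions v annihilator"
    unfolding bounded_solutions_def by (intro CollectI conjI allI ballI impI exI[of _ 2])
  have y_ne: "y 0 \<noteq> 0" using y[THEN spec, of 0] by (simp add: Y0 LIMSEQ_const_iff)
  have "\<exists>z\<in>laurent_variety annihilator. \<exists>t\<ge>0. log_abs z = t *\<^sub>R v"
    by (rule variety_point_of_bounded_solution[OF v _ g y_sol y_ne]) (rule annihilator_mult)
  then obtain z t where zt: "z \<in> laurent_variety annihilator" "t \<ge> 0" "log_abs z = t *\<^sub>R v"
    by (elim bexE exE conjE)
  have "log_abs z \<in> log_abs ` laurent_variety annihilator" by (rule imageI[OF zt(1)])
  moreover have "log_abs z \<in> {t *\<^sub>R v |t. t \<ge> 0}" unfolding zt(3) using zt(2) by blast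
  ultimately show False using cond unfolding half_condition_def by (simp only: disjoint_iff)
qed

text \<open>
  The monomial at a lattice point \<open>k\<close> outside the half-space acts invertibly, so the generators can be
  expressed with coefficients in the open half-space.
\<close>

lemma laurent_span_half:
  assumes sl: "set sl \<subseteq> carrier M" and gen: "carrier M = span (laurents_in (half_lattice v)) sl" and v: "norm v = 1"
  shows "\<exists>g\<in>strict_laurents v. 1 - g \<in> annihilator"
proof -
  let ?I = "strict_laurents v"
  obtain k :: "int ^ 'd" where k: "lattice_point k \<bullet> v \<ge> 1" by (rule exists_high_lattice_point[OF v])
  have neg: "- k \<in> strict_half_lattice v" using k by (simp add: strict_half_lattice_def lattice_point_uminus)
  have in_span: "1 \<odot> m \<in> span ?I sl" if m: "m \<in> set sl" for m
  proof -
    have mc: "m \<in> carrier M" using m sl by blast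
    have "laurent_monom (- k) \<odot> (laurent_monom k \<odot> m) \<in> span ?I sl"
    proof (rule span_smult[OF _ sl])
      show "laurent_monom k \<odot> m \<in> span (laurents_in (half_lattice v)) sl" using mc gen by blast
      show "laurent_monom (- k) * a \<in> ?I" if "a \<in> laurents_in (half_lattice v)" for a
        by (rule laurents_in_mult[OF laurents_in_monom[OF neg] that]) (auto intro: strict_add)
    qed
    then show ?thesis
      using laurent_mult_smult[OF mc, of "laurent_monom (- k)" "laurent_monom k"]
      by (simp add: laurent_monom_mult laurent_monom_zero)
  qed
  have "\<exists>t\<in>half_units v. \<forall>m\<in>set sl. t \<odot> m = \<zero>"
  proof (rule nakayama[of ?I "half_units v" "set sl" sl 1])
    show "0 \<in> ?I" by (rule laurents_in_zero)
    show "a + b \<in> ?I" if "a \<in> ?I" "b \<in> ?I" for a b by (rule laurents_in_add[OF that])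
    show "a * b \<in> ?I" if "a \<in> ?I" "b \<in> ?I" for a b by (rule strict_laurents_mult[OF that])
    show "s * t \<in> half_units v" if "s \<in> half_units v" "t \<in> half_units v" for s t
      by (rule half_units_mult[OF that])
    show "t * a \<in> ?I" if t: "t \<in> half_units v" and a: "a \<in> ?I" for t a
    proof -
      obtain b where b: "b \<in> ?I" "t = 1 - b" using t unfolding half_units_def by blast
      have "t * a = a - b * a" by (simp add: b algebra_simps)
      also have "\<dots> \<in> ?I" by (rule laurents_in_diff[OF a strict_laurents_mult[OF b(1) a]])
      finally show ?thesis .
    qed
    show "t - a \<in> half_units v" if t: "t \<in> half_units v" and a: "a \<in> ?I" for t a
    proof -
      obtain b where b: "b \<in> ?I" "t = 1 - b" using t unfolding half_units_def by blast
      have "t - a = 1 - (b + a)" by (simp add: b algebra_simps)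
      then show ?thesis unfolding half_units_def using laurents_in_add[OF b(1) a] by blast
    qed
    show "1 \<in> half_units v" by (rule half_units_one)
  qed (use sl in_span in simp_all)
  then obtain g where g: "g \<in> ?I" "\<And>m. m \<in> set sl \<Longrightarrow> (1 - g) \<odot> m = \<zero>"
    unfolding half_units_def by blast
  have "(1 - g) \<odot> x = \<zero>" if "x \<in> carrier M" for x
    by (rule kills_span[OF sl g(2) that[unfolded gen]])
  then have "1 - g \<in> annihilator" by (simp add: annihilator_def)
  then show ?thesis using g(1) by blast
qed

theorem half_condition_if_character_expansive:
  assumes v: "norm v = 1" and gen: "set ms \<subseteq> carrier M" "carrier M = span UNIV ms"
    and exp: "character_expansive v"
  shows "half_condition v annihilator"
proof -
  from exp obtain S \<delta> where S: "finite S" "S \<subseteq> carrier M" and \<delta>: "\<delta> > 0"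
    and ex: "\<forall>\<xi>\<in>characters M. (\<forall>n\<in>half_lattice v. \<forall>m\<in>S. cmod (\<xi> (laurent_monom n \<odot> m) - 1) \<le> \<delta>)
      \<longrightarrow> (\<forall>m\<in>carrier M. \<xi> m = 1)"
    unfolding character_expansive_def by (elim exE conjE)
  obtain sl where sl: "set sl = S" using finite_list[OF S(1)] by (rule exE)
  let ?P = "laurents_in (half_lattice v)"
  let ?N = "span ?P sl"
  have slc: "set sl \<subseteq> carrier M" using S(2) sl by simp
  have "carrier M = ?N"
  proof (rule ccontr)
    assume "carrier M \<noteq> ?N"
    then obtain x where x: "x \<in> carrier M" "x \<notin> ?N" using span_closed[OF slc, of ?P] by blast
    have "\<exists>\<xi>\<in>characters M. (\<forall>x\<in>?N. \<xi> x = 1) \<and> \<xi> x \<noteq> 1"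
    proof (rule character_separates)
      show "?N \<subseteq> carrier M" by (rule span_closed[OF slc])
      show "\<zero> \<in> ?N" by (rule span_zero[OF laurents_in_zero slc])
      show "y \<oplus> z \<in> ?N" if "y \<in> ?N" "z \<in> ?N" for y z
        by (rule span_add[OF laurents_in_add slc that])
      show "(- 1) \<odot> y \<in> ?N" if "y \<in> ?N" for y
        by (rule span_smult[OF _ slc that]) (simp add: laurents_in_uminus)
    qed (use x in simp_all)
    then obtain \<xi> where \<xi>: "\<xi> \<in> characters M" "\<forall>x\<in>?N. \<xi> x = 1" "\<xi> x \<noteq> 1" by (elim bexE conjE)
    have "cmod (\<xi> (laurent_monom n \<odot> m) - 1) \<le> \<delta>" if "n \<in> half_lattice v" "m \<in> S" for n m
    proof -
      have "laurent_monom n \<odot> m \<in> ?N"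
        using that sl by (intro span_gen[OF laurents_in_zero slc] laurents_in_monom) simp_all
      then show ?thesis using \<xi>(2) \<delta> by simp
    qed
    then have "\<forall>m\<in>carrier M. \<xi> m = 1" using ex \<xi>(1) by blast
    then show False using \<xi>(3) x(1) by blast
  qed
  then have g: "\<exists>g\<in>strict_laurents v. 1 - g \<in> annihilator"
    by (rule laurent_span_half[OF slc _ v])
  have "False" if z: "z \<in> laurent_variety annihilator" and t: "t \<ge> 0" and zt: "log_abs z = t *\<^sub>R v" for z t
  proof -
    have z0: "z $ i \<noteq> 0" for i using z by (simp add: laurent_variety_def)
    have "laurent_eval f z = 0" if "f \<in> annihilator" for f using z that by (simp add: laurent_variety_def)
    then obtain \<phi> m0 where m0: "m0 \<in> carrier M" "\<phi> m0 \<noteq> 0"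
      and add: "\<And>m m'. \<lbrakk>m \<in> carrier M; m' \<in> carrier M\<rbrakk> \<Longrightarrow> \<phi> (m \<oplus> m') = \<phi> m + (\<phi> m' :: complex)"
      and sm: "\<And>f m. m \<in> carrier M \<Longrightarrow> \<phi> (f \<odot> m) = laurent_eval f z * \<phi> m"
      using evaluation_functional[OF z0 gen] by metis
    have le1: "cmod (monom_val z n) \<le> 1" if n: "n \<in> half_lattice v" for n
    proof -
      have "ln (cmod (monom_val z n)) = t * (lattice_point n \<bullet> v)" by (simp add: ln_monom_val[OF z0] zt)
      also have "\<dots> \<le> 0" using t n by (simp add: half_lattice_def mult_nonneg_nonpos)
      finally show ?thesis using monom_val_nonzero[OF z0, of n] by (simp add: ln_le_zero_iff)
    qed
    define C where "C = (\<Sum>m\<in>S. cmod (\<phi> m)) + 1"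
    have C: "C > 0" "\<And>m. m \<in> S \<Longrightarrow> cmod (\<phi> m) \<le> C"
    proof -
      have "0 \<le> (\<Sum>m\<in>S. cmod (\<phi> m))" by (rule sum_nonneg) simp
      then show "C > 0" by (simp add: C_def)
      show "cmod (\<phi> m) \<le> C" if "m \<in> S" for m
        using member_le_sum[OF that _ S(1), of "\<lambda>m. cmod (\<phi> m)"] by (simp add: C_def)
    qed
    \<comment> \<open>Small enough for the estimate on the half-space, and for the character not to be trivial at m0.\<close>
    define r where "r = min (\<delta> / (cmod (\<phi> m0) * C)) (1 / (cmod (\<phi> m0))\<^sup>2)"
    have r: "r > 0" using \<delta> C(1) m0(2) by (simp add: r_def)
    define \<theta> where "\<theta> m = Re (of_real r * cnj (\<phi> m0) * \<phi> m)" for m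
    define \<xi> where "\<xi> = (\<lambda>m\<in>carrier M. cis (\<theta> m))"
    have \<theta>_add: "\<theta> (x \<oplus> y) = \<theta> x + \<theta> y" if "x \<in> carrier M" "y \<in> carrier M" for x y
      unfolding \<theta>_def add[OF that] by (simp only: distrib_left plus_complex.sel)
    have \<xi>: "\<xi> \<in> characters M"
      by (auto simp: characters_def \<xi>_def \<theta>_add cis_mult)
    have "cmod (\<xi> (laurent_monom n \<odot> m) - 1) \<le> \<delta>" if n: "n \<in> half_lattice v" and m: "m \<in> S" for n m
    proof -
      have mc: "m \<in> carrier M" using m S(2) by blast
      let ?x = "\<theta> (laurent_monom n \<odot> m)"
      have "\<xi> (laurent_monom n \<odot> m) = exp (\<i> * of_real ?x)" using mc by (simp add: \<xi>_def cis_conv_exp)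
      then have "cmod (\<xi> (laurent_monom n \<odot> m) - 1) = 2 * \<bar>sin (?x / 2)\<bar>" by (simp only: dist_exp_i_1)
      also have "\<dots> \<le> \<bar>?x\<bar>" using abs_sin_x_le_abs_x[of "?x / 2"] by simp
      also have "\<dots> \<le> cmod (of_real r * cnj (\<phi> m0) * \<phi> (laurent_monom n \<odot> m))"
        unfolding \<theta>_def by (rule abs_Re_le_cmod)
      also have "\<dots> = r * cmod (\<phi> m0) * (cmod (monom_val z n) * cmod (\<phi> m))"
        using r mc by (simp add: norm_mult sm laurent_eval_monom)
      also have "\<dots> \<le> r * cmod (\<phi> m0) * (1 * C)"
        using r C m le1[OF n] by (intro mult_left_mono mult_mono) simp_all
      also have "\<dots> \<le> \<delta>"
      proof -
        have "r \<le> \<delta> / (cmod (\<phi> m0) * C)" by (simp add: r_def)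
        then show ?thesis using C(1) m0(2) by (simp add: pos_le_divide_eq mult.assoc)
      qed
      finally show ?thesis .
    qed
    then have "\<forall>m\<in>carrier M. \<xi> m = 1" using ex \<xi> by blast
    then have "cis (\<theta> m0) = 1" using m0(1) by (simp add: \<xi>_def)
    then have "2 * \<bar>sin (\<theta> m0 / 2)\<bar> = 0" using dist_exp_i_1[of "\<theta> m0"] by (simp add: cis_conv_exp)
    then have "sin (\<theta> m0 / 2) = 0" by simp
    moreover have th: "\<theta> m0 = r * (cmod (\<phi> m0))\<^sup>2"
    proof -
      have "of_real r * cnj (\<phi> m0) * \<phi> m0 = of_real r * (\<phi> m0 * cnj (\<phi> m0))" by (simp only: ac_simps)
      also have "\<dots> = of_real (r * (cmod (\<phi> m0))\<^sup>2)" by (simp only: of_real_mult complex_norm_square)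
      finally have "of_real r * cnj (\<phi> m0) * \<phi> m0 = of_real (r * (cmod (\<phi> m0))\<^sup>2)" .
      then show ?thesis unfolding \<theta>_def by (simp only: Re_complex_of_real)
    qed
    have "\<theta> m0 > 0" using r m0(2) by (simp add: th)
    moreover have "\<theta> m0 \<le> 1"
    proof -
      have "r \<le> 1 / (cmod (\<phi> m0))\<^sup>2" by (simp add: r_def)
      then show ?thesis using m0(2) by (simp add: th pos_le_divide_eq)
    qed
    ultimately show False using sin_gt_zero[of "\<theta> m0 / 2"] pi_gt3 by simp
  qed
  then have "log_abs z \<notin> {t *\<^sub>R v |t. t \<ge> 0}" if "z \<in> laurent_variety annihilator" for z
    using that by (intro notI) (elim CollectE exE conjE)
  then have "{t *\<^sub>R v |t. t \<ge> 0} \<inter> log_abs ` laurent_variety annihilator = {}" by (rule disjoint_imageI)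
  then show ?thesis using g unfolding half_condition_def by (rule conjI[rotated])
qed

end

section \<open>The half-space ring and cyclic modules\<close>

lemma half_space_ring_carrier:
  fixes v :: "real ^ 'd::finite"
  shows "generate_ring laurent_ring (laurent_monom ` {n. lattice_point n \<in> half_space v}) = laurents_in (half_lattice v)"
    (is "?L = ?R")
proof
  have set_eq: "{n. lattice_point n \<in> half_space v} = half_lattice v"
    by (simp add: half_space_def half_lattice_def)
  show "?L \<subseteq> ?R"
  proof
    fix f assume "f \<in> ?L"
    then show "f \<in> ?R"
    proof (induction f rule: generate_ring.induct)
      case one
      then show ?case
        using laurents_in_monom[OF half_lattice_zero, of v] by (simp add: laurent_ring_sel laurent_monom_zero)
    next
      case (incl h)
      then show ?case unfolding set_eq by (auto intro: laurents_in_monom)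
    next
      case (a_inv h)
      then show ?case by (simp add: laurent_ring_uminus laurents_in_uminus)
    next
      case (eng_add f g)
      then show ?case by (simp add: laurent_ring_sel laurents_in_add)
    next
      case (eng_mult f g)
      then show ?case unfolding laurent_ring_sel by (intro laurents_in_mult[OF _ _ half_lattice_add])
    qed
  qed
  show "?R \<subseteq> ?L"
  proof
    fix f :: "'d laurent" assume "f \<in> ?R"
    then have "supp f \<subseteq> half_lattice v" by (simp add: laurents_in_def)
    then show "f \<in> ?L"
    proof (induction f rule: frag_induction)
      case zero
      have "\<one>\<^bsub>laurent_ring\<^esub> \<oplus>\<^bsub>laurent_ring\<^esub> (\<ominus>\<^bsub>laurent_ring\<^esub> \<one>\<^bsub>laurent_ring\<^esub>) \<in> ?L"
        by (rule generate_ring.eng_add[OF generate_ring.one generate_ring.a_inv[OF generate_ring.one]])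
      then show ?case by (simp add: laurent_ring_sel laurent_ring_uminus)
    next
      case (one n)
      then have "laurent_monom n \<in> ?L" unfolding set_eq by (intro generate_ring.incl imageI)
      then show ?case by (simp add: laurent_monom_def)
    next
      case (diff f g)
      then have "f \<oplus>\<^bsub>laurent_ring\<^esub> (\<ominus>\<^bsub>laurent_ring\<^esub> g) \<in> ?L"
        by (rule generate_ring.eng_add[OF _ generate_ring.a_inv])
      then show ?case by (simp add: laurent_ring_sel laurent_ring_uminus)
    qed
  qed
qed

lemma half_space_ring_sel:
  "carrier (half_space_ring (half_space v)) = laurents_in (half_lattice v)"
  "f \<otimes>\<^bsub>half_space_ring (half_space v)\<^esub> g = f * g" "f \<oplus>\<^bsub>half_space_ring (half_space v)\<^esub> g = f + g"
  "\<one>\<^bsub>half_space_ring (half_space v)\<^esub> = 1"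
  by (simp_all add: half_space_ring_def half_space_ring_carrier) (simp_all add: laurent_ring_def)

lemma cring_half_space_ring: "cring (half_space_ring (half_space v))"
proof -
  interpret L: cring laurent_ring by (rule cring_laurent_ring)
  have "subring (generate_ring laurent_ring (laurent_monom ` {n. lattice_point n \<in> half_space v})) laurent_ring"
    by (rule L.generate_ring_is_subring) (simp add: laurent_ring_sel)
  then have "subcring (generate_ring laurent_ring (laurent_monom ` {n. lattice_point n \<in> half_space v})) laurent_ring"
    by (rule L.subcringI')
  then show ?thesis unfolding half_space_ring_def
    by (subst (asm) L.subcring_iff) (simp_all add: laurent_ring_sel)
qed

context
  fixes p :: "('d::finite) laurent set"
  assumes p: "ideal p laurent_ring"
begin

abbreviation (input) quotient where "quotient \<equiv> quotient_module laurent_ring p"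

interpretation ideal p laurent_ring by (rule p)

definition coset :: "'d laurent \<Rightarrow> 'd laurent set" where
  "coset f = p +>\<^bsub>laurent_ring\<^esub> f"

lemma laurent_module_quotient: "laurent_module (quotient)"
  unfolding laurent_module_def by (rule quotient_module_is_module[OF cring_laurent_ring])

lemma carrier_quotient: "carrier (quotient) = range coset"
  by (auto simp: quotient_module_simps FactRing_def A_RCOSETS_def' coset_def laurent_ring_sel)

lemma coset_add: "coset f \<oplus>\<^bsub>quotient\<^esub> coset g = coset (f + g)"
  using ring_hom_add[OF rcos_ring_hom, of f g] by (simp add: quotient_module_simps coset_def laurent_ring_sel)

lemma coset_smult: "f \<odot>\<^bsub>quotient\<^esub> coset g = coset (f * g)"
  using rcoset_mult_add[of f g] by (simp add: quotient_module_simps coset_def laurent_ring_sel)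

lemma coset_zero_iff: "coset f = \<zero>\<^bsub>quotient\<^esub> \<longleftrightarrow> f \<in> p"
proof -
  have z: "\<zero>\<^bsub>quotient\<^esub> = p" by (simp add: quotient_module_simps FactRing_def)
  show ?thesis unfolding z coset_def
    using a_rcos_self[of f] a_rcos_const[of f] by (auto simp: laurent_ring_sel)
qed

lemma coset_eq_iff: "coset f = coset g \<longleftrightarrow> f - g \<in> p"
proof -
  interpret Q: laurent_module "quotient" by (rule laurent_module_quotient)
  have 1: "coset 1 \<in> carrier (quotient)" by (simp add: carrier_quotient)
  show ?thesis
    using Q.laurent_smult_eq_iff[OF 1, of f g] by (simp add: coset_smult coset_zero_iff)
qed

lemma annihilator_quotient: "laurent_module.annihilator (quotient) = p"
proof -
  interpret Q: laurent_module "quotient" by (rule laurent_module_quotient)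
  have mult: "f * g \<in> p" if "f \<in> p" for f g using I_r_closed[of f g] that by (simp add: laurent_ring_sel)
  have one: "f \<in> p" if "\<forall>g. f * g \<in> p" for f using spec[OF that, of 1] by simp
  have e1: "f \<in> Q.annihilator \<longleftrightarrow> (\<forall>g. f * g \<in> p)" for f
    unfolding Q.annihilator_def carrier_quotient by (simp add: coset_smult coset_zero_iff)
  have e2: "(\<forall>g. f * g \<in> p) \<longleftrightarrow> f \<in> p" for f 
  proof
    show "f \<in> p" if "\<forall>g. f * g \<in> p" using that by (rule one)
    show "\<forall>g. f * g \<in> p" if "f \<in> p" by (intro allI mult that)
  qed
  show ?thesis by (rule Set.set_eqI) (simp only: e1 e2)
qed

lemma quotient_generated:
  "set [coset 1] \<subseteq> carrier (quotient)"
  "carrier (quotient) = laurent_module.span (quotient) UNIV [coset 1]"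
proof -
  interpret Q: laurent_module "quotient" by (rule laurent_module_quotient)
  show sub: "set [coset 1] \<subseteq> carrier (quotient)" by (simp add: carrier_quotient)
  have "coset f \<in> Q.span UNIV [coset 1]" for f
    using Q.span_gen[OF _ sub, of UNIV "coset 1" f] by (simp add: coset_smult)
  then show "carrier (quotient) = Q.span UNIV [coset 1]"
    using Q.span_closed[OF sub, of UNIV] by (auto simp: carrier_quotient)
qed

lemma coset_closed: "coset f \<in> carrier (quotient)"
  by (simp add: carrier_quotient)

lemma half_module_quotient: "Module.module (half_space_ring (half_space v)) (quotient)"
proof -
  interpret Q: laurent_module "quotient" by (rule laurent_module_quotient)
  show ?thesis
    by (rule Module.moduleI[OF cring_half_space_ring Q.M.abelian_group_axioms])
       (simp_all add: half_space_ring_sel Q.laurent_add_smult Q.laurent_smult_add Q.laurent_mult_smult)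
qed

text \<open>
  In the chain of cosets of polynomials below the levels \<open>k c\<close>, stationarity at \<open>N\<close> makes a
  monomial at level \<open>(N + 1) c\<close> congruent to a polynomial of strictly lower level.
\<close>

lemma half_unit_if_half_noetherian:
  assumes v: "norm v = 1"
    and noeth: "noetherian_module (half_space_ring (half_space v)) (quotient)"
  shows "\<exists>g\<in>strict_laurents v. 1 - g \<in> p"
proof -
  interpret Q: laurent_module "quotient" by (rule laurent_module_quotient)
  interpret QH: Module.module "half_space_ring (half_space v)" "quotient"
    by (rule half_module_quotient)
  obtain w :: "int ^ 'd" where w: "lattice_point w \<bullet> v \<ge> 1" by (rule exists_high_lattice_point[OF v])
  define c where "c = lattice_point w \<bullet> v"
  define A where "A k = {n. lattice_point n \<bullet> v \<le> real k * c}" for k :: nat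
  define C where "C k = coset ` laurents_in (A k)" for k
  have c: "c \<ge> 1" using w by (simp add: c_def)
  have "submodule (C k) (half_space_ring (half_space v)) (quotient)" for k
  proof (rule QH.submoduleI)
    show "C k \<subseteq> carrier (quotient)" using coset_closed by (auto simp: C_def)
    have "coset 0 \<in> C k" unfolding C_def by (rule imageI[OF laurents_in_zero])
    moreover have "coset 0 = \<zero>\<^bsub>quotient\<^esub>"
      using Q.laurent_zero_smult[OF coset_closed, of 0] by (simp add: coset_smult)
    ultimately show "\<zero>\<^bsub>quotient\<^esub> \<in> C k" by simp
  next
    fix x assume "x \<in> C k"
    then obtain f where f: "f \<in> laurents_in (A k)" "x = coset f" unfolding C_def by blast
    have "\<ominus>\<^bsub>quotient\<^esub> x = coset (- f)"
      unfolding f(2) using Q.laurent_uminus_eq[OF coset_closed, of f] by (simp add: coset_smult)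
    then show "\<ominus>\<^bsub>quotient\<^esub> x \<in> C k"
      using laurents_in_uminus[OF f(1)] by (simp add: C_def)
  next
    fix x y assume "x \<in> C k" "y \<in> C k"
    then obtain f g where "f \<in> laurents_in (A k)" "x = coset f" "g \<in> laurents_in (A k)" "y = coset g"
      unfolding C_def by blast
    then show "x \<oplus>\<^bsub>quotient\<^esub> y \<in> C k"
      using laurents_in_add[of f "A k" g] by (simp add: C_def coset_add)
  next
    fix h x assume h: "h \<in> carrier (half_space_ring (half_space v))" and "x \<in> C k"
    then obtain f where f: "f \<in> laurents_in (A k)" "x = coset f" unfolding C_def by blast
    have "h * f \<in> laurents_in (A k)"
      by (rule laurents_in_mult[OF h[unfolded half_space_ring_sel] f(1)])
         (simp add: half_lattice_def A_def lattice_point_add inner_add_left)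
    then show "h \<odot>\<^bsub>quotient\<^esub> x \<in> C k" by (simp add: C_def f(2) coset_smult)
  qed
  moreover have "C k \<subseteq> C (Suc k)" for k
  proof -
    have "A k \<subseteq> A (Suc k)" using c by (auto simp: A_def algebra_simps)
    then show ?thesis unfolding C_def by (intro image_mono laurents_in_mono)
  qed
  ultimately have "\<exists>N. \<forall>k\<ge>N. C k = C N" by (rule noetherian_module.ascending_chain[OF noeth])
  then obtain N where "\<forall>k\<ge>N. C k = C N" by (rule exE)
  then have CN: "C (Suc N) = C N" by (rule allE[of _ "Suc N"]) simp
  define n :: "int ^ 'd" where "n = (\<chi> i. int (Suc N) * w $ i)"
  have "lattice_point n = real (Suc N) *\<^sub>R lattice_point w"
    by (simp add: n_def lattice_point_def vec_eq_iff)
  then have nv: "lattice_point n \<bullet> v = real (Suc N) * c" by (simp only: c_def inner_scaleR_left)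
  then have "coset (laurent_monom n) \<in> C (Suc N)"
    unfolding C_def by (intro imageI laurents_in_monom) (simp add: A_def)
  then have "coset (laurent_monom n) \<in> C N" unfolding CN .
  then obtain f where f: "f \<in> laurents_in (A N)" "coset (laurent_monom n) = coset f" unfolding C_def by blast
  have "(laurent_monom n - f) * laurent_monom (- n) \<in> p"
    using I_r_closed[of "laurent_monom n - f" "laurent_monom (- n)"] f(2) by (simp add: laurent_ring_sel coset_eq_iff)
  then have "1 - f * laurent_monom (- n) \<in> p"
    by (simp add: left_diff_distrib laurent_monom_mult laurent_monom_zero)
  moreover have "f * laurent_monom (- n) \<in> strict_laurents v"
  proof (rule laurents_in_mult[OF f(1) laurents_in_monom[of "- n" "{- n}"]])
    fix k m assume "k \<in> A N" "m \<in> {- n}"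
    then have "lattice_point (k + m) \<bullet> v \<le> real N * c - real (Suc N) * c"
      by (simp add: A_def lattice_point_diff inner_diff_left nv)
    also have "\<dots> < 0" using c by (simp add: algebra_simps)
    finally show "k + m \<in> strict_half_lattice v" by (simp add: strict_half_lattice_def)
  qed simp
  ultimately show ?thesis by blast
qed

text \<open>
  Submodules over the half-space ring turn out to be submodules over the full ring, and the cyclic
  module embeds into the Noetherian module \<open>M\<close>.
\<close>

lemma half_noetherian_if_half_unit:
  fixes M :: "('d laurent, 'm) module"
  assumes noeth: "noetherian_module laurent_ring M" and m: "m \<in> carrier M"
    and pm: "p = {f. f \<odot>\<^bsub>M\<^esub> m = \<zero>\<^bsub>M\<^esub>}"
    and g: "g \<in> strict_laurents v" "1 - g \<in> p"
  shows "noetherian_module (half_space_ring (half_space v)) (quotient)"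
proof -
  interpret M: laurent_module M by (rule laurent_module_if_noetherian[OF noeth])
  interpret QH: Module.module "half_space_ring (half_space v)" "quotient"
    by (rule half_module_quotient)
  have pr: "f * h \<in> p" if "f \<in> p" for f h using I_r_closed[of f h] that by (simp add: laurent_ring_sel)
  show ?thesis
  proof (intro noetherian_module.intro half_module_quotient noetherian_module_axioms.intro)
    fix C :: "nat \<Rightarrow> 'd laurent set set"
    assume C: "\<And>k. submodule (C k) (half_space_ring (half_space v)) (quotient)"
      and inc: "\<And>k. C k \<subseteq> C (Suc k)"
    \<comment> \<open>As g acts as the identity, f acts like a polynomial supported in the half-space.\<close>
    have closed: "coset (f * h) \<in> C k" if h: "coset h \<in> C k" for f h k
    proof -
      have "\<exists>u\<in>laurents_in (half_lattice v). f - u \<in> p" by (rule half_representative[OF g]) (rule pr)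
      then obtain u where u: "u \<in> laurents_in (half_lattice v)" "f - u \<in> p" by (rule bexE)
      have "(f - u) * h \<in> p" by (rule pr[OF u(2)])
      then have "coset (f * h) = coset (u * h)" unfolding coset_eq_iff by (simp add: algebra_simps)
      also have "\<dots> = u \<odot>\<^bsub>quotient\<^esub> coset h" by (simp add: coset_smult)
      also have "\<dots> \<in> C k" by (rule QH.submoduleE(4)[OF C _ h]) (simp add: half_space_ring_sel u(1))
      finally show ?thesis .
    qed
    define D where "D k = {f \<odot>\<^bsub>M\<^esub> m |f. coset f \<in> C k}" for k
    have "submodule (D k) laurent_ring M" for k
    proof (rule M.laurent_submoduleI)
      show "D k \<subseteq> carrier M" using m by (auto simp: D_def)
      have "\<zero>\<^bsub>quotient\<^esub> \<in> C k"
        using subgroup.one_closed[OF submodule.axioms(1)[OF C]] by simp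
      moreover have "coset 0 = \<zero>\<^bsub>quotient\<^esub>"
        unfolding coset_zero_iff using m by (simp add: pm)
      ultimately have "0 \<odot>\<^bsub>M\<^esub> m \<in> D k" unfolding D_def by (intro CollectI exI[of _ 0]) simp
      then show "\<zero>\<^bsub>M\<^esub> \<in> D k" using m by simp
    next
      fix x y assume x: "x \<in> D k" and y: "y \<in> D k"
      obtain f where f: "x = f \<odot>\<^bsub>M\<^esub> m" "coset f \<in> C k" using x unfolding D_def by blast
      obtain h where h: "y = h \<odot>\<^bsub>M\<^esub> m" "coset h \<in> C k" using y unfolding D_def by blast
      have "coset (f + h) \<in> C k" using QH.submoduleE(5)[OF C f(2) h(2)] by (simp add: coset_add)
      moreover have "x \<oplus>\<^bsub>M\<^esub> y = (f + h) \<odot>\<^bsub>M\<^esub> m" using m by (simp add: f(1) h(1) M.laurent_add_smult)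
      ultimately show "x \<oplus>\<^bsub>M\<^esub> y \<in> D k" unfolding D_def by blast
    next
      fix h x assume x: "x \<in> D k"
      obtain f where f: "x = f \<odot>\<^bsub>M\<^esub> m" "coset f \<in> C k" using x unfolding D_def by blast
      have "h \<odot>\<^bsub>M\<^esub> x = (h * f) \<odot>\<^bsub>M\<^esub> m" using m by (simp add: f(1) M.laurent_mult_smult)
      then show "h \<odot>\<^bsub>M\<^esub> x \<in> D k" unfolding D_def using closed[OF f(2), of h] by blast
    qed
    moreover have "D k \<subseteq> D (Suc k)" for k using inc unfolding D_def by blast
    ultimately have "\<exists>N. \<forall>k\<ge>N. D k = D N" by (rule noetherian_module.ascending_chain[OF noeth])
    then obtain N where N: "\<forall>k\<ge>N. D k = D N" by (rule exE)
    have sub: "C k \<subseteq> C j" if D: "D k = D j" for k j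
    proof
      fix x assume x: "x \<in> C k"
      then have "x \<in> carrier (quotient)" using QH.submoduleE(1)[OF C] by blast
      then obtain f where f: "x = coset f" unfolding carrier_quotient by blast
      have "f \<odot>\<^bsub>M\<^esub> m \<in> D k" unfolding D_def using x f by blast
      then have "f \<odot>\<^bsub>M\<^esub> m \<in> D j" unfolding D .
      then obtain h where h: "f \<odot>\<^bsub>M\<^esub> m = h \<odot>\<^bsub>M\<^esub> m" "coset h \<in> C j" unfolding D_def by blast
      have "f - h \<in> p" using M.laurent_smult_eq_iff[OF m, of f h] h(1) by (simp add: pm)
      then have "coset f = coset h" by (simp add: coset_eq_iff)
      then show "x \<in> C j" using f h(2) by simp
    qed
    have "C k = C N" if "k \<ge> N" for k
    proof -
      have "D k = D N" by (rule N[THEN spec, THEN mp, OF that])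
      then show ?thesis using sub[of k N] sub[of N k] by (intro equalityI) simp_all
    qed
    then show "\<exists>N. \<forall>k\<ge>N. C k = C N" by blast
  qed
qed

end

section \<open>Reduction to associated primes\<close>

context laurent_module begin

lemma expansive_iff_half_condition:
  assumes v: "norm v = 1" and gen: "set ms \<subseteq> carrier M" "carrier M = span UNIV ms"
  shows "expansive_along (dual_space M) (dual_action M) (half_space v) \<longleftrightarrow> half_condition v annihilator"
proof
  assume "expansive_along (dual_space M) (dual_action M) (half_space v)"
  then show "half_condition v annihilator"
    by (intro half_condition_if_character_expansive[OF v gen] expansive_imp_character_expansive[OF v])
next
  have "countable (carrier M)" unfolding gen(2) by (rule countable_span[OF countable_laurent])
  moreover assume "half_condition v annihilator"
  ultimately show "expansive_along (dual_space M) (dual_action M) (half_space v)"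
    by (intro character_expansive_imp_expansive character_expansive_if_half_condition[OF v gen])
qed

lemma half_condition_annihilator_iff:
  assumes noeth: "noetherian_module laurent_ring M"
  shows "half_condition v annihilator \<longleftrightarrow> (\<forall>p\<in>associated_primes laurent_ring M. half_condition v p)"
proof
  assume cond: "half_condition v annihilator"
  show "\<forall>p\<in>associated_primes laurent_ring M. half_condition v p"
  proof
    fix p assume "p \<in> associated_primes laurent_ring M"
    then have sub: "annihilator \<subseteq> p" by (auto simp: associated_primes_def annihilator_def laurent_ring_sel)
    then have "laurent_variety p \<subseteq> laurent_variety annihilator" by (auto simp: laurent_variety_def)
    then show "half_condition v p" using cond sub unfolding half_condition_def by blast
  qed
next
  assume cond: "\<forall>p\<in>associated_primes laurent_ring M. half_condition v p"
  let ?I = "strict_laurents v"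
  have "half_units v \<inter> annihilator \<noteq> {}"
  proof (rule annihilator_meets[OF noeth half_units_one half_units_mult])
    fix p assume "p \<in> associated_primes laurent_ring M"
    then have "half_condition v p" using cond by blast
    then show "half_units v \<inter> p \<noteq> {}" unfolding half_condition_def half_units_def by blast
  qed
  then have unit: "\<exists>g\<in>?I. 1 - g \<in> annihilator" unfolding half_units_def by blast
  have off_ray: "log_abs z \<notin> {t *\<^sub>R v |t. t \<ge> 0}" if z: "z \<in> laurent_variety annihilator" for z
  proof
    assume on_ray: "log_abs z \<in> {t *\<^sub>R v |t. t \<ge> 0}"
    let ?Z = "{f. laurent_eval f z \<noteq> 0}"
    have z0: "z $ i \<noteq> 0" for i using z by (simp add: laurent_variety_def)
    have "?Z \<inter> annihilator \<noteq> {}"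
    proof (rule annihilator_meets[OF noeth])
      show "1 \<in> ?Z" by (simp add: laurent_eval_one)
      show "s * t \<in> ?Z" if "s \<in> ?Z" "t \<in> ?Z" for s t using that by (simp add: laurent_eval_mult[OF z0])
      fix p assume "p \<in> associated_primes laurent_ring M"
      then have "half_condition v p" using cond by blast
      then have "z \<notin> laurent_variety p" using on_ray unfolding half_condition_def by blast
      then show "?Z \<inter> p \<noteq> {}" using z0 by (auto simp: laurent_variety_def)
    qed
    then show False using z by (auto simp: laurent_variety_def)
  qed
  have "{t *\<^sub>R v |t. t \<ge> 0} \<inter> log_abs ` laurent_variety annihilator = {}" by (rule disjoint_imageI[OF off_ray])
  then show "half_condition v annihilator" using unit unfolding half_condition_def by (rule conjI[rotated])
qed

end

theorem theorem4p9:
  fixes M :: "(('d::finite) laurent, 'm) module"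
    and H :: "(real ^ 'd) set" and v :: "real ^ 'd"
  assumes "noetherian_module laurent_ring M"
    and "norm v = 1" and "H = half_space v"
  shows "(expansive_along (dual_space M) (dual_action M) H
      \<longleftrightarrow> (\<forall>p \<in> associated_primes laurent_ring M.
             expansive_along (dual_space (quotient_module laurent_ring p))
               (dual_action (quotient_module laurent_ring p)) H))
    \<and> ((\<forall>p \<in> associated_primes laurent_ring M.
             expansive_along (dual_space (quotient_module laurent_ring p))
               (dual_action (quotient_module laurent_ring p)) H)
      \<longleftrightarrow> (\<forall>p \<in> associated_primes laurent_ring M.
             noetherian_module (half_space_ring H) (quotient_module laurent_ring p)
             \<and> {t *\<^sub>R v | t. t \<ge> 0} \<inter> log_abs ` laurent_variety p = {}))"
proof -
  interpret laurent_module M by (rule laurent_module_if_noetherian[OF assms(1)])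
  obtain ms where ms: "set ms \<subseteq> carrier M" "carrier M = span UNIV ms"
    by (rule noetherian_finitely_generated[OF assms(1)])
  have quotient: "expansive_along (dual_space (quotient_module laurent_ring p)) (dual_action (quotient_module laurent_ring p)) H
        \<longleftrightarrow> half_condition v p"
      "noetherian_module (half_space_ring H) (quotient_module laurent_ring p)
        \<longleftrightarrow> (\<exists>g\<in>strict_laurents v. 1 - g \<in> p)"
    if p: "p \<in> associated_primes laurent_ring M" for p
  proof -
    have "\<exists>m\<in>carrier M. p = {f. f \<odot>\<^bsub>M\<^esub> m = \<zero>\<^bsub>M\<^esub>}"
      using p by (simp add: associated_primes_def laurent_ring_sel)
    then obtain m where m: "m \<in> carrier M" "p = {f. f \<odot>\<^bsub>M\<^esub> m = \<zero>\<^bsub>M\<^esub>}" by (rule bexE)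
    have id: "ideal p laurent_ring" using annihilator_of_element_ideal[OF m(1)] m(2) by simp
    show "expansive_along (dual_space (quotient_module laurent_ring p)) (dual_action (quotient_module laurent_ring p)) H
        \<longleftrightarrow> half_condition v p"
      using laurent_module.expansive_iff_half_condition[OF laurent_module_quotient[OF id] assms(2) quotient_generated[OF id]]
      unfolding annihilator_quotient[OF id] assms(3) .
    show "noetherian_module (half_space_ring H) (quotient_module laurent_ring p)
        \<longleftrightarrow> (\<exists>g\<in>strict_laurents v. 1 - g \<in> p)"
      unfolding assms(3)
      using half_unit_if_half_noetherian[OF id assms(2)] half_noetherian_if_half_unit[OF id assms(1) m] by blast
  qed
  have "expansive_along (dual_space M) (dual_action M) H
      \<longleftrightarrow> (\<forall>p\<in>associated_primes laurent_ring M. half_condition v p)"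
    unfolding assms(3) expansive_iff_half_condition[OF assms(2) ms] by (rule half_condition_annihilator_iff[OF assms(1)])
  moreover have "half_condition v p \<longleftrightarrow> noetherian_module (half_space_ring H) (quotient_module laurent_ring p)
      \<and> {t *\<^sub>R v | t. t \<ge> 0} \<inter> log_abs ` laurent_variety p = {}"
    if "p \<in> associated_primes laurent_ring M" for p
    unfolding half_condition_def quotient(2)[OF that] ..
  ultimately show ?thesis using quotient(1) by simp
qed

end
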